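(* Let $W=(W(t))_{t\in\mathbb{R}}$ be a standard Brownian motion on the real line, let $\alpha,\sigma>0$, and let $X$ be the stationary Ornstein-Uhlenbeck process $$X(t)=\sqrt{2\alpha}\,\sigma\int_{-\infty}^t e^{-\alpha(t-s)}\,dW(s),\quad t\in\mathbb{R}.$$ Then $X$ is the only $L^2$-bounded solution of $$dX(t)=-\alpha X(t)\,dt+\sqrt{2\alpha}\,\sigma\,dW(t),\quad t\in\mathbb{R}, \qquad ( * )$$ and $X$ is Gaussian with mean $0$ and $\operatorname{Cov}(X(t),X(t+\tau))=\sigma^2e^{-\alpha\tau}$ for all $t\in\mathbb{R}$, $\tau\ge0$. Moreover: (a) For every Borel measure $\mu$ on $\mathbb{R}$ such that $\mu(\mathbb{R})=\infty$, $\mu(I)<\infty$ for every bounded interval $I$, and $\liminf_{r\to\infty}\frac{\mu([0,r])}{\mu([-r,r])}>0$, the process $X$ is not square-mean $\mu$-pseudo almost automorphic; thus $( * )$ has no square-mean $\mu$-pseudo almost automorphic solution. (b) $X$ is neither Weyl-like nor Besicovitch-like square-mean pseudo almost automorphic. (c) For every Borel measure $\mu$ on $\mathbb{R}$ as in (a), and for every Borel measure $\nu$ on $[0,1]$ with $0<\nu([0,1])<\infty$, the process $X$ is not square-mean $\mathbb{S}^2_\nu$-$\mu$-pseudo almost automorphic.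
   Context: Let $(\Omega,\mathcal{F},\mathrm{P})$ be the underlying probability space and $L^2=L^2(\Omega,\mathrm{P},\mathbb{R})$ with norm $\|U\|=(\mathrm{E}|U|^2)^{1/2}$. Processes are viewed as maps $\mathbb{R}\to L^2$. Square-mean $\mu$-pseudo almost automorphy: a continuous map $\varphi:\mathbb{R}\to E$ into a metrizable space $E$ is almost automorphic if every real sequence $(t'_n)$ has a subsequence $(t_n)$ such that for every $t\in\mathbb{R}$ the limit $\psi(t)=\lim_n\varphi(t+t_n)$ exists and $\lim_n\psi(t-t_n)=\varphi(t)$. A process $X$ is square-mean $\mu$-pseudo almost automorphic if $X=Y+Z$, where $Y:\mathbb{R}\to L^2$ is almost automorphic and $Z:\mathbb{R}\to L^2$ is bounded and continuous with $\lim_{r\to\infty}\frac{1}{\mu([-r,r])}\int_{[-r,r]}\|Z(t)\|\,d\mu(t)=0$. Seminorms: for $h:\mathbb{R}\to L^2$ and $t\in\mathbb{R}$ put $$|h|_{\mathbb{S}^2_\nu}(t)=\Bigl(\int_0^1\|h(t+s)\|^2\,d\nu(s)\Bigr)^{1/2},\qquad \|h\|_{\mathbb{S}^2_\nu}=\sup_{t\in\mathbb{R}}|h|_{\mathbb{S}^2_\nu}(t),$$ $$|h|_{\mathbb{W}^2}(t)=\lim_{r\to+\infty}\Bigl(\frac1{2r}\int_{t-r}^{t+r}\|h(s)\|^2ds\Bigr)^{1/2},\qquad \|h\|_{\mathbb{W}^2}=\lim_{r\to+\infty}\sup_{x\in\mathbb{R}}\Bigl(\frac1{2r}\int_{x-r}^{x+r}\|h(s)\|^2ds\Bigr)^{1/2},$$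 $$|h|_{\mathbb{B}^2}(t)=\|h\|_{\mathbb{B}^2}=\limsup_{r\to+\infty}\Bigl(\frac1{2r}\int_{-r}^{r}\|h(s)\|^2ds\Bigr)^{1/2}\quad\text{for all }t.$$ Let $N$ be one of $\mathbb{S}^2_\nu,\mathbb{W}^2,\mathbb{B}^2$. A locally square-integrable $Y:\mathbb{R}\to L^2$ (integrability being with respect to $\nu$ on translates of $[0,1]$ when $N=\mathbb{S}^2_\nu$) is $N$-almost automorphic if $\|Y\|_N<\infty$ and every real sequence has a subsequence $(t_n)$ and a locally square-integrable $g:\mathbb{R}\to L^2$ such that, for all $t\in\mathbb{R}$, $\lim_n|Y(\cdot+t_n)-g|_N(t)=0$ and $\lim_n|g(\cdot-t_n)-Y|_N(t)=0$. A map $Z:\mathbb{R}\to L^2$ is $N$-$\mu$-ergodic if $\|Z\|_N<\infty$ and $\lim_{r\to\infty}\frac1{\mu([-r,r])}\int_{[-r,r]}|Z|_N(t)\,d\mu(t)=0$ (and, for $N=\mathbb{S}^2_\nu$, $t\mapsto Z(t+\cdot)$ is continuous from $\mathbb{R}$ to $L^2([0,1],\nu;L^2)$). A process $X$ is square-mean $\mathbb{S}^2_\nu$-$\mu$-pseudo almost automorphic (respectively Weyl-like, Besicovitch-like square-mean pseudo almost automorphic) if $X=Y+Z$ with $Y$ $N$-almost automorphic and $Z$ $N$-$\mu$-ergodic, for $N=\mathbb{S}^2_\nu$ (respectively $N=\mathbb{W}^2$, $N=\mathbb{B}^2$). In the Weyl and Besicovitch cases $|Z|_N(t)$ does not depend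 on $t$, so the ergodicity condition means $|Z|_N=0$ and does not depend on $\mu$ (one may take Lebesgue measure). *)

theory Defs
  imports "HOL-Probability.Probability"
begin

section \<open>Square-integrable random variables\<close>

text \<open>
  Elements of \<open>L\<^sup>2(\<Omega>, P, \<real>)\<close> are represented by random variables, so equality in \<open>L\<^sup>2\<close> is
  almost sure equality, and a map \<open>\<real> \<rightarrow> L\<^sup>2\<close> is a family of representatives.
\<close>

definition sq_int :: "'a measure \<Rightarrow> ('a \<Rightarrow> real) \<Rightarrow> bool" where
  "sq_int M U \<longleftrightarrow> U \<in> borel_measurable M \<and> integrable M (\<lambda>\<omega>. (U \<omega>)\<^sup>2)"

definition l2norm :: "'a measure \<Rightarrow> ('a \<Rightarrow> real) \<Rightarrow> real" where
  "l2norm M U = sqrt (\<integral>\<omega>. (U \<omega>)\<^sup>2 \<partial>M)"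

definition l2dist :: "'a measure \<Rightarrow> ('a \<Rightarrow> real) \<Rightarrow> ('a \<Rightarrow> real) \<Rightarrow> real" where
  "l2dist M U V = l2norm M (\<lambda>\<omega>. U \<omega> - V \<omega>)"

definition l2_process :: "'a measure \<Rightarrow> (real \<Rightarrow> 'a \<Rightarrow> real) \<Rightarrow> bool" where
  "l2_process M X \<longleftrightarrow> (\<forall>t. sq_int M (X t))"

definition l2_bounded :: "'a measure \<Rightarrow> (real \<Rightarrow> 'a \<Rightarrow> real) \<Rightarrow> bool" where
  "l2_bounded M X \<longleftrightarrow> l2_process M X \<and> (\<exists>B. \<forall>t. l2norm M (X t) \<le> B)"

definition l2_continuous :: "'a measure \<Rightarrow> (real \<Rightarrow> 'a \<Rightarrow> real) \<Rightarrow> bool" where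
  "l2_continuous M X \<longleftrightarrow>
     l2_process M X \<and> (\<forall>t. ((\<lambda>s. l2dist M (X s) (X t)) \<longlongrightarrow> 0) (at t))"

definition shift :: "real \<Rightarrow> (real \<Rightarrow> 'b) \<Rightarrow> real \<Rightarrow> 'b" where
  "shift u h = (\<lambda>s. h (s + u))"

definition pdiff :: "(real \<Rightarrow> 'a \<Rightarrow> real) \<Rightarrow> (real \<Rightarrow> 'a \<Rightarrow> real) \<Rightarrow> real \<Rightarrow> 'a \<Rightarrow> real" where
  "pdiff g h = (\<lambda>s \<omega>. g s \<omega> - h s \<omega>)"

text \<open>\<open>X = Y + Z\<close> as maps into \<open>L\<^sup>2\<close>.\<close>

definition is_sum :: "'a measure \<Rightarrow> (real \<Rightarrow> 'a \<Rightarrow> real) \<Rightarrow> (real \<Rightarrow> 'a \<Rightarrow> real)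
    \<Rightarrow> (real \<Rightarrow> 'a \<Rightarrow> real) \<Rightarrow> bool" where
  "is_sum M X Y Z \<longleftrightarrow> (\<forall>t. AE \<omega> in M. X t \<omega> = Y t \<omega> + Z t \<omega>)"


section \<open>Brownian motion on the line and the Wiener integral\<close>

definition brownian_motion :: "'a measure \<Rightarrow> (real \<Rightarrow> 'a \<Rightarrow> real) \<Rightarrow> bool" where
  "brownian_motion M W \<longleftrightarrow>
     (\<forall>t. W t \<in> borel_measurable M) \<and>
     (AE \<omega> in M. W 0 \<omega> = 0) \<and>
     (\<forall>s t. s < t \<longrightarrow>
        distributed M lborel (\<lambda>\<omega>. W t \<omega> - W s \<omega>) (normal_density 0 (sqrt (t - s)))) \<and>
     (\<forall>(n::nat) \<tau>. mono_on {..n} \<tau> \<longrightarrow>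
        prob_space.indep_vars M (\<lambda>_. borel) (\<lambda>i \<omega>. W (\<tau> (Suc i)) \<omega> - W (\<tau> i) \<omega>) {..<n}) \<and>
     (AE \<omega> in M. continuous_on UNIV (\<lambda>t. W t \<omega>))"

text \<open>A triple \<open>(c, a, b)\<close> with \<open>a \<le> b\<close> stands for the function \<open>c\<close> on \<open>(a, b]\<close>, zero elsewhere.\<close>

definition step_fun :: "(real \<times> real \<times> real) list \<Rightarrow> real \<Rightarrow> real" where
  "step_fun S x = (\<Sum>(c, a, b)\<leftarrow>S. c * indicator {a<..b} x)"

definition step_integral ::
    "(real \<Rightarrow> 'a \<Rightarrow> real) \<Rightarrow> (real \<times> real \<times> real) list \<Rightarrow> 'a \<Rightarrow> real" where
  "step_integral W S \<omega> = (\<Sum>(c, a, b)\<leftarrow>S. c * (W b \<omega> - W a \<omega>))"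

text \<open>
  The integral of a deterministic \<open>f \<in> L\<^sup>2(\<real>)\<close> is the \<open>L\<^sup>2(P)\<close>-limit of the integrals of step
  functions converging to \<open>f\<close> in \<open>L\<^sup>2(\<real>)\<close>; by the Ito isometry it does not depend, up to null
  sets, on the approximating sequence.
\<close>

definition has_wiener_integral :: "'a measure \<Rightarrow> (real \<Rightarrow> 'a \<Rightarrow> real) \<Rightarrow> (real \<Rightarrow> real)
    \<Rightarrow> ('a \<Rightarrow> real) \<Rightarrow> bool" where
  "has_wiener_integral M W f I \<longleftrightarrow>
     f \<in> borel_measurable borel \<and> sq_int M I \<and>
     (\<exists>S :: nat \<Rightarrow> (real \<times> real \<times> real) list.
        (\<forall>n. \<forall>(c, a, b)\<in>set (S n). a \<le> b) \<and>
        (\<lambda>n. \<integral>\<^sup>+x. ennreal ((f x - step_fun (S n) x)\<^sup>2) \<partial>lborel) \<longlonglongrightarrow> 0 \<and>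
        (\<lambda>n. l2dist M I (step_integral W (S n))) \<longlonglongrightarrow> 0)"

definition wiener_integral :: "'a measure \<Rightarrow> (real \<Rightarrow> 'a \<Rightarrow> real) \<Rightarrow> (real \<Rightarrow> real)
    \<Rightarrow> 'a \<Rightarrow> real" where
  "wiener_integral M W f = (SOME I. has_wiener_integral M W f I)"

text \<open>
  \<open>X\<close> solves \<open>dX = p X dt + q dW\<close> on \<open>\<real>\<close>. As \<open>X\<close> is a map into \<open>L\<^sup>2\<close>, its values are only given
  almost surely for each \<open>t\<close>, and the equation is required of a version with continuous paths.
  The noise being additive, the equation needs no adaptedness, and none is imposed: uniqueness
  holds among all solutions, and the stationary solution is adapted by construction.
\<close>

definition sde_solution :: "'a measure \<Rightarrow> (real \<Rightarrow> 'a \<Rightarrow> real) \<Rightarrow> real \<Rightarrow> real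
    \<Rightarrow> (real \<Rightarrow> 'a \<Rightarrow> real) \<Rightarrow> bool" where
  "sde_solution M W p q X \<longleftrightarrow>
     (\<forall>t. X t \<in> borel_measurable M) \<and>
     (\<exists>X'. (\<forall>t. X' t \<in> borel_measurable M) \<and>
        (\<forall>t. AE \<omega> in M. X' t \<omega> = X t \<omega>) \<and>
        (AE \<omega> in M. continuous_on UNIV (\<lambda>t. X' t \<omega>) \<and>
           (\<forall>s t. s \<le> t \<longrightarrow>
              X' t \<omega> - X' s \<omega> = integral {s..t} (\<lambda>r. p * X' r \<omega>) + q * (W t \<omega> - W s \<omega>))))"

definition gaussian_rv :: "'a measure \<Rightarrow> ('a \<Rightarrow> real) \<Rightarrow> bool" where
  "gaussian_rv M U \<longleftrightarrow>
     U \<in> borel_measurable M \<and>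
     ((\<exists>m s. s > 0 \<and> distributed M lborel U (normal_density m s)) \<or>
      (\<exists>m. AE \<omega> in M. U \<omega> = m))"

definition gaussian_process :: "'a measure \<Rightarrow> (real \<Rightarrow> 'a \<Rightarrow> real) \<Rightarrow> bool" where
  "gaussian_process M X \<longleftrightarrow>
     (\<forall>J c. finite J \<longrightarrow> gaussian_rv M (\<lambda>\<omega>. \<Sum>t\<in>J. c t * X t \<omega>))"

definition expect :: "'a measure \<Rightarrow> ('a \<Rightarrow> real) \<Rightarrow> real" where
  "expect M U = (\<integral>\<omega>. U \<omega> \<partial>M)"

definition covariance :: "'a measure \<Rightarrow> ('a \<Rightarrow> real) \<Rightarrow> ('a \<Rightarrow> real) \<Rightarrow> real" where
  "covariance M U V = expect M (\<lambda>\<omega>. (U \<omega> - expect M U) * (V \<omega> - expect M V))"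


section \<open>Square-mean pseudo almost automorphy\<close>

definition admissible_measure :: "real measure \<Rightarrow> bool" where
  "admissible_measure \<mu> \<longleftrightarrow>
     sets \<mu> = sets borel \<and> emeasure \<mu> UNIV = \<infinity> \<and>
     (\<forall>I. is_interval I \<and> bounded I \<longrightarrow> emeasure \<mu> I < \<infinity>) \<and>
     Liminf at_top (\<lambda>r::real. emeasure \<mu> {0..r} / emeasure \<mu> {-r..r}) > 0"

definition mean_zero :: "real measure \<Rightarrow> (real \<Rightarrow> ennreal) \<Rightarrow> bool" where
  "mean_zero \<mu> \<phi> \<longleftrightarrow>
     ((\<lambda>r. (\<integral>\<^sup>+t\<in>{-r..r}. \<phi> t \<partial>\<mu>) / emeasure \<mu> {-r..r}) \<longlongrightarrow> 0) at_top"

definition sm_almost_automorphic :: "'a measure \<Rightarrow> (real \<Rightarrow> 'a \<Rightarrow> real) \<Rightarrow> bool" where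
  "sm_almost_automorphic M Y \<longleftrightarrow>
     l2_continuous M Y \<and>
     (\<forall>t' :: nat \<Rightarrow> real. \<exists>\<rho> G. strict_mono \<rho> \<and> l2_process M G \<and>
        (\<forall>t. (\<lambda>n. l2dist M (Y (t + t' (\<rho> n))) (G t)) \<longlonglongrightarrow> 0 \<and>
             (\<lambda>n. l2dist M (G (t - t' (\<rho> n))) (Y t)) \<longlonglongrightarrow> 0))"

definition sm_ergodic :: "'a measure \<Rightarrow> real measure \<Rightarrow> (real \<Rightarrow> 'a \<Rightarrow> real) \<Rightarrow> bool" where
  "sm_ergodic M \<mu> Z \<longleftrightarrow>
     l2_bounded M Z \<and> l2_continuous M Z \<and> mean_zero \<mu> (\<lambda>t. ennreal (l2norm M (Z t)))"

definition sm_pseudo_almost_automorphic ::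
    "'a measure \<Rightarrow> real measure \<Rightarrow> (real \<Rightarrow> 'a \<Rightarrow> real) \<Rightarrow> bool" where
  "sm_pseudo_almost_automorphic M \<mu> X \<longleftrightarrow>
     l2_process M X \<and>
     (\<exists>Y Z. is_sum M X Y Z \<and> sm_almost_automorphic M Y \<and> sm_ergodic M \<mu> Z)"


section \<open>Stepanov, Weyl and Besicovitch seminorms\<close>

definition ennreal_sqrt :: "ennreal \<Rightarrow> ennreal" where
  "ennreal_sqrt x = (if x = \<infinity> then \<infinity> else ennreal (sqrt (enn2real x)))"

text \<open>
  \<open>h \<in> L\<^sup>2(m; L\<^sup>2(\<Omega>))\<close> in the sense of Bochner: \<open>h\<close> is an \<open>m\<close>-almost everywhere limit of simple
  functions with values in \<open>L\<^sup>2(\<Omega>)\<close>, and its norm is square-integrable.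
\<close>

definition bochner_l2 :: "'a measure \<Rightarrow> real measure \<Rightarrow> (real \<Rightarrow> 'a \<Rightarrow> real) \<Rightarrow> bool" where
  "bochner_l2 M m h \<longleftrightarrow>
     (\<forall>s\<in>space m. sq_int M (h s)) \<and>
     (\<exists>F :: nat \<Rightarrow> real \<Rightarrow> 'a \<Rightarrow> real.
        (\<forall>n. simple_function m (F n) \<and> (\<forall>s\<in>space m. sq_int M (F n s))) \<and>
        (AE s in m. (\<lambda>n. l2dist M (F n s) (h s)) \<longlonglongrightarrow> 0)) \<and>
     (\<integral>\<^sup>+s. ennreal ((l2norm M (h s))\<^sup>2) \<partial>m) < \<infinity>"

definition loc_sq_int :: "'a measure \<Rightarrow> (real \<Rightarrow> 'a \<Rightarrow> real) \<Rightarrow> bool" where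
  "loc_sq_int M h \<longleftrightarrow> (\<forall>a b. bochner_l2 M (restrict_space lborel {a..b}) h)"

definition loc_sq_int_stepanov ::
    "'a measure \<Rightarrow> real measure \<Rightarrow> (real \<Rightarrow> 'a \<Rightarrow> real) \<Rightarrow> bool" where
  "loc_sq_int_stepanov M \<nu> h \<longleftrightarrow> (\<forall>t. bochner_l2 M \<nu> (shift t h))"

text \<open>In the Stepanov case \<open>\<nu>\<close> is a measure whose underlying space is \<open>[0, 1]\<close>.\<close>

definition stepanov_at ::
    "'a measure \<Rightarrow> real measure \<Rightarrow> (real \<Rightarrow> 'a \<Rightarrow> real) \<Rightarrow> real \<Rightarrow> ennreal" where
  "stepanov_at M \<nu> h t = ennreal_sqrt (\<integral>\<^sup>+s. ennreal ((l2norm M (h (t + s)))\<^sup>2) \<partial>\<nu>)"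

definition stepanov_norm ::
    "'a measure \<Rightarrow> real measure \<Rightarrow> (real \<Rightarrow> 'a \<Rightarrow> real) \<Rightarrow> ennreal" where
  "stepanov_norm M \<nu> h = (SUP t. stepanov_at M \<nu> h t)"

definition quad_mean :: "'a measure \<Rightarrow> (real \<Rightarrow> 'a \<Rightarrow> real) \<Rightarrow> real \<Rightarrow> real \<Rightarrow> ennreal" where
  "quad_mean M h x r =
     ennreal_sqrt ((\<integral>\<^sup>+s\<in>{x - r..x + r}. ennreal ((l2norm M (h s))\<^sup>2) \<partial>lborel) / ennreal (2 * r))"

text \<open>
  The limits in the Weyl seminorms are taken as upper limits, which makes them defined for every
  \<open>h\<close>. They are the limits whenever these exist. The limit in \<open>weyl_norm\<close> always does, but the
  one in \<open>weyl_at\<close> need not; requiring its existence would only make the classes below smaller.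
\<close>

definition weyl_at :: "'a measure \<Rightarrow> (real \<Rightarrow> 'a \<Rightarrow> real) \<Rightarrow> real \<Rightarrow> ennreal" where
  "weyl_at M h t = Limsup at_top (\<lambda>r. quad_mean M h t r)"

definition weyl_norm :: "'a measure \<Rightarrow> (real \<Rightarrow> 'a \<Rightarrow> real) \<Rightarrow> ennreal" where
  "weyl_norm M h = Limsup at_top (\<lambda>r. SUP x. quad_mean M h x r)"

definition besicovitch_norm :: "'a measure \<Rightarrow> (real \<Rightarrow> 'a \<Rightarrow> real) \<Rightarrow> ennreal" where
  "besicovitch_norm M h = Limsup at_top (\<lambda>r. quad_mean M h 0 r)"

definition besicovitch_at :: "'a measure \<Rightarrow> (real \<Rightarrow> 'a \<Rightarrow> real) \<Rightarrow> real \<Rightarrow> ennreal" where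
  "besicovitch_at M h t = besicovitch_norm M h"


section \<open>Generalised pseudo almost automorphy\<close>

text \<open>
  \<open>L\<close> is the relevant local square-integrability, \<open>N_at h t\<close> and \<open>N h\<close> are \<open>|h|\<^sub>N(t)\<close> and \<open>\<parallel>h\<parallel>\<^sub>N\<close>.
  Local square-integrability of \<open>Z\<close> in \<open>N_ergodic\<close> is what gives a meaning to its seminorms.
\<close>

definition N_almost_automorphic :: "((real \<Rightarrow> 'a \<Rightarrow> real) \<Rightarrow> bool)
    \<Rightarrow> ((real \<Rightarrow> 'a \<Rightarrow> real) \<Rightarrow> real \<Rightarrow> ennreal) \<Rightarrow> ((real \<Rightarrow> 'a \<Rightarrow> real) \<Rightarrow> ennreal)
    \<Rightarrow> (real \<Rightarrow> 'a \<Rightarrow> real) \<Rightarrow> bool" where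
  "N_almost_automorphic L N_at N Y \<longleftrightarrow>
     L Y \<and> N Y < \<infinity> \<and>
     (\<forall>t' :: nat \<Rightarrow> real. \<exists>\<rho> g. strict_mono \<rho> \<and> L g \<and>
        (\<forall>t. (\<lambda>n. N_at (pdiff (shift (t' (\<rho> n)) Y) g) t) \<longlonglongrightarrow> 0 \<and>
             (\<lambda>n. N_at (pdiff (shift (- t' (\<rho> n)) g) Y) t) \<longlonglongrightarrow> 0))"

definition N_ergodic :: "((real \<Rightarrow> 'a \<Rightarrow> real) \<Rightarrow> bool)
    \<Rightarrow> ((real \<Rightarrow> 'a \<Rightarrow> real) \<Rightarrow> real \<Rightarrow> ennreal) \<Rightarrow> ((real \<Rightarrow> 'a \<Rightarrow> real) \<Rightarrow> ennreal)
    \<Rightarrow> real measure \<Rightarrow> (real \<Rightarrow> 'a \<Rightarrow> real) \<Rightarrow> bool" where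
  "N_ergodic L N_at N \<mu> Z \<longleftrightarrow> L Z \<and> N Z < \<infinity> \<and> mean_zero \<mu> (N_at Z)"

definition stepanov_continuous ::
    "'a measure \<Rightarrow> real measure \<Rightarrow> (real \<Rightarrow> 'a \<Rightarrow> real) \<Rightarrow> bool" where
  "stepanov_continuous M \<nu> Z \<longleftrightarrow>
     (\<forall>t. ((\<lambda>u. stepanov_at M \<nu> (pdiff (shift u Z) (shift t Z)) 0) \<longlongrightarrow> 0) (at t))"

definition stepanov_pseudo_almost_automorphic ::
    "'a measure \<Rightarrow> real measure \<Rightarrow> real measure \<Rightarrow> (real \<Rightarrow> 'a \<Rightarrow> real) \<Rightarrow> bool" where
  "stepanov_pseudo_almost_automorphic M \<nu> \<mu> X \<longleftrightarrow>
     l2_process M X \<and>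
     (\<exists>Y Z. is_sum M X Y Z \<and>
        N_almost_automorphic (loc_sq_int_stepanov M \<nu>) (stepanov_at M \<nu>) (stepanov_norm M \<nu>) Y \<and>
        N_ergodic (loc_sq_int_stepanov M \<nu>) (stepanov_at M \<nu>) (stepanov_norm M \<nu>) \<mu> Z \<and>
        stepanov_continuous M \<nu> Z)"

definition weyl_pseudo_almost_automorphic ::
    "'a measure \<Rightarrow> (real \<Rightarrow> 'a \<Rightarrow> real) \<Rightarrow> bool" where
  "weyl_pseudo_almost_automorphic M X \<longleftrightarrow>
     l2_process M X \<and>
     (\<exists>Y Z. is_sum M X Y Z \<and>
        N_almost_automorphic (loc_sq_int M) (weyl_at M) (weyl_norm M) Y \<and>
        N_ergodic (loc_sq_int M) (weyl_at M) (weyl_norm M) lborel Z)"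

definition besicovitch_pseudo_almost_automorphic ::
    "'a measure \<Rightarrow> (real \<Rightarrow> 'a \<Rightarrow> real) \<Rightarrow> bool" where
  "besicovitch_pseudo_almost_automorphic M X \<longleftrightarrow>
     l2_process M X \<and>
     (\<exists>Y Z. is_sum M X Y Z \<and>
        N_almost_automorphic (loc_sq_int M) (besicovitch_at M) (besicovitch_norm M) Y \<and>
        N_ergodic (loc_sq_int M) (besicovitch_at M) (besicovitch_norm M) lborel Z)"

end

(*
Brownian increments of disjoint intervals are orthogonal, so the Wiener integral is an isometry and
X(t) = q e^{-\<alpha> t} (C + e^{\<alpha> t} W(t) - \<alpha> P(t)), where q = sqrt (2 \<alpha>) \<sigma> and
P'(s) = e^{\<alpha> s} W(s), is a pathwise solution; the difference of two solutions is a multiple of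
e^{-\<alpha> t}, which forces uniqueness among L2-bounded ones.

The covariance gives |X(s) - X(t)| >= c > 0 in L2 whenever |s - t| >= 1, with c independent of s and t.
If X = Y + Z with Z ergodic, then Z is small in the relevant seminorm at points t_n -> \<infinity>, and along
a subsequence the translates of Y by t_n converge in that seminorm. So the translates of X by t_n
would form a Cauchy sequence, which the lower bound c forbids.
*)
theory Submission
  imports Defs
begin

text \<open>All four notions are refuted by one argument for an abstract seminorm at the origin.
  With g the limit of the translates of Y, X(s+u) - X(s+v) = Z(s+u) - Z(s+v) + (Y(s+u) - g(s)) -
  (Y(s+v) - g(s)) has four terms, hence the thresholds c/4. The lower bound c holds for all s with
  the same u and v, so it survives integration over s. The points t_n exist because the liminf
  condition and the infinite total mass put a fixed share of the mass of [-r, r] into every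
  half-line [T, \<infinity>), where Z therefore cannot stay large. Two obstacles shape the rest. The
  seminorms integrate norms that are measurable only up to null sets, so strong measurability has to
  supply measurable versions before integrals are added or translated. And
  \<open>wiener_integral\<close> is a choice, so existence must be proved: Riemann sums converge
  pathwise after summation by parts, and the isometry upgrades this to L2 convergence. The
  antiderivative P is picked path by path, so measurability is obtained only for the combinations
  with W that arise as limits of Riemann sums.\<close>

section \<open>The space of square-integrable functions\<close>

lemma sq_int_measurable: "sq_int M U \<Longrightarrow> U \<in> borel_measurable M"
  by (simp add: sq_int_def)

lemma l2norm_nonneg [simp]: "0 \<le> l2norm M U"
  by (simp add: l2norm_def)

lemma l2norm_power2: "(l2norm M U)\<^sup>2 = (\<integral>\<omega>. (U \<omega>)\<^sup>2 \<partial>M)"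
  by (simp add: l2norm_def)

lemma l2dist_nonneg [simp]: "0 \<le> l2dist M U V"
  by (simp add: l2dist_def)

lemma l2dist_commute: "l2dist M U V = l2dist M V U"
  by (simp add: l2dist_def l2norm_def power2_commute)

lemma sq_int_integrable_mult:
  assumes "sq_int M U" "sq_int M V"
  shows "integrable M (\<lambda>\<omega>. U \<omega> * V \<omega>)"
proof (rule Bochner_Integration.integrable_bound)
  show "integrable M (\<lambda>\<omega>. (U \<omega>)\<^sup>2 + (V \<omega>)\<^sup>2)"
    using assms by (simp add: sq_int_def)
  have "\<bar>x * y\<bar> \<le> x\<^sup>2 + y\<^sup>2" for x y :: real
  proof -
    have "0 \<le> (\<bar>x\<bar> - \<bar>y\<bar>)\<^sup>2" by simp
    then have "2 * (\<bar>x\<bar> * \<bar>y\<bar>) \<le> x\<^sup>2 + y\<^sup>2" by (simp add: power2_diff)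
    moreover have "0 \<le> \<bar>x\<bar> * \<bar>y\<bar>" by simp
    ultimately show ?thesis unfolding abs_mult by linarith
  qed
  then show "AE \<omega> in M. norm (U \<omega> * V \<omega>) \<le> norm ((U \<omega>)\<^sup>2 + (V \<omega>)\<^sup>2)"
    by simp
next
  have [measurable]: "U \<in> borel_measurable M" "V \<in> borel_measurable M"
    using assms by (simp_all add: sq_int_def)
  show "(\<lambda>\<omega>. U \<omega> * V \<omega>) \<in> borel_measurable M" by measurable
qed

lemma sq_int_add:
  assumes "sq_int M U" "sq_int M V"
  shows "sq_int M (\<lambda>\<omega>. U \<omega> + V \<omega>)"
  using assms sq_int_integrable_mult[OF assms]
  by (auto simp: sq_int_def power2_sum mult.assoc)

lemma sq_int_cmult: "sq_int M U \<Longrightarrow> sq_int M (\<lambda>\<omega>. c * U \<omega>)"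
  by (auto simp: sq_int_def power_mult_distrib)

lemma sq_int_diff: "sq_int M U \<Longrightarrow> sq_int M V \<Longrightarrow> sq_int M (\<lambda>\<omega>. U \<omega> - V \<omega>)"
  using sq_int_add[of M U "\<lambda>\<omega>. -1 * V \<omega>"] sq_int_cmult[of M V "-1"] by simp

lemma sq_int_zero [simp]: "sq_int M (\<lambda>\<omega>. 0)"
  by (simp add: sq_int_def)

lemma sq_int_cong_AE:
  assumes "sq_int M U" "V \<in> borel_measurable M" "AE \<omega> in M. U \<omega> = V \<omega>"
  shows "sq_int M V"
proof -
  have "integrable M (\<lambda>\<omega>. (V \<omega>)\<^sup>2)"
    by (rule integrable_cong_AE_imp[of M "\<lambda>\<omega>. (U \<omega>)\<^sup>2"])
       (use assms in \<open>auto simp: sq_int_def\<close>)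
  with assms show ?thesis by (simp add: sq_int_def)
qed

lemma l2norm_cong_AE:
  assumes "U \<in> borel_measurable M" "V \<in> borel_measurable M" "AE \<omega> in M. U \<omega> = V \<omega>"
  shows "l2norm M U = l2norm M V"
  unfolding l2norm_def
  by (rule arg_cong[of _ _ sqrt], rule integral_cong_AE) (use assms in auto)

lemma l2norm_cmult: "l2norm M (\<lambda>\<omega>. c * U \<omega>) = \<bar>c\<bar> * l2norm M U"
  by (simp add: l2norm_def power_mult_distrib real_sqrt_mult)

lemma l2_cauchy_schwarz:
  assumes U: "sq_int M U" and V: "sq_int M V"
  shows "\<bar>\<integral>\<omega>. U \<omega> * V \<omega> \<partial>M\<bar> \<le> l2norm M U * l2norm M V"
proof -
  let ?a = "\<integral>\<omega>. (U \<omega>)\<^sup>2 \<partial>M" and ?b = "\<integral>\<omega>. U \<omega> * V \<omega> \<partial>M" and ?c = "\<integral>\<omega>. (V \<omega>)\<^sup>2 \<partial>M"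
  have int: "integrable M (\<lambda>\<omega>. (U \<omega>)\<^sup>2)" "integrable M (\<lambda>\<omega>. (V \<omega>)\<^sup>2)"
    "integrable M (\<lambda>\<omega>. U \<omega> * V \<omega>)"
    using U V sq_int_integrable_mult[OF U V] by (simp_all add: sq_int_def)
  \<comment> \<open>The second moment of x U + y V is a nonnegative quadratic form in x and y. Its
    value at (\<open>?c\<close>, \<open>- ?b\<close>) is \<open>?c * (?a * ?c - ?b\<^sup>2)\<close>,
    which settles the case of nonzero \<open>?c\<close>.\<close>
  have pos: "0 \<le> ?a * x\<^sup>2 + 2 * ?b * x * y + ?c * y\<^sup>2" for x y
  proof -
    have "0 \<le> (\<integral>\<omega>. (x * U \<omega> + y * V \<omega>)\<^sup>2 \<partial>M)" by simp
    also have "\<dots> = (\<integral>\<omega>. x\<^sup>2 * (U \<omega>)\<^sup>2 + (2 * x * y) * (U \<omega> * V \<omega>) + y\<^sup>2 * (V \<omega>)\<^sup>2 \<partial>M)"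
      by (intro Bochner_Integration.integral_cong) (auto simp: power2_sum power_mult_distrib algebra_simps)
    also have "\<dots> = ?a * x\<^sup>2 + 2 * ?b * x * y + ?c * y\<^sup>2"
      using int by simp
    finally show ?thesis .
  qed
  have a: "0 \<le> ?a" and c: "0 \<le> ?c" by simp_all
  have "?b\<^sup>2 \<le> ?a * ?c"
  proof (cases "?c = 0")
    case True
    have "?b = 0"
    proof (rule ccontr)
      assume "?b \<noteq> 0"
      \<comment> \<open>With \<open>?c = 0\<close> the form is affine in y, and this y gives it the
        value -1.\<close>
      with pos[of 1 "- (?a + 1) / (2 * ?b)"] True show False by (simp add: field_simps)
    qed
    then show ?thesis by (simp add: True)
  next
    case False
    have "0 \<le> ?c * (?a * ?c - ?b\<^sup>2)"
      using pos[of ?c "- ?b"] by (simp add: power2_eq_square algebra_simps)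
    moreover have "0 < ?c" using False c by linarith
    ultimately have "0 \<le> ?a * ?c - ?b\<^sup>2" by (simp only: zero_le_mult_iff) linarith
    then show ?thesis by linarith
  qed
  then have "sqrt (?b\<^sup>2) \<le> sqrt (?a * ?c)" by (rule real_sqrt_le_mono)
  then show ?thesis by (simp add: l2norm_def real_sqrt_mult)
qed

lemma l2norm_triangle:
  assumes U: "sq_int M U" and V: "sq_int M V"
  shows "l2norm M (\<lambda>\<omega>. U \<omega> + V \<omega>) \<le> l2norm M U + l2norm M V"
proof (rule power2_le_imp_le)
  have "(l2norm M (\<lambda>\<omega>. U \<omega> + V \<omega>))\<^sup>2 = (\<integral>\<omega>. (U \<omega>)\<^sup>2 + 2 * (U \<omega> * V \<omega>) + (V \<omega>)\<^sup>2 \<partial>M)"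
    by (simp add: l2norm_power2 power2_sum algebra_simps)
  also have "\<dots> = (l2norm M U)\<^sup>2 + 2 * (\<integral>\<omega>. U \<omega> * V \<omega> \<partial>M) + (l2norm M V)\<^sup>2"
    using U V sq_int_integrable_mult[OF U V] by (simp add: l2norm_power2 sq_int_def)
  also have "\<dots> \<le> (l2norm M U + l2norm M V)\<^sup>2"
    using l2_cauchy_schwarz[OF U V] by (simp add: power2_sum)
  finally show "(l2norm M (\<lambda>\<omega>. U \<omega> + V \<omega>))\<^sup>2 \<le> (l2norm M U + l2norm M V)\<^sup>2" .
qed simp

lemma l2norm_uminus: "l2norm M (\<lambda>\<omega>. - U \<omega>) = l2norm M U"
  using l2norm_cmult[of M "-1" U] by simp

lemma l2norm_diff_le:
  assumes "sq_int M U" "sq_int M V"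
  shows "l2norm M (\<lambda>\<omega>. U \<omega> - V \<omega>) \<le> l2norm M U + l2norm M V"
  using l2norm_triangle[OF assms(1) sq_int_cmult[OF assms(2), of "-1"]]
  by (simp add: l2norm_uminus)

lemma l2dist_triangle:
  assumes "sq_int M U" "sq_int M V" "sq_int M T"
  shows "l2dist M U T \<le> l2dist M U V + l2dist M V T"
  using l2norm_triangle[OF sq_int_diff[OF assms(1,2)] sq_int_diff[OF assms(2,3)]]
  by (simp add: l2dist_def)

lemma l2dist_lincomb_le:
  assumes "sq_int N U" "sq_int N U'" "sq_int N V" "sq_int N V'"
  shows "l2dist N (\<lambda>x. c * U x + d * V x) (\<lambda>x. c * U' x + d * V' x)
    \<le> \<bar>c\<bar> * l2dist N U U' + \<bar>d\<bar> * l2dist N V V'"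
proof -
  have "(\<lambda>x. c * U x + d * V x - (c * U' x + d * V' x)) = (\<lambda>x. c * (U x - U' x) + d * (V x - V' x))"
    by (auto simp: algebra_simps)
  then show ?thesis
    using l2norm_triangle[OF sq_int_cmult[OF sq_int_diff[OF assms(1,2)], of c]
        sq_int_cmult[OF sq_int_diff[OF assms(3,4)], of d]]
    by (simp add: l2dist_def l2norm_cmult)
qed

lemma l2norm_mono:
  assumes "U \<in> borel_measurable M" "sq_int M V" "\<And>x. \<bar>U x\<bar> \<le> \<bar>V x\<bar>"
  shows "l2norm M U \<le> l2norm M V"
proof -
  have le: "(U x)\<^sup>2 \<le> (V x)\<^sup>2" for x using assms(3)[of x] by (rule abs_le_square_iff[THEN iffD1])
  have V: "integrable M (\<lambda>x. (V x)\<^sup>2)" using assms(2) by (simp add: sq_int_def)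
  have "integrable M (\<lambda>x. (U x)\<^sup>2)"
    by (rule Bochner_Integration.integrable_bound[OF V]) (use assms(1) le in auto)
  with V le show ?thesis
    unfolding l2norm_def by (intro real_sqrt_le_mono integral_mono)
qed

lemma l2norm_le_l2dist:
  assumes "sq_int M U" "sq_int M V"
  shows "\<bar>l2norm M U - l2norm M V\<bar> \<le> l2dist M U V"
  using l2dist_triangle[OF assms sq_int_zero] l2dist_triangle[OF assms(2,1) sq_int_zero]
  by (simp add: l2dist_commute[of M V U]) (simp add: l2dist_def abs_le_iff)

lemma tendsto_l2norm:
  assumes "\<And>n. sq_int M (U n)" "sq_int M V" "((\<lambda>n. l2dist M (U n) V) \<longlongrightarrow> 0) F"
  shows "((\<lambda>n. l2norm M (U n)) \<longlongrightarrow> l2norm M V) F"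
  by (rule Lim_null[THEN iffD2], rule Lim_null_comparison[OF _ assms(3)])
     (use l2norm_le_l2dist[OF assms(1,2)] in \<open>auto intro!: always_eventually\<close>)

lemma tendsto_l2_inner:
  assumes U: "\<And>n. sq_int M (U n)" "sq_int M U'" "(\<lambda>n. l2dist M (U n) U') \<longlonglongrightarrow> 0"
    and V: "\<And>n. sq_int M (V n)" "sq_int M V'" "(\<lambda>n. l2dist M (V n) V') \<longlonglongrightarrow> 0"
  shows "(\<lambda>n. \<integral>\<omega>. U n \<omega> * V n \<omega> \<partial>M) \<longlonglongrightarrow> (\<integral>\<omega>. U' \<omega> * V' \<omega> \<partial>M)"
proof (rule Lim_null[THEN iffD2], rule Lim_null_comparison)
  show "\<forall>\<^sub>F n in sequentially. norm ((\<integral>\<omega>. U n \<omega> * V n \<omega> \<partial>M) - (\<integral>\<omega>. U' \<omega> * V' \<omega> \<partial>M))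
      \<le> l2dist M (U n) U' * l2norm M (V n) + l2norm M U' * l2dist M (V n) V'"
  proof (intro always_eventually allI)
    fix n
    note int = sq_int_integrable_mult[OF U(1)[of n] V(1)[of n]] sq_int_integrable_mult[OF U(2) V(1)[of n]]
      sq_int_integrable_mult[OF U(2) V(2)]
    have "(\<integral>\<omega>. U n \<omega> * V n \<omega> \<partial>M) - (\<integral>\<omega>. U' \<omega> * V' \<omega> \<partial>M)
       = (\<integral>\<omega>. (U n \<omega> - U' \<omega>) * V n \<omega> \<partial>M) + (\<integral>\<omega>. U' \<omega> * (V n \<omega> - V' \<omega>) \<partial>M)"
      using int by (simp add: algebra_simps)
    also have "\<bar>\<dots>\<bar> \<le> l2dist M (U n) U' * l2norm M (V n) + l2norm M U' * l2dist M (V n) V'"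
      unfolding l2dist_def
      by (rule order_trans[OF abs_triangle_ineq], intro add_mono l2_cauchy_schwarz sq_int_diff U V)
    finally show "norm ((\<integral>\<omega>. U n \<omega> * V n \<omega> \<partial>M) - (\<integral>\<omega>. U' \<omega> * V' \<omega> \<partial>M))
      \<le> l2dist M (U n) U' * l2norm M (V n) + l2norm M U' * l2dist M (V n) V'" by simp
  qed
  show "(\<lambda>n. l2dist M (U n) U' * l2norm M (V n) + l2norm M U' * l2dist M (V n) V') \<longlonglongrightarrow> 0"
    by (rule tendsto_eq_intros U V tendsto_l2norm[OF V] | simp)+
qed

lemma l2norm_eq_0_AE:
  assumes "sq_int M U" "l2norm M U = 0"
  shows "AE \<omega> in M. U \<omega> = 0"
  using assms integral_nonneg_eq_0_iff_AE[of M "\<lambda>\<omega>. (U \<omega>)\<^sup>2"] by (simp add: sq_int_def l2norm_def)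

lemma nn_integral_l2norm:
  assumes "sq_int M U"
  shows "(\<integral>\<^sup>+\<omega>. ennreal ((U \<omega>)\<^sup>2) \<partial>M) = ennreal ((l2norm M U)\<^sup>2)"
  using assms by (simp add: l2norm_power2 nn_integral_eq_integral sq_int_def)

lemma sq_intI_nn_integral:
  assumes "U \<in> borel_measurable M" "(\<integral>\<^sup>+\<omega>. ennreal ((U \<omega>)\<^sup>2) \<partial>M) < \<infinity>"
  shows "sq_int M U"
  using assms by (simp add: sq_int_def integrable_iff_bounded)

text \<open>Fatou's lemma bounds the distances to the limit by those within the sequence.\<close>

lemma l2_limit_of_AE_limit:
  assumes U: "\<And>n. sq_int M (U n)" and V: "V \<in> borel_measurable M"
    and conv: "AE \<omega> in M. (\<lambda>n. U n \<omega>) \<longlonglongrightarrow> V \<omega>"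
    and cauchy: "\<And>e. 0 < e \<Longrightarrow> \<exists>N. \<forall>m\<ge>N. \<forall>n\<ge>N. l2dist M (U m) (U n) < e"
  shows "sq_int M V" "(\<lambda>n. l2dist M (U n) V) \<longlonglongrightarrow> 0"
proof -
  have [measurable]: "U n \<in> borel_measurable M" for n using U by (simp add: sq_int_def)
  have fatou: "(\<integral>\<^sup>+\<omega>. ennreal ((U m \<omega> - V \<omega>)\<^sup>2) \<partial>M) \<le> ennreal (e\<^sup>2)"
    if "0 < e" and N: "\<forall>m\<ge>N. \<forall>n\<ge>N. l2dist M (U m) (U n) < e" and "m \<ge> N" for e N m
  proof -
    have "(\<integral>\<^sup>+\<omega>. ennreal ((U m \<omega> - V \<omega>)\<^sup>2) \<partial>M)
        = (\<integral>\<^sup>+\<omega>. liminf (\<lambda>n. ennreal ((U m \<omega> - U n \<omega>)\<^sup>2)) \<partial>M)"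
    proof (rule nn_integral_cong_AE, use conv in eventually_elim)
      fix \<omega> assume "(\<lambda>n. U n \<omega>) \<longlonglongrightarrow> V \<omega>"
      then have "(\<lambda>n. ennreal ((U m \<omega> - U n \<omega>)\<^sup>2)) \<longlonglongrightarrow> ennreal ((U m \<omega> - V \<omega>)\<^sup>2)"
        by (intro tendsto_intros tendsto_ennrealI)
      then show "ennreal ((U m \<omega> - V \<omega>)\<^sup>2) = liminf (\<lambda>n. ennreal ((U m \<omega> - U n \<omega>)\<^sup>2))"
        by (rule lim_imp_Liminf[OF sequentially_bot, symmetric])
    qed
    also have "\<dots> \<le> liminf (\<lambda>n. \<integral>\<^sup>+\<omega>. ennreal ((U m \<omega> - U n \<omega>)\<^sup>2) \<partial>M)"
      by (intro nn_integral_liminf) measurable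
    also have "\<dots> \<le> ennreal (e\<^sup>2)"
    proof (rule Liminf_le[OF sequentially_bot], rule eventually_mono[OF eventually_ge_at_top[of N]])
      fix n assume "n \<ge> N"
      have "(\<integral>\<^sup>+\<omega>. ennreal ((U m \<omega> - U n \<omega>)\<^sup>2) \<partial>M) = ennreal ((l2dist M (U m) (U n))\<^sup>2)"
        unfolding l2dist_def by (rule nn_integral_l2norm) (intro sq_int_diff U)
      also have "\<dots> \<le> ennreal (e\<^sup>2)"
        using N \<open>m \<ge> N\<close> \<open>n \<ge> N\<close> by (intro ennreal_leI power_mono) (auto intro: less_imp_le)
      finally show "(\<integral>\<^sup>+\<omega>. ennreal ((U m \<omega> - U n \<omega>)\<^sup>2) \<partial>M) \<le> ennreal (e\<^sup>2)" .
    qed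
    finally show ?thesis .
  qed
  have diff: "sq_int M (\<lambda>\<omega>. U m \<omega> - V \<omega>)"
    if "0 < e" and N: "\<forall>m\<ge>N. \<forall>n\<ge>N. l2dist M (U m) (U n) < e" and "m \<ge> N" for e N m
    using le_less_trans[OF fatou[OF that], of \<infinity>] U[of m] V
    by (intro sq_intI_nn_integral) (auto simp: sq_int_def)
  from cauchy[of 1] obtain N1 where N1: "\<forall>m\<ge>N1. \<forall>n\<ge>N1. l2dist M (U m) (U n) < 1" by auto
  \<comment> \<open>V is \<open>U N1\<close> minus (\<open>U N1\<close> - V), and Fatou has bounded
    the second term.\<close>
  show sqV: "sq_int M V"
    using sq_int_diff[OF U[of N1] diff[of 1 N1 N1]] N1 by simp
  show "(\<lambda>n. l2dist M (U n) V) \<longlonglongrightarrow> 0"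
  proof (rule LIMSEQ_I)
    fix r :: real assume "0 < r"
    then obtain N where N: "\<forall>m\<ge>N. \<forall>n\<ge>N. l2dist M (U m) (U n) < r / 2"
      using cauchy[of "r / 2"] by auto
    have "norm (l2dist M (U m) V - 0) < r" if "m \<ge> N" for m
    proof -
      have "ennreal ((l2dist M (U m) V)\<^sup>2) \<le> ennreal ((r / 2)\<^sup>2)"
        using fatou[OF _ N that] \<open>0 < r\<close> nn_integral_l2norm[OF sq_int_diff[OF U[of m] sqV]]
        by (simp add: l2dist_def)
      then have "(l2dist M (U m) V)\<^sup>2 \<le> (r / 2)\<^sup>2" by (subst (asm) ennreal_le_iff) auto
      then have "l2dist M (U m) V \<le> r / 2" by (rule power2_le_imp_le) (use \<open>0 < r\<close> in simp)
      with \<open>0 < r\<close> show ?thesis by simp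
    qed
    then show "\<exists>N. \<forall>m\<ge>N. norm (l2dist M (U m) V - 0) < r" by blast
  qed
qed

section \<open>From L2 bounds to almost sure convergence\<close>

lemma (in prob_space) sq_int_integrable: "sq_int M U \<Longrightarrow> integrable M U"
  by (simp add: sq_int_def square_integrable_imp_integrable)

lemma (in prob_space) expectation_abs_le_l2norm:
  assumes "sq_int M U"
  shows "expectation (\<lambda>\<omega>. \<bar>U \<omega>\<bar>) \<le> l2norm M U"
proof -
  have "sq_int M (\<lambda>\<omega>. \<bar>U \<omega>\<bar>)" "sq_int M (\<lambda>\<omega>. 1)" using assms by (auto simp: sq_int_def)
  from l2_cauchy_schwarz[OF this] show ?thesis by (simp add: l2norm_def prob_space)
qed

text \<open>The Riesz-Fischer argument: on a probability space the L1 norm is at most the L2 norm,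
  so the sum of the absolute increments has finite expectation and is finite almost surely. Together
  with \<open>l2_limit_of_AE_limit\<close> this stands in for completeness of L2.\<close>

lemma (in prob_space) l2_summable_imp_AE_convergent:
  assumes U: "\<And>n. sq_int M (U n)" and sum: "summable (\<lambda>n. l2dist M (U (Suc n)) (U n))"
  shows "AE \<omega> in M. convergent (\<lambda>n. U n \<omega>)"
proof -
  let ?D = "\<lambda>n \<omega>. \<bar>U (Suc n) \<omega> - U n \<omega>\<bar>"
  have D: "sq_int M (\<lambda>\<omega>. U (Suc n) \<omega> - U n \<omega>)" for n by (intro sq_int_diff U)
  have [measurable]: "U n \<in> borel_measurable M" for n using U by (simp add: sq_int_def)
  have meas: "(\<lambda>\<omega>. ennreal (?D n \<omega>)) \<in> borel_measurable M" for n
    by measurable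
  have "(\<integral>\<^sup>+\<omega>. (\<Sum>n. ennreal (?D n \<omega>)) \<partial>M) = (\<Sum>n. \<integral>\<^sup>+\<omega>. ennreal (?D n \<omega>) \<partial>M)"
    by (rule nn_integral_suminf) (rule meas)
  also have "\<dots> \<le> (\<Sum>n. ennreal (l2dist M (U (Suc n)) (U n)))"
  proof (rule suminf_le)
    fix n
    have "(\<integral>\<^sup>+\<omega>. ennreal (?D n \<omega>) \<partial>M) = ennreal (\<integral>\<omega>. ?D n \<omega> \<partial>M)"
      by (intro nn_integral_eq_integral integrable_abs sq_int_integrable D) simp
    also have "\<dots> \<le> ennreal (l2dist M (U (Suc n)) (U n))"
      unfolding l2dist_def by (intro ennreal_leI expectation_abs_le_l2norm D)
    finally show "(\<integral>\<^sup>+\<omega>. ennreal (?D n \<omega>) \<partial>M) \<le> ennreal (l2dist M (U (Suc n)) (U n))" .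
  qed auto
  also have "\<dots> < \<infinity>"
    using sum by (subst suminf_ennreal2) auto
  finally have "AE \<omega> in M. (\<Sum>n. ennreal (?D n \<omega>)) \<noteq> \<infinity>"
    by (intro nn_integral_PInf_AE borel_measurable_suminf_order meas) auto
  then show ?thesis
  proof eventually_elim
    case (elim \<omega>)
    have "summable (\<lambda>n. ?D n \<omega>)"
      by (rule summable_suminf_not_top) (use elim in auto)
    then have "summable (\<lambda>n. U (Suc n) \<omega> - U n \<omega>)" by (rule summable_rabs_cancel)
    then have "convergent (\<lambda>n. U n \<omega> - U 0 \<omega>)"
      unfolding summable_iff_convergent sum_lessThan_telescope[of "\<lambda>n. U n \<omega>"] .
    then show ?case
      using convergent_diff_const_right_iff by blast
  qed
qed


section \<open>The Wiener integral\<close>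

locale wiener_space = prob_space M for M :: "'a measure" +
  fixes W :: "real \<Rightarrow> 'a \<Rightarrow> real"
  assumes brownian: "brownian_motion M W"
begin

lemma W_measurable [measurable]: "W t \<in> borel_measurable M"
  using brownian by (simp add: brownian_motion_def)

lemma increment_normal:
  "s < t \<Longrightarrow> distributed M lborel (\<lambda>\<omega>. W t \<omega> - W s \<omega>) (normal_density 0 (sqrt (t - s)))"
  using brownian by (simp add: brownian_motion_def)

lemma increment_moments:
  "sq_int M (\<lambda>\<omega>. W b \<omega> - W a \<omega>)"
  "expectation (\<lambda>\<omega>. W b \<omega> - W a \<omega>) = 0"
  "expectation (\<lambda>\<omega>. (W b \<omega> - W a \<omega>)\<^sup>2) = \<bar>b - a\<bar>"
proof -
  have less: "sq_int M (\<lambda>\<omega>. W t \<omega> - W s \<omega>) \<and> expectation (\<lambda>\<omega>. W t \<omega> - W s \<omega>) = 0 \<and>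
     expectation (\<lambda>\<omega>. (W t \<omega> - W s \<omega>)\<^sup>2) = t - s" if "s < t" for s t
  proof -
    note D = increment_normal[OF that]
    have pos: "0 < sqrt (t - s)" using that by simp
    have "integrable M (\<lambda>\<omega>. (W t \<omega> - W s \<omega>)\<^sup>2)"
      using integrable_normal_moment[OF pos, of 0 2]
        distributed_integrable[OF D, of "\<lambda>x. x\<^sup>2"] by simp
    moreover have e: "expectation (\<lambda>\<omega>. W t \<omega> - W s \<omega>) = 0"
      by (rule normal_distributed_expectation[OF pos D])
    moreover have "expectation (\<lambda>\<omega>. (W t \<omega> - W s \<omega>)\<^sup>2) = t - s"
      using normal_distributed_variance[OF pos D] that unfolding e by simp
    ultimately show ?thesis by (simp add: sq_int_def)
  qed
  consider "a < b" | "b < a" | "a = b" by linarith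
  then have "sq_int M (\<lambda>\<omega>. W b \<omega> - W a \<omega>) \<and> expectation (\<lambda>\<omega>. W b \<omega> - W a \<omega>) = 0 \<and>
     expectation (\<lambda>\<omega>. (W b \<omega> - W a \<omega>)\<^sup>2) = \<bar>b - a\<bar>"
  proof cases
    case 2
    have "(\<lambda>\<omega>. W b \<omega> - W a \<omega>) = (\<lambda>\<omega>. -1 * (W a \<omega> - W b \<omega>))" by auto
    moreover have "(\<lambda>\<omega>. (W b \<omega> - W a \<omega>)\<^sup>2) = (\<lambda>\<omega>. (W a \<omega> - W b \<omega>)\<^sup>2)"
      by (simp add: power2_commute)
    ultimately show ?thesis
      using less[OF 2] 2 sq_int_cmult[of M "\<lambda>\<omega>. W a \<omega> - W b \<omega>" "-1"]
      by (simp del: minus_diff_eq)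
  qed (use less in auto)
  then show "sq_int M (\<lambda>\<omega>. W b \<omega> - W a \<omega>)" "expectation (\<lambda>\<omega>. W b \<omega> - W a \<omega>) = 0"
    "expectation (\<lambda>\<omega>. (W b \<omega> - W a \<omega>)\<^sup>2) = \<bar>b - a\<bar>" by auto
qed

text \<open>The covariance of two increments follows from their variances by polarisation, so
  independence is not needed for the isometry.\<close>

lemma increment_covariance:
  assumes "a \<le> b" "a' \<le> b'"
  shows "expectation (\<lambda>\<omega>. (W b \<omega> - W a \<omega>) * (W b' \<omega> - W a' \<omega>))
    = (\<integral>x. indicator {a<..b} x * indicator {a'<..b'} x \<partial>lborel)"
proof -
  have int: "integrable M (\<lambda>\<omega>. (W y \<omega> - W x \<omega>)\<^sup>2)" for x y
    using increment_moments(1)[of y x] by (simp add: sq_int_def)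
  have "expectation (\<lambda>\<omega>. (W b \<omega> - W a \<omega>) * (W b' \<omega> - W a' \<omega>))
    = expectation (\<lambda>\<omega>. ((W b \<omega> - W a' \<omega>)\<^sup>2 + (W a \<omega> - W b' \<omega>)\<^sup>2
        - (W b \<omega> - W b' \<omega>)\<^sup>2 - (W a \<omega> - W a' \<omega>)\<^sup>2) / 2)"
    by (intro Bochner_Integration.integral_cong) (auto simp: power2_eq_square algebra_simps)
  also have "\<dots> = (\<bar>b - a'\<bar> + \<bar>a - b'\<bar> - \<bar>b - b'\<bar> - \<bar>a - a'\<bar>) / 2"
    using int by (simp add: increment_moments(3))
  \<comment> \<open>Half this combination of distances is the length of the overlap of the two
    intervals, and 0 when they are disjoint.\<close>
  also have "\<dots> = measure lborel {max a a'<..min b b'}"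
    using assms by (cases "max a a' \<le> min b b'") (auto simp: min_def max_def split: if_splits)
  also have "\<dots> = (\<integral>x. indicator {max a a'<..min b b'} x \<partial>lborel)" by simp
  also have "\<dots> = (\<integral>x. indicator {a<..b} x * indicator {a'<..b'} x \<partial>lborel)"
    by (intro Bochner_Integration.integral_cong) (auto simp: indicator_def)
  finally show ?thesis .
qed

end

section \<open>Step functions and their integrals\<close>

definition valid_steps :: "(real \<times> real \<times> real) list \<Rightarrow> bool" where
  "valid_steps S \<longleftrightarrow> (\<forall>(c, a, b)\<in>set S. a \<le> b)"

text \<open>The intervals of a list may overlap, so concatenation already represents the sum of step
  functions. With scaling this gives all linear combinations without a common refinement.\<close>

definition scale_steps :: "real \<Rightarrow> (real \<times> real \<times> real) list \<Rightarrow> (real \<times> real \<times> real) list" where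
  "scale_steps k S = map (\<lambda>(c, a, b). (k * c, a, b)) S"

lemma step_fun_simps [simp]:
  "step_fun [] x = 0"
  "step_fun ((c, a, b) # S) x = c * indicator {a<..b} x + step_fun S x"
  "step_fun (S @ T) x = step_fun S x + step_fun T x"
  "step_fun (scale_steps k S) x = k * step_fun S x"
  by (induction S) (auto simp: step_fun_def scale_steps_def algebra_simps)

lemma step_integral_simps [simp]:
  "step_integral W [] \<omega> = 0"
  "step_integral W ((c, a, b) # S) \<omega> = c * (W b \<omega> - W a \<omega>) + step_integral W S \<omega>"
  "step_integral W (S @ T) \<omega> = step_integral W S \<omega> + step_integral W T \<omega>"
  "step_integral W (scale_steps k S) \<omega> = k * step_integral W S \<omega>"
  by (induction S) (auto simp: step_integral_def scale_steps_def algebra_simps)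

lemma valid_steps_simps [simp]:
  "valid_steps []"
  "valid_steps ((c, a, b) # S) \<longleftrightarrow> a \<le> b \<and> valid_steps S"
  "valid_steps (S @ T) \<longleftrightarrow> valid_steps S \<and> valid_steps T"
  "valid_steps (scale_steps k S) \<longleftrightarrow> valid_steps S"
  by (auto simp: valid_steps_def scale_steps_def split: prod.splits)

lemma sq_int_interval: "sq_int lborel (indicator {a<..b} :: real \<Rightarrow> real)"
proof -
  have "(\<lambda>x. (indicator {a<..b} x)\<^sup>2) = (indicator {a<..b} :: real \<Rightarrow> real)"
    by (auto simp: indicator_def)
  then show ?thesis by (cases "a \<le> b") (simp_all add: sq_int_def)
qed

lemma sq_int_step_fun: "sq_int lborel (step_fun S)"
proof (induction S)
  case Nil
  then show ?case by (simp add: step_fun_def)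
next
  case (Cons s S)
  obtain c a b where "s = (c, a, b)" by (cases s)
  then have "step_fun (s # S) = (\<lambda>x. c * indicator {a<..b} x + step_fun S x)" by auto
  with Cons show ?case by (simp add: sq_int_add sq_int_cmult sq_int_interval)
qed

context wiener_space
begin

lemma sq_int_step_integral: "sq_int M (step_integral W S)"
proof (induction S)
  case Nil
  then show ?case by (simp add: step_integral_def)
next
  case (Cons s S)
  obtain c a b where "s = (c, a, b)" by (cases s)
  then have "step_integral W (s # S) = (\<lambda>\<omega>. c * (W b \<omega> - W a \<omega>) + step_integral W S \<omega>)" by auto
  with Cons show ?case by (simp add: sq_int_add sq_int_cmult increment_moments)
qed

lemma expectation_step_integral: "expectation (step_integral W S) = 0"
proof (induction S)
  case Nil
  then show ?case by (simp add: step_integral_def)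
next
  case (Cons s S)
  obtain c a b where "s = (c, a, b)" by (cases s)
  then have "step_integral W (s # S) = (\<lambda>\<omega>. c * (W b \<omega> - W a \<omega>) + step_integral W S \<omega>)" by auto
  then show ?case
    using Cons sq_int_integrable[OF sq_int_step_integral[of S]]
      sq_int_integrable[OF increment_moments(1)] increment_moments(2)
    by (simp del: Bochner_Integration.integral_diff)
qed

text \<open>Both sides are bilinear in the two lists, so one induction over each reduces the claim
  to two single intervals, which is \<open>increment_covariance\<close>. The polarised form of the
  isometry is kept because covariances of X are needed later.\<close>

lemma step_integral_inner:
  assumes "valid_steps S" "valid_steps T"
  shows "expectation (\<lambda>\<omega>. step_integral W S \<omega> * step_integral W T \<omega>)
    = (\<integral>x. step_fun S x * step_fun T x \<partial>lborel)"
proof -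
  have single: "expectation (\<lambda>\<omega>. (W b \<omega> - W a \<omega>) * step_integral W T \<omega>)
    = (\<integral>x. indicator {a<..b} x * step_fun T x \<partial>lborel)" if "a \<le> b" for a b
    using assms(2)
  proof (induction T)
    case Nil
    then show ?case by simp
  next
    case (Cons s T)
    obtain c a' b' where s: "s = (c, a', b')" by (cases s)
    note i1 = sq_int_integrable_mult[OF increment_moments(1)[of b a] sq_int_step_integral[of T]]
      and i2 = sq_int_integrable_mult[OF increment_moments(1)[of b a] increment_moments(1)[of b' a']]
      and i3 = sq_int_integrable_mult[OF sq_int_interval[of a b] sq_int_step_fun[of T]]
      and i4 = sq_int_integrable_mult[OF sq_int_interval[of a b] sq_int_interval[of a' b']]
    have "expectation (\<lambda>\<omega>. (W b \<omega> - W a \<omega>) * step_integral W (s # T) \<omega>)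
      = expectation (\<lambda>\<omega>. c * ((W b \<omega> - W a \<omega>) * (W b' \<omega> - W a' \<omega>))
         + (W b \<omega> - W a \<omega>) * step_integral W T \<omega>)"
      by (simp add: s distrib_left mult.left_commute)
    also have "\<dots> = c * expectation (\<lambda>\<omega>. (W b \<omega> - W a \<omega>) * (W b' \<omega> - W a' \<omega>))
        + expectation (\<lambda>\<omega>. (W b \<omega> - W a \<omega>) * step_integral W T \<omega>)"
      using Bochner_Integration.integral_add[OF integrable_mult_right[OF i2, of c] i1] by simp
    also have "\<dots> = c * (\<integral>x. indicator {a<..b} x * indicator {a'<..b'} x \<partial>lborel)
        + (\<integral>x. indicator {a<..b} x * step_fun T x \<partial>lborel)"
      using Cons s that by (simp add: increment_covariance)
    also have "\<dots> = (\<integral>x. c * (indicator {a<..b} x * indicator {a'<..b'} x)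
        + indicator {a<..b} x * step_fun T x \<partial>lborel)"
      using Bochner_Integration.integral_add[OF integrable_mult_right[OF i4, of c] i3] by simp
    finally show ?case by (simp add: s distrib_left mult.left_commute)
  qed
  show ?thesis
    using assms(1)
  proof (induction S)
    case Nil
    then show ?case by simp
  next
    case (Cons s S)
    obtain c a b where s: "s = (c, a, b)" by (cases s)
    note i1 = sq_int_integrable_mult[OF sq_int_step_integral[of S] sq_int_step_integral[of T]]
      and i2 = sq_int_integrable_mult[OF increment_moments(1)[of b a] sq_int_step_integral[of T]]
      and i3 = sq_int_integrable_mult[OF sq_int_step_fun[of S] sq_int_step_fun[of T]]
      and i4 = sq_int_integrable_mult[OF sq_int_interval[of a b] sq_int_step_fun[of T]]
    have "expectation (\<lambda>\<omega>. step_integral W (s # S) \<omega> * step_integral W T \<omega>)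
      = expectation (\<lambda>\<omega>. c * ((W b \<omega> - W a \<omega>) * step_integral W T \<omega>)
         + step_integral W S \<omega> * step_integral W T \<omega>)"
      by (simp add: s distrib_right mult.assoc)
    also have "\<dots> = c * expectation (\<lambda>\<omega>. (W b \<omega> - W a \<omega>) * step_integral W T \<omega>)
        + expectation (\<lambda>\<omega>. step_integral W S \<omega> * step_integral W T \<omega>)"
      using Bochner_Integration.integral_add[OF integrable_mult_right[OF i2, of c] i1] by simp
    also have "\<dots> = c * (\<integral>x. indicator {a<..b} x * step_fun T x \<partial>lborel)
        + (\<integral>x. step_fun S x * step_fun T x \<partial>lborel)"
      using Cons s by (simp add: single)
    also have "\<dots> = (\<integral>x. c * (indicator {a<..b} x * step_fun T x)
        + step_fun S x * step_fun T x \<partial>lborel)"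
      using Bochner_Integration.integral_add[OF integrable_mult_right[OF i4, of c] i3] by simp
    finally show ?case by (simp add: s distrib_right mult.assoc)
  qed
qed

section \<open>Isometry and closure properties of the Wiener integral\<close>

text \<open>Puts the integrand and the integral on the same footing: both convergences become
  statements about \<open>l2dist\<close>, over \<open>lborel\<close> and over \<open>M\<close>, so
  that the same L2 lemmas serve for both.\<close>

lemma has_wiener_integral_iff:
  "has_wiener_integral M W f I \<longleftrightarrow> sq_int lborel f \<and> sq_int M I \<and>
    (\<exists>S. (\<forall>n. valid_steps (S n)) \<and> (\<lambda>n. l2dist lborel (step_fun (S n)) f) \<longlonglongrightarrow> 0 \<and>
      (\<lambda>n. l2dist M (step_integral W (S n)) I) \<longlonglongrightarrow> 0)"
proof -
  have nn: "(\<integral>\<^sup>+x. ennreal ((f x - step_fun (S n) x)\<^sup>2) \<partial>lborel)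
      = ennreal ((l2dist lborel (step_fun (S n)) f)\<^sup>2)"
    if "sq_int lborel f" for S :: "nat \<Rightarrow> _" and n
    using nn_integral_l2norm[OF sq_int_diff[OF that sq_int_step_fun[of "S n"]]]
    by (simp add: l2dist_commute[of _ _ f]) (simp add: l2dist_def)
  have tends: "((\<lambda>n. \<integral>\<^sup>+x. ennreal ((f x - step_fun (S n) x)\<^sup>2) \<partial>lborel) \<longlonglongrightarrow> 0) \<longleftrightarrow>
      ((\<lambda>n. l2dist lborel (step_fun (S n)) f) \<longlonglongrightarrow> 0)" if "sq_int lborel f" for S
  proof -
    have "((\<lambda>n. (l2dist lborel (step_fun (S n)) f)\<^sup>2) \<longlonglongrightarrow> 0) \<longleftrightarrow>
      ((\<lambda>n. l2dist lborel (step_fun (S n)) f) \<longlonglongrightarrow> 0)"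
      using tendsto_real_sqrt[of "\<lambda>n. (l2dist lborel (step_fun (S n)) f)\<^sup>2" 0 sequentially]
        tendsto_power[of "\<lambda>n. l2dist lborel (step_fun (S n)) f" 0 sequentially 2]
      by auto
    then show ?thesis
      unfolding nn[OF that] by (subst tendsto_ennreal_iff[of _ _ 0, unfolded ennreal_0]) auto
  qed
  \<comment> \<open>The definition asks only for measurability of f; since some step function lies
    at finite distance, f is in L2.\<close>
  have sq: "sq_int lborel f" if f: "f \<in> borel_measurable borel"
    and lim: "(\<lambda>n. \<integral>\<^sup>+x. ennreal ((f x - step_fun (S n) x)\<^sup>2) \<partial>lborel) \<longlonglongrightarrow> 0" for S
  proof -
    have "\<forall>\<^sub>F n in sequentially. (\<integral>\<^sup>+x. ennreal ((f x - step_fun (S n) x)\<^sup>2) \<partial>lborel) < 1"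
      using lim by (rule order_tendstoD) simp
    then obtain n where "(\<integral>\<^sup>+x. ennreal ((f x - step_fun (S n) x)\<^sup>2) \<partial>lborel) < 1"
      by (auto simp: eventually_sequentially)
    then have "sq_int lborel (\<lambda>x. f x - step_fun (S n) x)"
      using f sq_int_measurable[OF sq_int_step_fun[of "S n"]]
      by (intro sq_intI_nn_integral) (auto intro: less_trans)
    from sq_int_add[OF this sq_int_step_fun[of "S n"]] show ?thesis by simp
  qed
  have meas: "f \<in> borel_measurable borel" if "sq_int lborel f"
    using sq_int_measurable[OF that] by simp
  have "f \<in> borel_measurable borel \<and>
      (\<lambda>n. \<integral>\<^sup>+x. ennreal ((f x - step_fun (S n) x)\<^sup>2) \<partial>lborel) \<longlonglongrightarrow> 0 \<longleftrightarrow>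
      sq_int lborel f \<and> (\<lambda>n. l2dist lborel (step_fun (S n)) f) \<longlonglongrightarrow> 0" for S
    using sq[of S] tends[of S] meas by blast
  note eq = this
  \<comment> \<open>Pure logic: one conjunct lies outside the quantifier over S and one inside, so
    the equivalence \<open>eq\<close> cannot be used as a plain rewrite rule.\<close>
  have abstract: "(A \<and> Q \<and> (\<exists>S. V S \<and> B S \<and> E S)) \<longleftrightarrow> (C \<and> Q \<and> (\<exists>S. V S \<and> D S \<and> E S))"
    if "\<And>S. A \<and> B S \<longleftrightarrow> C \<and> D S" for A C Q and B D E V :: "'b \<Rightarrow> bool"
    using that by blast
  show ?thesis
    unfolding has_wiener_integral_def valid_steps_def l2dist_commute[of M I] by (rule abstract, rule eq)
qed

lemma has_wiener_integral_step: "valid_steps S \<Longrightarrow> has_wiener_integral M W (step_fun S) (step_integral W S)"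
  unfolding has_wiener_integral_iff
  by (intro conjI sq_int_step_fun sq_int_step_integral exI[of _ "\<lambda>n. S"])
     (simp_all add: l2dist_def l2norm_def)

lemma has_wiener_integral_sq_int:
  assumes "has_wiener_integral M W f I"
  shows "sq_int lborel f" "sq_int M I"
  using assms by (simp_all add: has_wiener_integral_iff)

lemma wiener_inner:
  assumes f: "has_wiener_integral M W f I" and g: "has_wiener_integral M W g J"
  shows "expectation (\<lambda>\<omega>. I \<omega> * J \<omega>) = (\<integral>x. f x * g x \<partial>lborel)"
proof -
  obtain S where S: "\<And>n. valid_steps (S n)" "(\<lambda>n. l2dist lborel (step_fun (S n)) f) \<longlonglongrightarrow> 0"
    "(\<lambda>n. l2dist M (step_integral W (S n)) I) \<longlonglongrightarrow> 0"
    using f by (auto simp: has_wiener_integral_iff)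
  obtain T where T: "\<And>n. valid_steps (T n)" "(\<lambda>n. l2dist lborel (step_fun (T n)) g) \<longlonglongrightarrow> 0"
    "(\<lambda>n. l2dist M (step_integral W (T n)) J) \<longlonglongrightarrow> 0"
    using g by (auto simp: has_wiener_integral_iff)
  note sq = has_wiener_integral_sq_int[OF f] has_wiener_integral_sq_int[OF g]
  have "(\<lambda>n. expectation (\<lambda>\<omega>. step_integral W (S n) \<omega> * step_integral W (T n) \<omega>))
      \<longlonglongrightarrow> expectation (\<lambda>\<omega>. I \<omega> * J \<omega>)"
    by (intro tendsto_l2_inner sq_int_step_integral sq S T)
  moreover have "(\<lambda>n. \<integral>x. step_fun (S n) x * step_fun (T n) x \<partial>lborel) \<longlonglongrightarrow> (\<integral>x. f x * g x \<partial>lborel)"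
    by (intro tendsto_l2_inner sq_int_step_fun sq S T)
  ultimately show ?thesis
    unfolding step_integral_inner[OF S(1) T(1)] by (rule LIMSEQ_unique)
qed

lemma wiener_isometry:
  "has_wiener_integral M W f I \<Longrightarrow> l2norm M I = l2norm lborel f"
  using wiener_inner[of f I f I] by (simp add: l2norm_def power2_eq_square)

lemma wiener_expectation:
  assumes f: "has_wiener_integral M W f I"
  shows "expectation I = 0"
proof -
  obtain S where S: "(\<lambda>n. l2dist M (step_integral W (S n)) I) \<longlonglongrightarrow> 0"
    using f by (auto simp: has_wiener_integral_iff)
  note sq = has_wiener_integral_sq_int[OF f]
  have "\<bar>expectation I\<bar> \<le> l2dist M (step_integral W (S n)) I" for n
  proof -
    note D = sq_int_diff[OF sq_int_step_integral[of "S n"] sq(2)]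
    have "expectation (\<lambda>\<omega>. step_integral W (S n) \<omega> - I \<omega>) = - expectation I"
      using sq_int_integrable[OF sq(2)] sq_int_integrable[OF sq_int_step_integral[of "S n"]]
      by (simp add: expectation_step_integral)
    moreover have "\<bar>expectation (\<lambda>\<omega>. step_integral W (S n) \<omega> - I \<omega>)\<bar>
        \<le> expectation (\<lambda>\<omega>. \<bar>step_integral W (S n) \<omega> - I \<omega>\<bar>)"
      by (rule integral_abs_bound)
    ultimately show ?thesis
      using expectation_abs_le_l2norm[OF D] by (simp add: l2dist_def)
  qed
  then have "\<bar>expectation I\<bar> \<le> 0"
    by (intro LIMSEQ_le_const[OF S]) auto
  then show ?thesis by simp
qed

lemma has_wiener_integral_lincomb:
  assumes f: "has_wiener_integral M W f I" and g: "has_wiener_integral M W g J"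
  shows "has_wiener_integral M W (\<lambda>x. c * f x + d * g x) (\<lambda>\<omega>. c * I \<omega> + d * J \<omega>)"
proof -
  obtain S where S: "\<And>n. valid_steps (S n)" "(\<lambda>n. l2dist lborel (step_fun (S n)) f) \<longlonglongrightarrow> 0"
    "(\<lambda>n. l2dist M (step_integral W (S n)) I) \<longlonglongrightarrow> 0"
    using f by (auto simp: has_wiener_integral_iff)
  obtain T where T: "\<And>n. valid_steps (T n)" "(\<lambda>n. l2dist lborel (step_fun (T n)) g) \<longlonglongrightarrow> 0"
    "(\<lambda>n. l2dist M (step_integral W (T n)) J) \<longlonglongrightarrow> 0"
    using g by (auto simp: has_wiener_integral_iff)
  note sq = has_wiener_integral_sq_int[OF f] has_wiener_integral_sq_int[OF g]
  let ?R = "\<lambda>n. scale_steps c (S n) @ scale_steps d (T n)"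
  have R: "step_fun (?R n) = (\<lambda>x. c * step_fun (S n) x + d * step_fun (T n) x)"
    "step_integral W (?R n) = (\<lambda>x. c * step_integral W (S n) x + d * step_integral W (T n) x)" for n
    by auto
  have lim: "(\<lambda>n. \<bar>c\<bar> * a n + \<bar>d\<bar> * b n) \<longlonglongrightarrow> 0" if "a \<longlonglongrightarrow> 0" "b \<longlonglongrightarrow> 0" for a b :: "nat \<Rightarrow> real"
    by (rule tendsto_eq_intros that | simp)+
  have "(\<lambda>n. l2dist lborel (step_fun (?R n)) (\<lambda>x. c * f x + d * g x)) \<longlonglongrightarrow> 0"
    unfolding R
    by (rule Lim_null_comparison[OF _ lim[OF S(2) T(2)]])
       (auto intro!: always_eventually l2dist_lincomb_le sq sq_int_step_fun)
  moreover have "(\<lambda>n. l2dist M (step_integral W (?R n)) (\<lambda>x. c * I x + d * J x)) \<longlonglongrightarrow> 0"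
    unfolding R
    by (rule Lim_null_comparison[OF _ lim[OF S(3) T(3)]])
       (auto intro!: always_eventually l2dist_lincomb_le sq sq_int_step_integral)
  ultimately show ?thesis
    unfolding has_wiener_integral_iff using S(1) T(1)
    by (intro conjI exI[of _ ?R] sq_int_add sq_int_cmult sq) auto
qed

lemma has_wiener_integral_cong_AE:
  assumes f: "has_wiener_integral M W f I" and J: "J \<in> borel_measurable M"
    and eq: "AE \<omega> in M. I \<omega> = J \<omega>"
  shows "has_wiener_integral M W f J"
proof -
  note sq = has_wiener_integral_sq_int[OF f]
  have "l2dist M (step_integral W S) I = l2dist M (step_integral W S) J" for S
    unfolding l2dist_def using eq sq_int_measurable[OF sq(2)] J
      sq_int_measurable[OF sq_int_step_integral[of S]]
    by (intro l2norm_cong_AE) (measurable, auto)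
  with f show ?thesis
    using sq_int_cong_AE[OF sq(2) J eq] by (simp add: has_wiener_integral_iff)
qed

text \<open>The difference of two candidates is an integral of the zero function, so the isometry
  gives it norm 0. Hence the choice made in \<open>wiener_integral\<close> matters only on null
  sets.\<close>

lemma has_wiener_integral_unique:
  assumes "has_wiener_integral M W f I" "has_wiener_integral M W f J"
  shows "AE \<omega> in M. I \<omega> = J \<omega>"
proof -
  have D: "has_wiener_integral M W (\<lambda>x. 1 * f x + -1 * f x) (\<lambda>\<omega>. 1 * I \<omega> + -1 * J \<omega>)"
    by (intro has_wiener_integral_lincomb assms)
  have "l2norm M (\<lambda>\<omega>. 1 * I \<omega> + -1 * J \<omega>) = 0"
    unfolding wiener_isometry[OF D] by (simp add: l2norm_def)
  from l2norm_eq_0_AE[OF has_wiener_integral_sq_int(2)[OF D] this] show ?thesis by auto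
qed

lemma wiener_l2dist:
  assumes "has_wiener_integral M W f I" "has_wiener_integral M W g J"
  shows "l2dist M I J = l2dist lborel f g"
  using wiener_isometry[OF has_wiener_integral_lincomb[OF assms, of 1 "-1"]] by (simp add: l2dist_def)

text \<open>Diagonal argument: the n-th integrand is replaced by a step function that is within
  1/(n+1) of it and whose integral is within 1/(n+1) of the n-th integral.\<close>

lemma has_wiener_integral_l2_limit:
  assumes I: "\<And>n. has_wiener_integral M W (f n) (I n)"
    and g: "sq_int lborel g" "(\<lambda>n. l2dist lborel (f n) g) \<longlonglongrightarrow> 0"
    and J: "sq_int M J" "(\<lambda>n. l2dist M (I n) J) \<longlonglongrightarrow> 0"
  shows "has_wiener_integral M W g J"
proof -
  note sq = has_wiener_integral_sq_int[OF I]
  have "\<exists>S. valid_steps S \<and> l2dist lborel (step_fun S) (f n) < 1 / Suc n \<and>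
      l2dist M (step_integral W S) (I n) < 1 / Suc n" for n
  proof -
    obtain S where S: "\<And>n. valid_steps (S n)" "(\<lambda>k. l2dist lborel (step_fun (S k)) (f n)) \<longlonglongrightarrow> 0"
      "(\<lambda>k. l2dist M (step_integral W (S k)) (I n)) \<longlonglongrightarrow> 0"
      using I[of n] by (auto simp: has_wiener_integral_iff)
    have "\<forall>\<^sub>F k in sequentially. l2dist lborel (step_fun (S k)) (f n) < 1 / Suc n \<and>
        l2dist M (step_integral W (S k)) (I n) < 1 / Suc n"
      by (intro eventually_conj order_tendstoD(2)[OF S(2)] order_tendstoD(2)[OF S(3)]) simp_all
    then show ?thesis using S(1) by (auto simp: eventually_sequentially)
  qed
  then obtain S where S: "\<And>n. valid_steps (S n)"
    "\<And>n. l2dist lborel (step_fun (S n)) (f n) < 1 / Suc n"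
    "\<And>n. l2dist M (step_integral W (S n)) (I n) < 1 / Suc n"
    by metis
  have lim: "(\<lambda>n. 1 / Suc n + a n) \<longlonglongrightarrow> 0" if "a \<longlonglongrightarrow> 0" for a :: "nat \<Rightarrow> real"
    using tendsto_add[OF LIMSEQ_Suc[OF lim_1_over_n] that] by simp
  have "(\<lambda>n. l2dist lborel (step_fun (S n)) g) \<longlonglongrightarrow> 0"
  proof (rule Lim_null_comparison[OF _ lim[OF g(2)]], intro always_eventually allI)
    fix n show "norm (l2dist lborel (step_fun (S n)) g) \<le> 1 / Suc n + l2dist lborel (f n) g"
      using l2dist_triangle[OF sq_int_step_fun[of "S n"] sq(1)[of n] g(1)] S(2)[of n] by simp
  qed
  moreover have "(\<lambda>n. l2dist M (step_integral W (S n)) J) \<longlonglongrightarrow> 0"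
  proof (rule Lim_null_comparison[OF _ lim[OF J(2)]], intro always_eventually allI)
    fix n show "norm (l2dist M (step_integral W (S n)) J) \<le> 1 / Suc n + l2dist M (I n) J"
      using l2dist_triangle[OF sq_int_step_integral[of "S n"] sq(2)[of n] J(1)] S(3)[of n] by simp
  qed
  ultimately show ?thesis using S(1) g(1) J(1) by (auto simp: has_wiener_integral_iff)
qed

text \<open>The isometry carries the Cauchy property from the integrands to the integrals, and Fatou
  then identifies their almost sure limit as the L2 limit. This is how pathwise formulas become
  Wiener integrals.\<close>

lemma has_wiener_integral_AE_limit:
  assumes I: "\<And>n. has_wiener_integral M W (f n) (I n)"
    and g: "sq_int lborel g" "(\<lambda>n. l2dist lborel (f n) g) \<longlonglongrightarrow> 0"
    and J: "J \<in> borel_measurable M" "AE \<omega> in M. (\<lambda>n. I n \<omega>) \<longlonglongrightarrow> J \<omega>"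
  shows "has_wiener_integral M W g J"
proof -
  note sq = has_wiener_integral_sq_int[OF I]
  have cauchy: "\<exists>N. \<forall>m\<ge>N. \<forall>n\<ge>N. l2dist M (I m) (I n) < e" if "0 < e" for e
  proof -
    have "\<forall>\<^sub>F n in sequentially. l2dist lborel (f n) g < e / 2"
      using that by (intro order_tendstoD(2)[OF g(2)]) simp
    then obtain N where N: "\<And>n. n \<ge> N \<Longrightarrow> l2dist lborel (f n) g < e / 2"
      by (auto simp: eventually_sequentially)
    have "l2dist M (I m) (I n) < e" if "m \<ge> N" "n \<ge> N" for m n
      using l2dist_triangle[OF sq(1)[of m] g(1) sq(1)[of n]] N[OF that(1)] N[OF that(2)]
      by (simp add: wiener_l2dist[OF I I] l2dist_commute[of _ g])
    then show ?thesis by blast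
  qed
  from l2_limit_of_AE_limit[OF sq(2) J cauchy] show ?thesis
    by (intro has_wiener_integral_l2_limit[OF I g])
qed

text \<open>Summable distances make the integrals converge almost surely, so a pointwise
  \<open>lim\<close> provides a measurable candidate.\<close>

lemma has_wiener_integral_exists_limit:
  assumes I: "\<And>n. has_wiener_integral M W (f n) (I n)"
    and g: "sq_int lborel g" "(\<lambda>n. l2dist lborel (f n) g) \<longlonglongrightarrow> 0"
    and sum: "summable (\<lambda>n. l2dist lborel (f (Suc n)) (f n))"
  shows "\<exists>J. has_wiener_integral M W g J"
proof -
  note sq = has_wiener_integral_sq_int[OF I]
  have [measurable]: "I n \<in> borel_measurable M" for n by (rule sq_int_measurable[OF sq(2)])
  have "AE \<omega> in M. convergent (\<lambda>n. I n \<omega>)"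
    using sum by (intro l2_summable_imp_AE_convergent sq) (simp add: wiener_l2dist[OF I I])
  then have "AE \<omega> in M. (\<lambda>n. I n \<omega>) \<longlonglongrightarrow> lim (\<lambda>n. I n \<omega>)"
    by eventually_elim (simp add: convergent_LIMSEQ_iff)
  moreover have "(\<lambda>\<omega>. lim (\<lambda>n. I n \<omega>)) \<in> borel_measurable M" by measurable
  ultimately show ?thesis using has_wiener_integral_AE_limit[OF I g] by blast
qed

end


section \<open>Gaussianity of Wiener integrals\<close>

lemma (in prob_space) char_distr_eq:
  "U \<in> borel_measurable M \<Longrightarrow> char (distr M borel U) u = (CLINT \<omega>|M. iexp (u * U \<omega>))"
  by (simp add: char_def integral_distr)

lemma (in prob_space) char_std_normal:
  assumes "distributed M lborel Z std_normal_density"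
  shows "char (distr M borel Z) u = complex_of_real (exp (- u\<^sup>2 / 2))"
proof -
  have "distr M borel Z = distr M lborel Z" by (rule distr_cong) auto
  also have "\<dots> = std_normal_distribution" using assms by (simp add: distributed_def)
  finally show ?thesis by (simp add: char_std_normal_distribution)
qed

lemma norm_iexp_diff_le: "cmod (iexp x - iexp y) \<le> \<bar>x - y\<bar>"
proof -
  have "iexp x = iexp y * iexp (x - y)"
    by (simp flip: exp_add add: algebra_simps)
  then have "iexp x - iexp y = iexp y * (iexp (x - y) - 1)" by (simp add: algebra_simps)
  then have "cmod (iexp x - iexp y) = cmod (iexp (x - y) - 1)" by (simp add: norm_mult)
  also have "\<dots> \<le> \<bar>x - y\<bar>" using iexp_approx1[of "x - y" 0] by simp
  finally show ?thesis .
qed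

text \<open>Makes characteristic functions converge along L2-convergent sequences, since iexp is
  1-Lipschitz and the L1 norm is at most the L2 norm.\<close>

lemma (in prob_space) char_diff_le:
  assumes U: "sq_int M U" and V: "sq_int M V"
  shows "cmod (char (distr M borel U) u - char (distr M borel V) u) \<le> \<bar>u\<bar> * l2dist M U V"
proof -
  have [measurable]: "U \<in> borel_measurable M" "V \<in> borel_measurable M"
    using U V by (simp_all add: sq_int_def)
  note D = sq_int_diff[OF U V]
  have "cmod (char (distr M borel U) u - char (distr M borel V) u)
      = cmod (CLINT \<omega>|M. iexp (u * U \<omega>) - iexp (u * V \<omega>))"
    using integrable_iexp[of "\<lambda>\<omega>. u * U \<omega>"] integrable_iexp[of "\<lambda>\<omega>. u * V \<omega>"]
    by (simp add: char_distr_eq)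
  also have "\<dots> \<le> (\<integral>\<omega>. \<bar>u\<bar> * \<bar>U \<omega> - V \<omega>\<bar> \<partial>M)"
  proof (rule order_trans[OF integral_norm_bound], rule Bochner_Integration.integral_mono)
    show "cmod (iexp (u * U \<omega>) - iexp (u * V \<omega>)) \<le> \<bar>u\<bar> * \<bar>U \<omega> - V \<omega>\<bar>" for \<omega>
      using norm_iexp_diff_le[of "u * U \<omega>" "u * V \<omega>"]
      by (simp flip: abs_mult add: right_diff_distrib)
    show "integrable M (\<lambda>\<omega>. cmod (iexp (u * U \<omega>) - iexp (u * V \<omega>)))"
      by (intro integrable_norm Bochner_Integration.integrable_diff integrable_iexp) measurable
    show "integrable M (\<lambda>\<omega>. \<bar>u\<bar> * \<bar>U \<omega> - V \<omega>\<bar>)"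
      by (intro integrable_mult_right integrable_abs sq_int_integrable D)
  qed
  also have "\<dots> = \<bar>u\<bar> * expectation (\<lambda>\<omega>. \<bar>U \<omega> - V \<omega>\<bar>)" by simp
  also have "\<dots> \<le> \<bar>u\<bar> * l2dist M U V"
    unfolding l2dist_def by (intro mult_left_mono expectation_abs_le_l2norm D) simp
  finally show ?thesis .
qed

text \<open>The centred normal law with variance \<open>(l2norm M U)\<^sup>2\<close>, variance 0
  included. Unlike a density, this form passes to L2 limits even when the limit is
  degenerate.\<close>

definition gaussian_char :: "'a measure \<Rightarrow> ('a \<Rightarrow> real) \<Rightarrow> bool" where
  "gaussian_char M U \<longleftrightarrow> sq_int M U \<and>
     (\<forall>u. char (distr M borel U) u = complex_of_real (exp (- (u\<^sup>2 * (l2norm M U)\<^sup>2) / 2)))"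

lemma (in prob_space) gaussian_char_limit:
  assumes U: "\<And>n. gaussian_char M (U n)" and V: "sq_int M V" "(\<lambda>n. l2dist M (U n) V) \<longlonglongrightarrow> 0"
  shows "gaussian_char M V"
  unfolding gaussian_char_def
proof (intro conjI allI V)
  fix u
  have sq: "sq_int M (U n)" for n using U by (simp add: gaussian_char_def)
  have "(\<lambda>n. char (distr M borel (U n)) u) \<longlonglongrightarrow> char (distr M borel V) u"
  proof (rule Lim_null[THEN iffD2], rule Lim_null_comparison)
    show "\<forall>\<^sub>F n in sequentially. norm (char (distr M borel (U n)) u - char (distr M borel V) u)
      \<le> \<bar>u\<bar> * l2dist M (U n) V"
      by (intro always_eventually allI char_diff_le sq V)
    show "(\<lambda>n. \<bar>u\<bar> * l2dist M (U n) V) \<longlonglongrightarrow> 0"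
      using tendsto_mult_right_zero[OF V(2)] by simp
  qed
  moreover have "(\<lambda>n. char (distr M borel (U n)) u)
      \<longlonglongrightarrow> complex_of_real (exp (- (u\<^sup>2 * (l2norm M V)\<^sup>2) / 2))"
    using U unfolding gaussian_char_def
    by (simp del: of_real_exp) (intro tendsto_intros tendsto_l2norm[OF sq V], simp)
  ultimately show "char (distr M borel V) u = complex_of_real (exp (- (u\<^sup>2 * (l2norm M V)\<^sup>2) / 2))"
    by (rule LIMSEQ_unique)
qed

lemma (in prob_space) gaussian_char_imp_gaussian_rv:
  assumes "gaussian_char M U"
  shows "gaussian_rv M U"
proof -
  let ?s = "l2norm M U"
  have sq: "sq_int M U" using assms by (simp add: gaussian_char_def)
  then have [measurable]: "U \<in> borel_measurable M" by (simp add: sq_int_def)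
  show ?thesis
  proof (cases "?s = 0")
    case True
    with l2norm_eq_0_AE[OF sq] show ?thesis by (auto simp: gaussian_rv_def)
  next
    case False
    then have s: "0 < ?s" using l2norm_nonneg[of M U] by linarith
    \<comment> \<open>Normalised so that Levy uniqueness can be applied with the standard normal
      law; the subtracted 0 is the mean expected by
      \<open>normal_standard_normal_convert\<close>.\<close>
    let ?Z = "\<lambda>\<omega>. (U \<omega> - 0) / ?s"
    have "char (distr M borel ?Z) u = complex_of_real (exp (- (u\<^sup>2) / 2))" for u
    proof -
      have "char (distr M borel ?Z) u = char (distr M borel U) (u / ?s)"
        by (simp add: char_distr_eq)
      also have "\<dots> = complex_of_real (exp (- ((u / ?s)\<^sup>2 * ?s\<^sup>2) / 2))"
        using assms unfolding gaussian_char_def by blast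
      also have "(u / ?s)\<^sup>2 * ?s\<^sup>2 = u\<^sup>2" using s by (simp add: power_divide)
      finally show ?thesis by simp
    qed
    then have "char (distr M borel ?Z) = char std_normal_distribution"
      by (simp add: fun_eq_iff char_std_normal_distribution)
    moreover have "real_distribution (distr M borel ?Z)" by simp
    ultimately have "distr M borel ?Z = std_normal_distribution"
      by (intro Levy_uniqueness real_dist_normal_dist)
    moreover have "distr M borel ?Z = distr M lborel ?Z" by (rule distr_cong) auto
    ultimately have "distributed M lborel ?Z std_normal_density"
      by (simp add: distributed_def)
    then have "distributed M lborel U (normal_density 0 ?s)"
      using normal_standard_normal_convert[OF s, of U 0] by simp
    with s show ?thesis unfolding gaussian_rv_def by auto
  qed
qed

text \<open>Independence of Brownian increments is available only for consecutive points of a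
  monotone sequence, whereas the intervals of S may overlap. Cutting every interval at all endpoints
  in S yields such a sequence.\<close>

lemma step_integral_partition:
  assumes "valid_steps S"
  shows "\<exists>n p d. mono_on {..n} p \<and>
    (\<forall>\<omega>. step_integral W S \<omega> = (\<Sum>i<n. d i * (W (p (Suc i)) \<omega> - W (p i) \<omega>)))"
proof -
  \<comment> \<open>The extra point 0 keeps \<open>A\<close> nonempty, so that its sorted list has
    length \<open>Suc n\<close> even for an empty S.\<close>
  define A where "A = insert 0 ((\<lambda>(c, a, b). a) ` set S \<union> (\<lambda>(c, a, b). b) ` set S)"
  define xs where "xs = sorted_list_of_set A"
  define n where "n = length xs - 1"
  have A: "finite A" "A \<noteq> {}" by (simp_all add: A_def)
  then have xs: "set xs = A" "sorted xs" "sorted_wrt (<) xs" by (simp_all add: xs_def)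
  have len: "length xs = Suc n" using xs A by (cases xs) (auto simp: n_def)
  have mono: "mono_on {..n} (\<lambda>i. xs ! i)"
    by (rule mono_onI) (use xs len in \<open>auto intro: sorted_nth_mono\<close>)
  \<comment> \<open>The induction runs over sublists T while the partition remains the one built
    from S.\<close>
  have sub: "valid_steps T \<Longrightarrow> set T \<subseteq> set S \<Longrightarrow>
      \<exists>d. \<forall>\<omega>. step_integral W T \<omega> = (\<Sum>i<n. d i * (W (xs ! Suc i) \<omega> - W (xs ! i) \<omega>))" for T
  proof (induction T)
    case Nil
    show ?case by (intro exI[of _ "\<lambda>_. 0"]) simp
  next
    case (Cons s T)
    obtain c a b where s: "s = (c, a, b)" by (cases s)
    from Cons obtain d where
      d: "\<And>\<omega>. step_integral W T \<omega> = (\<Sum>i<n. d i * (W (xs ! Suc i) \<omega> - W (xs ! i) \<omega>))"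
      by (auto simp: s)
    have ab: "a \<le> b" "a \<in> A" "b \<in> A" using Cons.prems by (force simp: s A_def)+
    from ab xs(1) obtain j k where jk: "j \<le> n" "xs ! j = a" "k \<le> n" "xs ! k = b"
      by (metis in_set_conv_nth len less_Suc_eq_le)
    have "j \<le> k"
    proof (rule ccontr)
      assume "\<not> j \<le> k"
      then have "xs ! k < xs ! j"
        using jk len by (intro sorted_wrt_nth_less[OF xs(3)]) auto
      with jk ab show False by simp
    qed
    have "step_integral W (s # T) \<omega> = (\<Sum>i<n. (c * (if j \<le> i \<and> i < k then 1 else 0) + d i)
        * (W (xs ! Suc i) \<omega> - W (xs ! i) \<omega>))" for \<omega>
    proof -
      have "W b \<omega> - W a \<omega> = (\<Sum>i=j..<k. W (xs ! Suc i) \<omega> - W (xs ! i) \<omega>)"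
        using sum_Suc_diff'[OF \<open>j \<le> k\<close>, of "\<lambda>i. W (xs ! i) \<omega>"] jk by simp
      also have "\<dots> = (\<Sum>i<n. if j \<le> i \<and> i < k then W (xs ! Suc i) \<omega> - W (xs ! i) \<omega> else 0)"
        using jk by (subst sum.inter_filter[symmetric]) (auto intro!: sum.cong)
      finally have "W b \<omega> - W a \<omega> =
        (\<Sum>i<n. (if j \<le> i \<and> i < k then 1 else 0) * (W (xs ! Suc i) \<omega> - W (xs ! i) \<omega>))"
        by (simp add: if_distrib[of "\<lambda>x. x * _"] cong: if_cong)
      then show ?thesis
        by (simp add: s d distrib_right sum.distrib sum_distrib_left mult.assoc)
    qed
    then show ?case
      by (intro exI[of _ "\<lambda>i. c * (if j \<le> i \<and> i < k then 1 else 0) + d i"]) blast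
  qed
  from sub[OF assms] mono show ?thesis by auto
qed

context wiener_space
begin

lemma char_increment:
  assumes "a \<le> b"
  shows "char (distr M borel (\<lambda>\<omega>. d * (W b \<omega> - W a \<omega>))) u
    = complex_of_real (exp (- (u\<^sup>2 * (d\<^sup>2 * (b - a))) / 2))"
\<comment> \<open>An increment over an empty interval has no normal density; it is 0 and its
  characteristic function is 1.\<close>
proof (cases "a = b")
  case True
  then show ?thesis by (simp add: char_distr_eq prob_space del: distr_const)
next
  case False
  with assms have s: "0 < sqrt (b - a)" by simp
  let ?Z = "\<lambda>\<omega>. (W b \<omega> - W a \<omega> - 0) / sqrt (b - a)"
  have Z: "distributed M lborel ?Z std_normal_density"
    using normal_standard_normal_convert[OF s, of "\<lambda>\<omega>. W b \<omega> - W a \<omega>" 0]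
      increment_normal[of a b] assms False by simp
  have "char (distr M borel (\<lambda>\<omega>. d * (W b \<omega> - W a \<omega>))) u
      = char (distr M borel ?Z) (u * d * sqrt (b - a))"
    using s by (simp add: char_distr_eq mult.assoc)
  also have "\<dots> = complex_of_real (exp (- (u * d * sqrt (b - a))\<^sup>2 / 2))"
    by (rule char_std_normal[OF Z])
  also have "(u * d * sqrt (b - a))\<^sup>2 = u\<^sup>2 * (d\<^sup>2 * (b - a))"
    using assms by (simp add: power_mult_distrib)
  finally show ?thesis .
qed

text \<open>On a partition the characteristic function is a product by independence, and the
  disjoint cells make the covariance matrix diagonal. So the variances that add up in the exponent
  sum to the squared norm.\<close>

lemma gaussian_char_step_integral:
  assumes "valid_steps S"
  shows "gaussian_char M (step_integral W S)"
proof -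
  obtain n p d where p: "mono_on {..n} p"
    and S: "\<And>\<omega>. step_integral W S \<omega> = (\<Sum>i<n. d i * (W (p (Suc i)) \<omega> - W (p i) \<omega>))"
    using step_integral_partition[OF assms, of W] by auto
  define D where "D i \<omega> = d i * (W (p (Suc i)) \<omega> - W (p i) \<omega>)" for i :: nat and \<omega>
  have S': "step_integral W S = (\<lambda>\<omega>. \<Sum>i<n. D i \<omega>)" by (auto simp: S D_def)
  have mono: "i \<le> j \<Longrightarrow> j \<le> n \<Longrightarrow> p i \<le> p j" for i j
    using p by (auto intro: mono_onD)
  have "indep_vars (\<lambda>_. borel) (\<lambda>i \<omega>. W (p (Suc i)) \<omega> - W (p i) \<omega>) {..<n}"
    using brownian p by (simp add: brownian_motion_def)
  from indep_vars_compose2[OF this, of "\<lambda>i x. d i * x" "\<lambda>_. borel"]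
  have ind: "indep_vars (\<lambda>_. borel) D {..<n}"
    unfolding D_def[abs_def] by simp
  have sqD: "sq_int M (D i)" for i
    unfolding D_def by (intro sq_int_cmult increment_moments)
  have cov: "expectation (\<lambda>\<omega>. D i \<omega> * D j \<omega>) = (if i = j then (d i)\<^sup>2 * (p (Suc i) - p i) else 0)"
    if "i < n" "j < n" for i j
  proof -
    have "expectation (\<lambda>\<omega>. D i \<omega> * D j \<omega>) = d i * d j *
        expectation (\<lambda>\<omega>. (W (p (Suc i)) \<omega> - W (p i) \<omega>) * (W (p (Suc j)) \<omega> - W (p j) \<omega>))"
      by (subst integral_mult_right_zero[symmetric]) (auto simp: D_def mult_ac)
    also have "expectation (\<lambda>\<omega>. (W (p (Suc i)) \<omega> - W (p i) \<omega>) * (W (p (Suc j)) \<omega> - W (p j) \<omega>))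
        = (if i = j then p (Suc i) - p i else 0)"
    proof (cases "i = j")
      case True
      then show ?thesis
        using increment_moments(3)[of "p (Suc i)" "p i"] mono[of i "Suc i"] that
        by (simp add: power2_eq_square)
    next
      case False
      have zero: "indicator {p i<..p (Suc i)} x * indicator {p j<..p (Suc j)} x = (0::real)" for x
      proof (cases "i < j")
        case True
        then show ?thesis using mono[of "Suc i" j] that by (auto simp: indicator_def)
      next
        case no: False
        then show ?thesis using mono[of "Suc j" i] that False by (auto simp: indicator_def)
      qed
      show ?thesis
        using mono[of i "Suc i"] mono[of j "Suc j"] that False
        by (subst increment_covariance) (auto simp: zero)
    qed
    finally show ?thesis by (simp add: power2_eq_square)
  qed
  have "(l2norm M (step_integral W S))\<^sup>2 = expectation (\<lambda>\<omega>. \<Sum>i<n. \<Sum>j<n. D i \<omega> * D j \<omega>)"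
    unfolding l2norm_power2 S' by (simp add: power2_eq_square sum_product)
  also have "\<dots> = (\<Sum>i<n. \<Sum>j<n. expectation (\<lambda>\<omega>. D i \<omega> * D j \<omega>))"
    using sq_int_integrable_mult[OF sqD sqD] by simp
  also have "\<dots> = (\<Sum>i<n. (d i)\<^sup>2 * (p (Suc i) - p i))"
  proof (intro sum.cong refl)
    fix i assume "i \<in> {..<n}"
    then have "(\<Sum>j<n. expectation (\<lambda>\<omega>. D i \<omega> * D j \<omega>))
        = (\<Sum>j<n. if i = j then (d i)\<^sup>2 * (p (Suc i) - p i) else 0)"
      by (intro sum.cong refl cov) auto
    with \<open>i \<in> {..<n}\<close> show "(\<Sum>j<n. expectation (\<lambda>\<omega>. D i \<omega> * D j \<omega>)) = (d i)\<^sup>2 * (p (Suc i) - p i)"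
      by simp
  qed
  finally have norm: "(l2norm M (step_integral W S))\<^sup>2 = (\<Sum>i<n. (d i)\<^sup>2 * (p (Suc i) - p i))" .
  have "char (distr M borel (step_integral W S)) u
      = complex_of_real (exp (- (u\<^sup>2 * (l2norm M (step_integral W S))\<^sup>2) / 2))" for u
  proof -
    have "char (distr M borel (step_integral W S)) u = (\<Prod>i<n. char (distr M borel (D i)) u)"
      unfolding S' by (rule char_distr_sum[OF ind])
    also have "\<dots> = (\<Prod>i<n. complex_of_real (exp (- (u\<^sup>2 * ((d i)\<^sup>2 * (p (Suc i) - p i))) / 2)))"
      unfolding D_def by (intro prod.cong char_increment mono refl) auto
    also have "\<dots> = complex_of_real (exp (\<Sum>i<n. - (u\<^sup>2 * ((d i)\<^sup>2 * (p (Suc i) - p i))) / 2))"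
      by (simp only: exp_sum[OF finite_lessThan] of_real_prod)
    also have "(\<Sum>i<n. - (u\<^sup>2 * ((d i)\<^sup>2 * (p (Suc i) - p i))) / 2)
        = - (u\<^sup>2 * (l2norm M (step_integral W S))\<^sup>2) / 2"
      by (simp add: norm sum_distrib_left sum_divide_distrib[symmetric] sum_negf)
    finally show ?thesis .
  qed
  then show ?thesis
    by (simp add: gaussian_char_def sq_int_step_integral)
qed

lemma wiener_integral_gaussian:
  assumes f: "has_wiener_integral M W f I"
  shows "gaussian_rv M I"
proof -
  obtain S where S: "\<And>n. valid_steps (S n)" "(\<lambda>n. l2dist M (step_integral W (S n)) I) \<longlonglongrightarrow> 0"
    using f by (auto simp: has_wiener_integral_iff)
  show ?thesis
    by (intro gaussian_char_imp_gaussian_rv gaussian_char_limit[OF gaussian_char_step_integral[OF S(1)] _ S(2)]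
        has_wiener_integral_sq_int[OF f])
qed

end


section \<open>The exponential kernel\<close>

definition ou_kernel :: "real \<Rightarrow> real \<Rightarrow> real \<Rightarrow> real" where
  "ou_kernel \<alpha> t = (\<lambda>s. indicator {..t} s * exp (- \<alpha> * (t - s)))"

text \<open>The kernel restricted to the noise in (a, t]. On a bounded interval the integral can be
  computed by Riemann sums; the full kernel is reached by letting a tend to minus infinity.\<close>

definition ou_window :: "real \<Rightarrow> real \<Rightarrow> real \<Rightarrow> real \<Rightarrow> real" where
  "ou_window \<alpha> a t = (\<lambda>s. indicator {a<..t} s * exp (- \<alpha> * (t - s)))"

lemma ou_kernel_measurable [measurable]: "ou_kernel \<alpha> t \<in> borel_measurable borel"
  by (simp add: ou_kernel_def)

text \<open>The semigroup law of the exponential. For the integrals it says that X(t) is the damped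
  value of X(a) plus the noise collected on (a, t].\<close>

lemma ou_kernel_split:
  assumes "a \<le> t"
  shows "ou_kernel \<alpha> t s = ou_window \<alpha> a t s + exp (- \<alpha> * (t - a)) * ou_kernel \<alpha> a s"
proof -
  have "exp (- \<alpha> * (t - a)) * exp (- \<alpha> * (a - s)) = exp (- \<alpha> * (t - s))"
    by (simp add: algebra_simps flip: exp_add)
  with assms show ?thesis by (auto simp: ou_kernel_def ou_window_def indicator_def)
qed

lemma nn_integral_ou_kernel_square:
  assumes "0 < \<alpha>"
  shows "(\<integral>\<^sup>+s. ennreal ((ou_kernel \<alpha> t s)\<^sup>2) \<partial>lborel) = ennreal (1 / (2 * \<alpha>))"
proof -
  have sq: "(exp x)\<^sup>2 = exp (2 * x)" for x :: real
    by (simp add: power2_eq_square flip: exp_add)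
  have "(\<integral>\<^sup>+s. ennreal ((ou_kernel \<alpha> t s)\<^sup>2) \<partial>lborel)
      = (\<integral>\<^sup>+x. ennreal ((ou_kernel \<alpha> t (t + -1 * x))\<^sup>2) \<partial>lborel)"
    by (subst nn_integral_real_affine[of _ "-1" t]) simp_all
  also have "\<dots> = (\<integral>\<^sup>+x. ennreal (exp (- (2 * \<alpha>) * x)) * indicator {0..} x \<partial>lborel)"
    by (intro nn_integral_cong) (auto simp: ou_kernel_def indicator_def sq)
  also have "\<dots> = ennreal (0 - (- exp (- (2 * \<alpha>) * 0) / (2 * \<alpha>)))"
  proof (rule nn_integral_FTC_atLeast)
    show "((\<lambda>x. - exp (- (2 * \<alpha>) * x) / (2 * \<alpha>)) has_real_derivative exp (- (2 * \<alpha>) * x)) (at x)" for x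
      using assms by (auto intro!: derivative_eq_intros)
    have "filterlim (\<lambda>x. - (2 * \<alpha>) * x) at_bot at_top"
      using assms by (intro filterlim_tendsto_neg_mult_at_bot[OF tendsto_const]) (auto simp: filterlim_ident)
    from filterlim_compose[OF exp_at_bot this]
    have "((\<lambda>x. exp (- (2 * \<alpha>) * x)) \<longlongrightarrow> 0) at_top" .
    from tendsto_divide[OF tendsto_minus[OF this] tendsto_const[of "2 * \<alpha>"]]
    show "((\<lambda>x. - exp (- (2 * \<alpha>) * x) / (2 * \<alpha>)) \<longlongrightarrow> 0) at_top"
      using assms by simp
  qed (use assms in simp_all)
  finally show ?thesis by simp
qed

lemma sq_int_ou_kernel: "0 < \<alpha> \<Longrightarrow> sq_int lborel (ou_kernel \<alpha> t)"
  by (rule sq_intI_nn_integral) (simp_all add: nn_integral_ou_kernel_square)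

lemma l2norm_ou_kernel: "0 < \<alpha> \<Longrightarrow> (l2norm lborel (ou_kernel \<alpha> t))\<^sup>2 = 1 / (2 * \<alpha>)"
  using nn_integral_l2norm[OF sq_int_ou_kernel, of \<alpha> t] nn_integral_ou_kernel_square[of \<alpha> t]
  by simp

lemma ou_kernel_inner:
  assumes "0 < \<alpha>" "t \<le> u"
  shows "(\<integral>s. ou_kernel \<alpha> t s * ou_kernel \<alpha> u s \<partial>lborel) = exp (- \<alpha> * (u - t)) / (2 * \<alpha>)"
proof -
  \<comment> \<open>On the support of the earlier kernel the later one is a constant multiple of it:
    the window between t and u meets that support nowhere.\<close>
  have "ou_kernel \<alpha> t s * ou_kernel \<alpha> u s = exp (- \<alpha> * (u - t)) * (ou_kernel \<alpha> t s)\<^sup>2" for s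
    using ou_kernel_split[OF assms(2), of \<alpha> s]
    by (auto simp: ou_window_def ou_kernel_def indicator_def power2_eq_square)
  then show ?thesis using l2norm_ou_kernel[OF assms(1), of t] by (simp add: l2norm_power2)
qed

lemma ou_window_eq:
  "a \<le> t \<Longrightarrow> ou_window \<alpha> a t = (\<lambda>s. ou_kernel \<alpha> t s - exp (- \<alpha> * (t - a)) * ou_kernel \<alpha> a s)"
  using ou_kernel_split[of a t \<alpha>] by auto

lemma sq_int_ou_window: "0 < \<alpha> \<Longrightarrow> a \<le> t \<Longrightarrow> sq_int lborel (ou_window \<alpha> a t)"
  unfolding ou_window_eq by (intro sq_int_diff sq_int_cmult sq_int_ou_kernel)

lemma l2dist_ou_window_kernel:
  assumes "0 < \<alpha>" "a \<le> t"
  shows "l2dist lborel (ou_window \<alpha> a t) (ou_kernel \<alpha> t) = exp (- \<alpha> * (t - a)) * sqrt (1 / (2 * \<alpha>))"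
proof -
  have "l2norm lborel (ou_kernel \<alpha> a) = sqrt (1 / (2 * \<alpha>))"
    using l2norm_ou_kernel[OF assms(1), of a] by (intro real_sqrt_unique[symmetric]) auto
  then show ?thesis
    using l2norm_cmult[of lborel "- exp (- \<alpha> * (t - a))" "ou_kernel \<alpha> a"]
    by (simp add: l2dist_def ou_window_eq[OF assms(2)])
qed


section \<open>Riemann sums\<close>

text \<open>There are \<open>Suc n\<close> cells, so no index leads to a division by zero.\<close>

definition grid :: "real \<Rightarrow> real \<Rightarrow> nat \<Rightarrow> nat \<Rightarrow> real" where
  "grid a t n i = a + real i * ((t - a) / real (Suc n))"

definition riemann_steps :: "(real \<Rightarrow> real) \<Rightarrow> real \<Rightarrow> real \<Rightarrow> nat \<Rightarrow> (real \<times> real \<times> real) list" where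
  "riemann_steps e a t n = map (\<lambda>i. (e (grid a t n i), grid a t n i, grid a t n (Suc i))) [0..<Suc n]"

lemma grid_ends [simp]: "grid a t n 0 = a" "grid a t n (Suc n) = t"
  by (simp_all add: grid_def del: of_nat_Suc)

lemma grid_Suc: "grid a t n (Suc i) = grid a t n i + (t - a) / real (Suc n)"
  by (simp add: grid_def algebra_simps add_divide_distrib diff_divide_distrib del: of_nat_Suc)
     (simp add: algebra_simps add_divide_distrib diff_divide_distrib)

lemma grid_mono: "a \<le> t \<Longrightarrow> i \<le> j \<Longrightarrow> grid a t n i \<le> grid a t n j"
  unfolding grid_def by (intro add_left_mono mult_right_mono) auto

lemma valid_riemann_steps: "a \<le> t \<Longrightarrow> valid_steps (riemann_steps e a t n)"
  by (auto simp: valid_steps_def riemann_steps_def simp del: upt_Suc grid_ends intro!: grid_mono)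

lemma step_fun_riemann:
  "step_fun (riemann_steps e a t n) x
    = (\<Sum>i<Suc n. e (grid a t n i) * indicator {grid a t n i<..grid a t n (Suc i)} x)"
  by (simp add: step_fun_def riemann_steps_def sum_list_distinct_conv_sum_set o_def atLeast0LessThan)

lemma step_integral_riemann:
  "step_integral W (riemann_steps e a t n) \<omega>
    = (\<Sum>i<Suc n. e (grid a t n i) * (W (grid a t n (Suc i)) \<omega> - W (grid a t n i) \<omega>))"
  by (simp add: step_integral_def riemann_steps_def sum_list_distinct_conv_sum_set o_def atLeast0LessThan)

text \<open>The indicator of a half-open cell is the increment of \<open>of_bool (x \<le> _)\<close>
  between its endpoints, so the sum telescopes.\<close>

lemma indicator_grid:
  assumes "a \<le> t"
  shows "(\<Sum>i<Suc n. indicator {grid a t n i<..grid a t n (Suc i)} x) = (indicator {a<..t} x :: real)"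
proof -
  have "indicator {grid a t n i<..grid a t n (Suc i)} x
      = (of_bool (x \<le> grid a t n (Suc i)) - of_bool (x \<le> grid a t n i) :: real)" for i
    using grid_mono[OF assms, of i "Suc i" n] by (auto simp: indicator_def)
  then have "(\<Sum>i<Suc n. indicator {grid a t n i<..grid a t n (Suc i)} x)
      = (of_bool (x \<le> grid a t n (Suc n)) - of_bool (x \<le> grid a t n 0) :: real)"
    using sum_lessThan_telescope[of "\<lambda>i. of_bool (x \<le> grid a t n i) :: real" "Suc n"]
    by (simp only:)
  also have "\<dots> = indicator {a<..t} x"
    using assms by (auto simp: indicator_def simp del: of_nat_Suc)
  finally show ?thesis .
qed

lemma exp_lipschitz:
  fixes x y \<alpha> t :: real
  assumes "0 < \<alpha>" "x \<le> y" "y \<le> t"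
  shows "\<bar>exp (- \<alpha> * (t - y)) - exp (- \<alpha> * (t - x))\<bar> \<le> \<alpha> * (y - x)"
proof -
  have "exp (- \<alpha> * (t - x)) = exp (- \<alpha> * (t - y)) * exp (- \<alpha> * (y - x))"
    by (simp add: algebra_simps flip: exp_add)
  then have "exp (- \<alpha> * (t - y)) - exp (- \<alpha> * (t - x))
      = exp (- \<alpha> * (t - y)) * (1 - exp (- \<alpha> * (y - x)))" by (simp add: algebra_simps)
  moreover have "0 \<le> 1 - exp (- \<alpha> * (y - x))" using assms by simp
  moreover have "1 - exp (- \<alpha> * (y - x)) \<le> \<alpha> * (y - x)"
    using exp_ge_add_one_self[of "- \<alpha> * (y - x)"] by linarith
  moreover have "exp (- \<alpha> * (t - y)) \<le> 1" using assms by simp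
  ultimately show ?thesis
    using mult_mono[of "exp (- \<alpha> * (t - y))" 1 "1 - exp (- \<alpha> * (y - x))" "\<alpha> * (y - x)"] by simp
qed

text \<open>On each cell the exponential changes by at most \<alpha> times the mesh. The error is
  thus bounded by a multiple of the indicator of (a, t] that decreases like 1/(n+1).\<close>

lemma riemann_steps_tendsto_window:
  assumes \<alpha>: "0 < \<alpha>" and at: "a \<le> t"
  shows "(\<lambda>n. l2dist lborel (step_fun (riemann_steps (\<lambda>s. exp (- \<alpha> * (t - s))) a t n))
    (ou_window \<alpha> a t)) \<longlonglongrightarrow> 0"
proof (rule Lim_null_comparison)
  let ?e = "\<lambda>s. exp (- \<alpha> * (t - s))"
  let ?K = "\<alpha> * (t - a) * l2norm lborel (indicator {a<..t} :: real \<Rightarrow> real)"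
  show "(\<lambda>n. ?K * (1 / real (Suc n))) \<longlonglongrightarrow> 0"
    by (intro tendsto_mult_right_zero LIMSEQ_Suc lim_1_over_n)
  show "\<forall>\<^sub>F n in sequentially. norm (l2dist lborel (step_fun (riemann_steps ?e a t n)) (ou_window \<alpha> a t))
      \<le> ?K * (1 / real (Suc n))"
  proof (intro always_eventually allI)
    fix n
    let ?h = "(t - a) / real (Suc n)" and ?I = "\<lambda>i. {grid a t n i<..grid a t n (Suc i)}"
    have "\<bar>step_fun (riemann_steps ?e a t n) s - ou_window \<alpha> a t s\<bar>
        \<le> \<bar>\<alpha> * ?h * indicator {a<..t} s\<bar>" for s
    proof -
      have window: "ou_window \<alpha> a t s = (\<Sum>i<Suc n. ?e s * indicator (?I i) s)"
        unfolding ou_window_def by (simp only: sum_distrib_left[symmetric] indicator_grid[OF at] mult.commute)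
      have diff: "step_fun (riemann_steps ?e a t n) s - ou_window \<alpha> a t s
          = (\<Sum>i<Suc n. (?e (grid a t n i) - ?e s) * indicator (?I i) s)"
        unfolding step_fun_riemann window by (simp only: left_diff_distrib sum_subtractf)
      have "\<bar>step_fun (riemann_steps ?e a t n) s - ou_window \<alpha> a t s\<bar>
          \<le> (\<Sum>i<Suc n. \<alpha> * ?h * indicator (?I i) s)"
        unfolding diff
      proof (rule order_trans[OF sum_abs], rule sum_mono)
        fix i assume "i \<in> {..<Suc n}"
        then have "grid a t n (Suc i) \<le> t" using grid_mono[OF at, of "Suc i" "Suc n" n] by simp
        then have "\<bar>?e s - ?e (grid a t n i)\<bar> \<le> \<alpha> * ?h" if "s \<in> ?I i"
          using exp_lipschitz[OF \<alpha>, of "grid a t n i" s t] that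
            mult_left_mono[of "s - grid a t n i" ?h \<alpha>] \<alpha>
          by (simp add: grid_Suc del: of_nat_Suc)
        then show "\<bar>(?e (grid a t n i) - ?e s) * indicator (?I i) s\<bar> \<le> \<alpha> * ?h * indicator (?I i) s"
          by (auto simp: indicator_def abs_minus_commute simp del: of_nat_Suc)
      qed
      also have "\<dots> = \<alpha> * ?h * indicator {a<..t} s"
        by (simp only: sum_distrib_left[symmetric] indicator_grid[OF at])
      finally show ?thesis by linarith
    qed
    then have "l2dist lborel (step_fun (riemann_steps ?e a t n)) (ou_window \<alpha> a t)
        \<le> l2norm lborel (\<lambda>s. \<alpha> * ?h * indicator {a<..t} s)"
      unfolding l2dist_def
      by (intro l2norm_mono sq_int_cmult sq_int_interval
          sq_int_measurable[OF sq_int_diff[OF sq_int_step_fun sq_int_ou_window]] \<alpha> at)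
    also have "\<dots> = ?K * (1 / real (Suc n))"
      unfolding l2norm_cmult using \<alpha> at by (simp add: abs_mult del: of_nat_Suc)
    finally show "norm (l2dist lborel (step_fun (riemann_steps ?e a t n)) (ou_window \<alpha> a t))
      \<le> ?K * (1 / real (Suc n))" by simp
  qed
qed

text \<open>The fundamental theorem is applied on the segment from -|x| - 1 to |x| + 1: it contains
  the base point 0 and has x in its interior, so the one-sided restriction disappears.\<close>

lemma antiderivative_on_line:
  fixes f :: "real \<Rightarrow> real"
  assumes "continuous_on UNIV f"
  shows "\<exists>P. \<forall>x. (P has_real_derivative f x) (at x)"
proof (intro exI[of _ "\<lambda>x. LBINT y=ereal 0..ereal x. f y"] allI)
  fix x :: real
  have cont: "continuous_on {- \<bar>x\<bar> - 1..\<bar>x\<bar> + 1} f"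
    using assms by (rule continuous_on_subset) simp
  have "((\<lambda>u. LBINT y=ereal 0..ereal u. f y) has_vector_derivative f x) (at x within {- \<bar>x\<bar> - 1..\<bar>x\<bar> + 1})"
    by (rule interval_integral_FTC2[OF _ _ cont]) auto
  moreover have "at x within {- \<bar>x\<bar> - 1..\<bar>x\<bar> + 1} = at x"
    by (intro at_within_interior) (simp, linarith)
  ultimately show "((\<lambda>x. LBINT y=ereal 0..ereal x. f y) has_real_derivative f x) (at x)"
    by (simp add: has_real_derivative_iff_has_vector_derivative)
qed

text \<open>Summation by parts turns the Riemann sums of \<open>\<integral> e dw\<close> into those of \<open>\<integral> w de\<close>, which
  converge by uniform continuity of \<open>w\<close>.\<close>

lemma riemann_sum_by_parts:
  fixes w :: "real \<Rightarrow> real"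
  assumes \<alpha>: "0 < \<alpha>" and at: "a \<le> t" and w: "continuous_on UNIV w"
    and P: "\<And>s. (P has_real_derivative exp (\<alpha> * s) * w s) (at s)"
  shows "(\<lambda>n. \<Sum>i<Suc n. exp (- \<alpha> * (t - grid a t n i)) * (w (grid a t n (Suc i)) - w (grid a t n i)))
    \<longlonglongrightarrow> w t - exp (- \<alpha> * (t - a)) * w a - \<alpha> * exp (- \<alpha> * t) * (P t - P a)"
proof (cases "a = t")
  case True
  then show ?thesis by (simp add: grid_def)
next
  case False
  with at have at': "a < t" by simp
  let ?e = "\<lambda>s. exp (- \<alpha> * (t - s))"
  \<comment> \<open>An antiderivative of \<open>\<alpha> * ?e s * w s\<close>, that is, of w against
    the differential of \<open>?e\<close>; the limit consists of boundary terms minus the increment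
    of \<open>?Q\<close>.\<close>
  let ?Q = "\<lambda>s. \<alpha> * exp (- \<alpha> * t) * P s"
  have e': "(?e has_real_derivative \<alpha> * ?e s) (at s)" for s
    by (auto intro!: derivative_eq_intros)
  have Q': "(?Q has_real_derivative \<alpha> * ?e s * w s) (at s)" for s
  proof -
    have "exp (- \<alpha> * t) * exp (\<alpha> * s) = ?e s" by (simp add: algebra_simps flip: exp_add)
    then have "\<alpha> * exp (- \<alpha> * t) * (exp (\<alpha> * s) * w s) = \<alpha> * ?e s * w s" by (simp add: mult.assoc)
    from DERIV_cmult[OF P[of s], of "\<alpha> * exp (- \<alpha> * t)", unfolded this] show ?thesis .
  qed
  show ?thesis
  proof (rule LIMSEQ_I)
    fix r :: real assume r: "0 < r"
    \<comment> \<open>Chosen so that the cell errors, at most \<open>\<alpha> * \<epsilon>\<close>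
      times the mesh each, add up to r/2.\<close>
    define \<epsilon> where "\<epsilon> = r / (2 * (\<alpha> * (t - a)))"
    have pos: "0 < \<alpha> * (t - a)" using \<alpha> at' by simp
    then have \<epsilon>: "0 < \<epsilon>" using r by (simp add: \<epsilon>_def)
    have "uniformly_continuous_on {a..t} w"
      by (rule compact_uniformly_continuous[OF continuous_on_subset[OF w]]) auto
    then obtain \<delta> where \<delta>: "0 < \<delta>" "\<And>x y. x \<in> {a..t} \<Longrightarrow> y \<in> {a..t} \<Longrightarrow> \<bar>x - y\<bar> < \<delta> \<Longrightarrow> \<bar>w x - w y\<bar> < \<epsilon>"
      using \<epsilon> unfolding uniformly_continuous_on_def dist_real_def by (metis abs_minus_commute)
    obtain N where N: "(t - a) / \<delta> < real N" using reals_Archimedean2 by blast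
    have "norm ((\<Sum>i<Suc n. ?e (grid a t n i) * (w (grid a t n (Suc i)) - w (grid a t n i)))
        - (w t - ?e a * w a - \<alpha> * exp (- \<alpha> * t) * (P t - P a))) < r" if "n \<ge> N" for n
    proof -
      let ?x = "grid a t n" and ?h = "(t - a) / real (Suc n)"
      have h: "0 < ?h" using at' by simp
      have "(t - a) / \<delta> < real (Suc n)" using N that by simp
      then have "?h < \<delta>" using \<delta>(1) by (simp add: field_simps)
      have cell: "\<bar>w (?x (Suc i)) * (?e (?x (Suc i)) - ?e (?x i)) - (?Q (?x (Suc i)) - ?Q (?x i))\<bar>
          \<le> \<alpha> * \<epsilon> * ?h" if "i < Suc n" for i
      proof -
        \<comment> \<open>Freezing w at the right endpoint makes the derivative of \<open>?F\<close>
          equal to \<open>\<alpha> * ?e s * (w (?x (Suc i)) - w s)\<close>, which uniform continuity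
          makes small; the mean value theorem then bounds the cell error.\<close>
        let ?F = "\<lambda>s. w (?x (Suc i)) * ?e s - ?Q s"
        have lt: "?x i < ?x (Suc i)" using h by (simp add: grid_Suc del: of_nat_Suc)
        have "\<exists>z>?x i. z < ?x (Suc i) \<and> ?F (?x (Suc i)) - ?F (?x i)
            = (?x (Suc i) - ?x i) * (w (?x (Suc i)) * (\<alpha> * ?e z) - \<alpha> * ?e z * w z)"
          by (rule MVT2[OF lt]) (intro DERIV_diff DERIV_cmult e' Q')
        then obtain z where z: "?x i < z" "z < ?x (Suc i)" "?F (?x (Suc i)) - ?F (?x i)
            = ?h * (w (?x (Suc i)) * (\<alpha> * ?e z) - \<alpha> * ?e z * w z)"
          by (auto simp: grid_Suc simp del: of_nat_Suc)
        have in_range: "a \<le> ?x i" "?x (Suc i) \<le> t"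
          using grid_mono[OF at, of 0 i n] grid_mono[OF at, of "Suc i" "Suc n" n] that by auto
        have "\<bar>w (?x (Suc i)) - w z\<bar> < \<epsilon>"
          using z in_range \<open>?h < \<delta>\<close> by (intro \<delta>(2)) (auto simp: grid_Suc simp del: of_nat_Suc)
        moreover have "?e z \<le> 1" using z in_range \<alpha> by simp
        ultimately have "?e z * \<bar>w (?x (Suc i)) - w z\<bar> \<le> 1 * \<epsilon>"
          by (intro mult_mono) auto
        then have "(\<alpha> * ?h) * (?e z * \<bar>w (?x (Suc i)) - w z\<bar>) \<le> (\<alpha> * ?h) * \<epsilon>"
          using \<alpha> h by (intro mult_left_mono mult_nonneg_nonneg less_imp_le[OF \<alpha>] less_imp_le[OF h]) simp
        moreover have "?F (?x (Suc i)) - ?F (?x i) = (\<alpha> * ?h) * (?e z * (w (?x (Suc i)) - w z))"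
          unfolding z(3) by (simp add: algebra_simps del: of_nat_Suc)
        moreover have "\<bar>(\<alpha> * ?h) * (?e z * (w (?x (Suc i)) - w z))\<bar>
            = (\<alpha> * ?h) * (?e z * \<bar>w (?x (Suc i)) - w z\<bar>)"
          using \<alpha> at' by (simp add: abs_mult del: of_nat_Suc)
        moreover have "w (?x (Suc i)) * (?e (?x (Suc i)) - ?e (?x i)) - (?Q (?x (Suc i)) - ?Q (?x i))
            = ?F (?x (Suc i)) - ?F (?x i)" by (simp add: algebra_simps)
        ultimately show ?thesis by (simp add: mult_ac del: of_nat_Suc)
      qed
      \<comment> \<open>Abel summation on one cell: an increment of \<open>?e * w - ?Q\<close>,
        which telescopes, minus the cell error just bounded.\<close>
      have parts: "?e (?x i) * (w (?x (Suc i)) - w (?x i))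
          = (?e (?x (Suc i)) * w (?x (Suc i)) - ?Q (?x (Suc i)) - (?e (?x i) * w (?x i) - ?Q (?x i)))
            - (w (?x (Suc i)) * (?e (?x (Suc i)) - ?e (?x i)) - (?Q (?x (Suc i)) - ?Q (?x i)))" for i
        by (simp add: algebra_simps)
      have "(\<Sum>i<Suc n. ?e (?x i) * (w (?x (Suc i)) - w (?x i)))
          = (?e t * w t - ?Q t - (?e a * w a - ?Q a))
            - (\<Sum>i<Suc n. w (?x (Suc i)) * (?e (?x (Suc i)) - ?e (?x i)) - (?Q (?x (Suc i)) - ?Q (?x i)))"
        unfolding parts sum_subtractf[of "\<lambda>i. ?e (?x (Suc i)) * w (?x (Suc i)) - ?Q (?x (Suc i)) - (?e (?x i) * w (?x i) - ?Q (?x i))"]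
          sum_lessThan_telescope[of "\<lambda>i. ?e (?x i) * w (?x i) - ?Q (?x i)"] by simp
      then have "\<bar>(\<Sum>i<Suc n. ?e (?x i) * (w (?x (Suc i)) - w (?x i)))
          - (w t - ?e a * w a - \<alpha> * exp (- \<alpha> * t) * (P t - P a))\<bar>
          = \<bar>\<Sum>i<Suc n. w (?x (Suc i)) * (?e (?x (Suc i)) - ?e (?x i)) - (?Q (?x (Suc i)) - ?Q (?x i))\<bar>"
        by (simp add: right_diff_distrib del: sum.lessThan_Suc)
      also have "\<dots> \<le> (\<Sum>i<Suc n. \<alpha> * \<epsilon> * ?h)"
        by (rule order_trans[OF sum_abs], rule sum_mono, rule cell) simp
      also have "\<dots> = \<alpha> * \<epsilon> * (t - a)" by (simp del: of_nat_Suc sum.lessThan_Suc)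
      also have "\<dots> = \<epsilon> * (2 * (\<alpha> * (t - a))) / 2" by simp
      also have "\<dots> = r / 2" using \<alpha> at' by (simp add: \<epsilon>_def)
      also have "\<dots> < r" using r by simp
      finally show ?thesis by simp
    qed
    then show "\<exists>N. \<forall>n\<ge>N. norm ((\<Sum>i<Suc n. ?e (grid a t n i) * (w (grid a t n (Suc i)) - w (grid a t n i)))
        - (w t - ?e a * w a - \<alpha> * exp (- \<alpha> * t) * (P t - P a))) < r" by blast
  qed
qed

context wiener_space
begin

section \<open>Existence of the Wiener integral of the kernel\<close>

text \<open>Paths of W are continuous only almost surely; setting them to 0 on a null set makes
  every path integrable by antiderivatives. \<open>P\<close> is chosen separately for each \<omega>,
  so nothing is asserted about its measurability.\<close>

lemma continuous_modification:
  obtains B P where "\<And>t. B t \<in> borel_measurable M" "\<And>\<omega>. continuous_on UNIV (\<lambda>t. B t \<omega>)"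
    "AE \<omega> in M. \<forall>t. B t \<omega> = W t \<omega>"
    "\<And>\<omega> s. (P \<omega> has_real_derivative exp (\<alpha> * s) * B s \<omega>) (at s)"
proof -
  have "AE \<omega> in M. continuous_on UNIV (\<lambda>t. W t \<omega>)"
    using brownian by (simp add: brownian_motion_def)
  then obtain N where N: "{\<omega>\<in>space M. \<not> continuous_on UNIV (\<lambda>t. W t \<omega>)} \<subseteq> N" "N \<in> null_sets M"
    by (auto simp: eventually_ae_filter)
  define B where "B t \<omega> = (if \<omega> \<in> space M - N then W t \<omega> else 0)" for t \<omega>
  have [measurable]: "N \<in> sets M" using N(2) by auto
  have meas: "B t \<in> borel_measurable M" for t
    unfolding B_def by measurable
  have cont: "continuous_on UNIV (\<lambda>t. B t \<omega>)" for \<omega>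
    using N(1) by (cases "\<omega> \<in> space M - N") (auto simp: B_def)
  have eq: "AE \<omega> in M. \<forall>t. B t \<omega> = W t \<omega>"
    using AE_not_in[OF N(2)] AE_space by eventually_elim (auto simp: B_def)
  have "\<exists>P. \<forall>s. (P has_real_derivative exp (\<alpha> * s) * B s \<omega>) (at s)" for \<omega>
    by (intro antiderivative_on_line continuous_intros cont)
  then obtain P where "\<And>\<omega> s. (P \<omega> has_real_derivative exp (\<alpha> * s) * B s \<omega>) (at s)" by metis
  with meas cont eq that show thesis by blast
qed

text \<open>The Riemann sums converge to the kernel piece in L2 and, after summation by parts, along
  every path of \<open>B\<close> to the stated expression. Being a pointwise limit, the expression
  is measurable although \<open>P\<close> was picked pathwise.\<close>

lemma has_wiener_integral_ou_window:
  assumes \<alpha>: "0 < \<alpha>" and at: "a \<le> t"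
    and B: "\<And>t. B t \<in> borel_measurable M" "\<And>\<omega>. continuous_on UNIV (\<lambda>t. B t \<omega>)"
      "AE \<omega> in M. \<forall>t. B t \<omega> = W t \<omega>"
    and P: "\<And>\<omega> s. (P \<omega> has_real_derivative exp (\<alpha> * s) * B s \<omega>) (at s)"
  shows "has_wiener_integral M W (ou_window \<alpha> a t)
    (\<lambda>\<omega>. B t \<omega> - exp (- \<alpha> * (t - a)) * B a \<omega> - \<alpha> * exp (- \<alpha> * t) * (P \<omega> t - P \<omega> a))"
    (is "has_wiener_integral M W _ ?V")
proof -
  let ?S = "riemann_steps (\<lambda>s. exp (- \<alpha> * (t - s))) a t"
  have lim: "(\<lambda>n. step_integral B (?S n) \<omega>) \<longlonglongrightarrow> ?V \<omega>" for \<omega>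
    unfolding step_integral_riemann by (rule riemann_sum_by_parts[OF \<alpha> at B(2) P])
  have [measurable]: "step_integral B (?S n) \<in> borel_measurable M" for n
    unfolding step_integral_riemann[abs_def] using B(1) by measurable
  show ?thesis
  proof (rule has_wiener_integral_AE_limit)
    show "has_wiener_integral M W (step_fun (?S n)) (step_integral W (?S n))" for n
      by (intro has_wiener_integral_step valid_riemann_steps at)
    show "?V \<in> borel_measurable M"
      by (rule borel_measurable_LIMSEQ_real[OF lim]) measurable
    have same: "step_integral W S \<omega> = step_integral B S \<omega>" if "\<forall>t. B t \<omega> = W t \<omega>" for S \<omega>
      using that by (simp add: step_integral_def)
    have "(\<lambda>n. step_integral W (?S n) \<omega>) \<longlonglongrightarrow> ?V \<omega>" if "\<forall>t. B t \<omega> = W t \<omega>" for \<omega>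
      using lim[of \<omega>] same[OF that]
      by (simp only:)
    with B(3) show "AE \<omega> in M. (\<lambda>n. step_integral W (?S n) \<omega>) \<longlonglongrightarrow> ?V \<omega>"
      by (rule eventually_mono)
  qed (intro sq_int_ou_window riemann_steps_tendsto_window \<alpha> at)+
qed

text \<open>\<open>wiener_integral\<close> is a choice and means something only once an integral
  exists. The windows (t - n, t] approach the kernel at the geometric rate exp(-\<alpha> n), so
  their successive distances are summable.\<close>

lemma has_wiener_integral_ou_kernel:
  assumes \<alpha>: "0 < \<alpha>"
  shows "has_wiener_integral M W (ou_kernel \<alpha> t) (wiener_integral M W (ou_kernel \<alpha> t))"
proof -
  obtain B P where BP: "\<And>t. B t \<in> borel_measurable M" "\<And>\<omega>. continuous_on UNIV (\<lambda>t. B t \<omega>)"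
    "AE \<omega> in M. \<forall>t. B t \<omega> = W t \<omega>"
    "\<And>\<omega> s. (P \<omega> has_real_derivative exp (\<alpha> * s) * B s \<omega>) (at s)"
    by (rule continuous_modification) blast
  define f where "f n = ou_window \<alpha> (t - real n) t" for n
  have f: "\<exists>I. has_wiener_integral M W (f n) I" for n
    unfolding f_def using has_wiener_integral_ou_window[OF \<alpha> _ BP, of "t - real n" t] by auto
  then obtain I where I: "\<And>n. has_wiener_integral M W (f n) (I n)" by metis
  let ?r = "exp (- \<alpha>)" and ?c = "sqrt (1 / (2 * \<alpha>))"
  have r: "0 < ?r" "?r < 1" using \<alpha> by simp_all
  have dist: "l2dist lborel (f n) (ou_kernel \<alpha> t) = ?r ^ n * ?c" for n
    using l2dist_ou_window_kernel[OF \<alpha>, of "t - real n" t]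
    by (simp add: f_def mult.commute flip: exp_of_nat_mult)
  have lim: "(\<lambda>n. l2dist lborel (f n) (ou_kernel \<alpha> t)) \<longlonglongrightarrow> 0"
    unfolding dist using r by (intro tendsto_mult_left_zero LIMSEQ_realpow_zero) auto
  have sq: "sq_int lborel (f n)" for n by (rule has_wiener_integral_sq_int[OF I])
  have "summable (\<lambda>n. l2dist lborel (f (Suc n)) (f n))"
  proof (rule summable_comparison_test')
    \<comment> \<open>The factor 2 comes from passing through the full kernel, whose distances to
      windows n + 1 and n are both at most \<open>?r ^ n * ?c\<close>.\<close>
    show "summable (\<lambda>n. ?r ^ n * (2 * ?c))"
      using r by (intro summable_mult2 summable_geometric) simp
    show "norm (l2dist lborel (f (Suc n)) (f n)) \<le> ?r ^ n * (2 * ?c)" for n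
    proof -
      have "l2dist lborel (f (Suc n)) (f n) \<le> ?r ^ Suc n * ?c + ?r ^ n * ?c"
        using l2dist_triangle[OF sq[of "Suc n"] sq_int_ou_kernel[OF \<alpha>, of t] sq[of n]]
        unfolding l2dist_commute[of _ "ou_kernel \<alpha> t"] dist .
      moreover have "?r ^ Suc n * ?c \<le> ?r ^ n * ?c"
        using r \<alpha> by (intro mult_right_mono power_decreasing) auto
      ultimately have "l2dist lborel (f (Suc n)) (f n) \<le> ?r ^ n * ?c + ?r ^ n * ?c" by linarith
      then show ?thesis by simp
    qed
  qed
  then have "\<exists>J. has_wiener_integral M W (ou_kernel \<alpha> t) J"
    by (rule has_wiener_integral_exists_limit[OF I sq_int_ou_kernel[OF \<alpha>] lim])
  then show ?thesis unfolding wiener_integral_def by (rule someI_ex)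
qed

end


section \<open>Separated processes are not pseudo almost automorphic\<close>

text \<open>If \<phi> stayed above \<epsilon> on [T, \<infinity>), its means would be at least
  \<epsilon> times the share of that half-line in the mass of [-r, r]. By the liminf condition
  [0, r] has a share above some l > 0, and the bounded piece [0, N] is negligible because the total
  mass is infinite.\<close>

lemma mean_zero_small_values:
  assumes \<mu>: "admissible_measure \<mu>" and \<phi>: "mean_zero \<mu> \<phi>" and \<epsilon>: "0 < \<epsilon>"
  shows "\<exists>t\<ge>T. \<phi> t < \<epsilon>"
proof (rule ccontr)
  assume "\<not> (\<exists>t\<ge>T. \<phi> t < \<epsilon>)"
  then have ge: "\<epsilon> \<le> \<phi> t" if "t \<ge> T" for t using that by (auto simp: not_less)
  define N where "N = max T 0"
  \<comment> \<open>\<epsilon> may be infinite, so a positive real number below it is used.\<close>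
  obtain e where e: "0 < e" "ennreal e \<le> \<epsilon>"
  proof (cases \<epsilon>)
    case (real r)
    with \<epsilon> that[of r] show thesis by simp
  next
    case top
    with that[of 1] show thesis by simp
  qed
  have sets [measurable_cong]: "sets \<mu> = sets borel" using \<mu> by (simp add: admissible_measure_def)
  have fin: "emeasure \<mu> {a..b} < \<infinity>" for a b
    using \<mu> by (simp add: admissible_measure_def is_interval_cc)
  then have em: "emeasure \<mu> {a..b} = ennreal (measure \<mu> {a..b})" for a b
    by (intro emeasure_eq_ennreal_measure) (auto simp: less_top)
  have le: "measure \<mu> A \<le> measure \<mu> {a..b}" if "A \<subseteq> {a..b}" "A \<in> sets borel" for A a b
    using that fin[of a b] by (intro measure_mono_fmeasurable) (auto simp: fmeasurable_def sets)
  define m where "m r = measure \<mu> {-r..r}" for r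
  have large: "\<forall>\<^sub>F r in at_top. C < m r" for C :: real
  proof -
    have "(\<lambda>n. emeasure \<mu> {-real n..real n}) \<longlonglongrightarrow> emeasure \<mu> (\<Union>n. {-real n..real n})"
      by (intro Lim_emeasure_incseq) (auto simp: incseq_def sets)
    moreover have "(\<Union>n. {-real n..real n}) = UNIV"
    proof -
      have "\<exists>n. x \<in> {-real n..real n}" for x
        using real_arch_simple[of "\<bar>x\<bar>"] by (auto simp: abs_le_iff minus_le_iff)
      then show ?thesis by auto
    qed
    ultimately have "(\<lambda>n. emeasure \<mu> {-real n..real n}) \<longlonglongrightarrow> \<infinity>"
      using \<mu> by (simp add: admissible_measure_def)
    then have "\<forall>\<^sub>F n in sequentially. ennreal \<bar>C\<bar> < emeasure \<mu> {-real n..real n}"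
      by (rule order_tendstoD) simp
    then obtain n where "ennreal \<bar>C\<bar> < emeasure \<mu> {-real n..real n}"
      by (auto simp: eventually_sequentially)
    then have "\<bar>C\<bar> < m (real n)" by (simp add: em m_def ennreal_less_iff)
    moreover have "m (real n) \<le> m r" if "r \<ge> real n" for r
      unfolding m_def using that by (intro le) auto
    ultimately show ?thesis
      by (intro eventually_mono[OF eventually_ge_at_top[of "real n"]]) force
  qed
  obtain l where l: "0 < l" and lim: "\<forall>\<^sub>F r in at_top. ennreal l < emeasure \<mu> {0..r} / emeasure \<mu> {-r..r}"
  proof -
    have "0 < Liminf at_top (\<lambda>r. emeasure \<mu> {0..r} / emeasure \<mu> {-r..r})"
      using \<mu> by (simp add: admissible_measure_def)
    then obtain y where y: "0 < y" "y < Liminf at_top (\<lambda>r. emeasure \<mu> {0..r} / emeasure \<mu> {-r..r})"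
      using dense by blast
    then obtain l where "y = ennreal l" "0 < l" by (cases y) auto
    with less_LiminfD[OF y(2)] that show thesis by auto
  qed
  have small: "\<forall>\<^sub>F r in at_top. (\<integral>\<^sup>+t\<in>{-r..r}. \<phi> t \<partial>\<mu>) / emeasure \<mu> {-r..r} < ennreal (e * l / 2)"
    using \<phi> e l unfolding mean_zero_def by (intro order_tendstoD) auto
  \<comment> \<open>For such r both [0, N] and [N, r] have mass below \<open>l * m r / 2\<close>,
    while [0, r] has mass above \<open>l * m r\<close>: this is why l is halved in
    \<open>small\<close>.\<close>
  have "\<forall>\<^sub>F r in at_top. r \<ge> N \<and> 0 < m r \<and> 2 * measure \<mu> {0..N} / l < m r \<and>
      ennreal l < emeasure \<mu> {0..r} / emeasure \<mu> {-r..r} \<and>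
      (\<integral>\<^sup>+t\<in>{-r..r}. \<phi> t \<partial>\<mu>) / emeasure \<mu> {-r..r} < ennreal (e * l / 2)"
    by (intro eventually_conj eventually_ge_at_top large lim small)
  then obtain r where r: "r \<ge> N" "0 < m r" "2 * measure \<mu> {0..N} / l < m r"
      "ennreal l < emeasure \<mu> {0..r} / emeasure \<mu> {-r..r}"
      "(\<integral>\<^sup>+t\<in>{-r..r}. \<phi> t \<partial>\<mu>) / emeasure \<mu> {-r..r} < ennreal (e * l / 2)"
    by (auto simp: eventually_at_top_linorder)
  have "ennreal (e * measure \<mu> {N..r}) = (\<integral>\<^sup>+t. ennreal e * indicator {N..r} t \<partial>\<mu>)"
    using e by (subst nn_integral_cmult_indicator) (auto simp: em ennreal_mult sets)
  also have "\<dots> \<le> (\<integral>\<^sup>+t\<in>{-r..r}. \<phi> t \<partial>\<mu>)"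
  proof (rule nn_integral_mono)
    show "ennreal e * indicator {N..r} t \<le> \<phi> t * indicator {-r..r} t" for t
      using order_trans[OF e(2) ge[of t]] r(1) by (auto simp: indicator_def N_def)
  qed
  finally have "ennreal (e * measure \<mu> {N..r}) / emeasure \<mu> {-r..r}
      \<le> (\<integral>\<^sup>+t\<in>{-r..r}. \<phi> t \<partial>\<mu>) / emeasure \<mu> {-r..r}"
    by (rule divide_right_mono_ennreal)
  from le_less_trans[OF this r(5)]
  have "ennreal (e * measure \<mu> {N..r}) / ennreal (m r) < ennreal (e * l / 2)"
    unfolding em[of "-r" r] m_def .
  then have "e * measure \<mu> {N..r} / m r < e * l / 2"
    using e r(2) by (simp add: divide_ennreal ennreal_less_iff)
  then have 1: "2 * measure \<mu> {N..r} < l * m r"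
    using e r(2) by (simp add: field_simps)
  have "ennreal l < ennreal (measure \<mu> {0..r} / m r)"
    using r(4) r(2) by (simp add: em divide_ennreal m_def)
  then have 2: "l * m r < measure \<mu> {0..r}"
    using l r(2) by (simp add: ennreal_less_iff field_simps)
  have 3: "2 * measure \<mu> {0..N} < l * m r"
    using r(3) l by (simp add: field_simps)
  have "{0..r} = {0..N} \<union> {N..r}" using r(1) by (auto simp: N_def)
  then have "measure \<mu> {0..r} \<le> measure \<mu> {0..N} + measure \<mu> {N..r}"
    using measure_Un_le[of "{0..N}" \<mu> "{N..r}"] by (simp add: sets)
  with 1 2 3 show False by linarith
qed

text \<open>\<open>N\<close> is the seminorm at the origin. Almost automorphy is only used through the convergence
  of a subsequence of \<open>N\<close>-translates; \<open>Z\<close> is \<open>N\<close>-small along a sequence tending to infinity, hence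
  some translates of \<open>X\<close> far apart would be \<open>N\<close>-close to each other.\<close>

lemma separated_not_decomposable:
  fixes N :: "(real \<Rightarrow> 'a \<Rightarrow> real) \<Rightarrow> ennreal"
  assumes X: "\<And>t. sq_int M (X t)" and sep: "\<And>s t. 1 \<le> \<bar>s - t\<bar> \<Longrightarrow> c \<le> l2dist M (X s) (X t)"
    and sum: "is_sum M X Y Z"
    and L_l2: "\<And>h. L h \<Longrightarrow> l2_process M h"
    and L_shift: "\<And>h u. L h \<Longrightarrow> L (shift u h)"
    and L_diff: "\<And>h g. L h \<Longrightarrow> L g \<Longrightarrow> L (pdiff h g)"
    and LYZ: "L Y" "L Z"
    and \<delta>: "0 < \<delta>" and lower: "\<And>A B C D. L A \<Longrightarrow> L B \<Longrightarrow> L C \<Longrightarrow> L D \<Longrightarrow>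
      (\<And>s. c \<le> l2norm M (A s) + l2norm M (B s) + l2norm M (C s) + l2norm M (D s)) \<Longrightarrow>
      N A < \<delta> \<Longrightarrow> N B < \<delta> \<Longrightarrow> N C < \<delta> \<Longrightarrow> N D < \<delta> \<Longrightarrow> False"
    and Z: "\<And>T \<epsilon>. 0 < \<epsilon> \<Longrightarrow> \<exists>t\<ge>T. N (shift t Z) < \<epsilon>"
    and Y: "\<And>t'. \<exists>\<rho> g. strict_mono (\<rho> :: nat \<Rightarrow> nat) \<and> L g \<and>
      (\<lambda>n. N (pdiff (shift (t' (\<rho> n)) Y) g)) \<longlonglongrightarrow> 0"
  shows False
proof -
  have "\<exists>t\<ge>real n. N (shift t Z) < \<delta>" for n using Z[OF \<delta>] by blast
  then obtain t' where t': "\<And>n. t' n \<ge> real n" "\<And>n. N (shift (t' n) Z) < \<delta>" by metis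
  obtain \<rho> g where \<rho>: "strict_mono (\<rho> :: nat \<Rightarrow> nat)" and g: "L g"
    and conv: "(\<lambda>n. N (pdiff (shift (t' (\<rho> n)) Y) g)) \<longlonglongrightarrow> 0" using Y[of t'] by blast
  from order_tendstoD(2)[OF conv \<delta>] obtain K where
    K: "\<And>n. n \<ge> K \<Longrightarrow> N (pdiff (shift (t' (\<rho> n)) Y) g) < \<delta>"
    by (auto simp: eventually_sequentially)
  \<comment> \<open>First u is fixed, then a later index is taken so large that its translation v
    exceeds u + 1. Both indices are at least \<open>K\<close>, so both translates of Y are close to
    the same g.\<close>
  define u where "u = t' (\<rho> K)"
  obtain m where m: "real m \<ge> max (real K) (u + 1)" using real_arch_simple by blast
  define v where "v = t' (\<rho> m)"
  have "real m \<le> v"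
    using t'(1)[of "\<rho> m"] seq_suble[OF \<rho>, of m] unfolding v_def by linarith
  with m have uv: "1 \<le> \<bar>u - v\<bar>" by linarith
  have N_small: "N (shift u Z) < \<delta>" "N (shift v Z) < \<delta>"
    "N (pdiff (shift u Y) g) < \<delta>" "N (pdiff (shift v Y) g) < \<delta>"
    using K[of K] K[of m] m t'(2) by (simp_all add: u_def v_def)
  have "c \<le> l2norm M (shift u Z s) + l2norm M (shift v Z s)
      + l2norm M (pdiff (shift u Y) g s) + l2norm M (pdiff (shift v Y) g s)" for s
  proof -
    note LZ = L_shift[OF LYZ(2)] and LY = L_diff[OF L_shift[OF LYZ(1)] g]
    have sqZ: "sq_int M (shift w Z s)" and sqY: "sq_int M (pdiff (shift w Y) g s)" for w
      using L_l2[OF LZ] L_l2[OF LY] by (simp_all add: l2_process_def)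
    let ?P = "\<lambda>\<omega>. shift u Z s \<omega> - shift v Z s \<omega>"
    \<comment> \<open>The limit g cancels in \<open>?Q\<close>, so \<open>?P\<close> plus
      \<open>?Q\<close> is X(s+u) - X(s+v) almost surely.\<close>
    let ?Q = "\<lambda>\<omega>. pdiff (shift u Y) g s \<omega> - pdiff (shift v Y) g s \<omega>"
    have P: "sq_int M ?P" and Q: "sq_int M ?Q" by (intro sq_int_diff sqZ sqY)+
    have "c \<le> l2dist M (X (s + u)) (X (s + v))" using uv by (intro sep) simp
    also have "\<dots> = l2norm M (\<lambda>\<omega>. ?P \<omega> + ?Q \<omega>)"
      unfolding l2dist_def
    proof (rule l2norm_cong_AE)
      show "(\<lambda>\<omega>. X (s + u) \<omega> - X (s + v) \<omega>) \<in> borel_measurable M"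
        by (rule sq_int_measurable) (intro sq_int_diff X)
      show "(\<lambda>\<omega>. ?P \<omega> + ?Q \<omega>) \<in> borel_measurable M"
        by (rule sq_int_measurable) (intro sq_int_add P Q)
      have "AE \<omega> in M. X (s + u) \<omega> = Y (s + u) \<omega> + Z (s + u) \<omega>"
        "AE \<omega> in M. X (s + v) \<omega> = Y (s + v) \<omega> + Z (s + v) \<omega>"
        using sum by (simp_all add: is_sum_def)
      then show "AE \<omega> in M. X (s + u) \<omega> - X (s + v) \<omega> = ?P \<omega> + ?Q \<omega>"
        by eventually_elim (simp add: shift_def pdiff_def)
    qed
    also have "\<dots> \<le> l2norm M ?P + l2norm M ?Q" by (rule l2norm_triangle[OF P Q])
    finally show ?thesis
      using l2norm_diff_le[OF sqZ[of u] sqZ[of v]] l2norm_diff_le[OF sqY[of u] sqY[of v]] by linarith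
  qed
  with N_small show False
    by (intro lower[of "shift u Z" "shift v Z" "pdiff (shift u Y) g" "pdiff (shift v Y) g"]
        L_diff L_shift LYZ g)
qed

lemma N_almost_automorphic_at_origin:
  fixes t' :: "nat \<Rightarrow> real"
  assumes "N_almost_automorphic L N_at N Y"
  shows "\<exists>\<rho> g. strict_mono \<rho> \<and> L g \<and> (\<lambda>n. N_at (pdiff (shift (t' (\<rho> n)) Y) g) 0) \<longlonglongrightarrow> 0"
proof -
  have "\<exists>\<rho> g. strict_mono \<rho> \<and> L g \<and>
        (\<forall>t. (\<lambda>n. N_at (pdiff (shift (t' (\<rho> n)) Y) g) t) \<longlonglongrightarrow> 0 \<and>
             (\<lambda>n. N_at (pdiff (shift (- t' (\<rho> n)) g) Y) t) \<longlonglongrightarrow> 0)"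
    by (rule assms[unfolded N_almost_automorphic_def, THEN conjunct2, THEN conjunct2, THEN spec])
  then show ?thesis by (elim ex_forward conj_forward) simp_all
qed

lemma separated_not_sm_pseudo_almost_automorphic:
  assumes \<mu>: "admissible_measure \<mu>" and c: "0 < c"
    and X: "\<And>t. sq_int M (X t)" and sep: "\<And>s t. 1 \<le> \<bar>s - t\<bar> \<Longrightarrow> c \<le> l2dist M (X s) (X t)"
  shows "\<not> sm_pseudo_almost_automorphic M \<mu> X"
proof
  assume "sm_pseudo_almost_automorphic M \<mu> X"
  then obtain Y Z where YZ: "is_sum M X Y Z" "sm_almost_automorphic M Y" "sm_ergodic M \<mu> Z"
    by (auto simp: sm_pseudo_almost_automorphic_def)
  show False
  \<comment> \<open>The seminorm is the norm of the value at 0, so four terms below c/4 contradict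
    the lower bound at s = 0.\<close>
  proof (rule separated_not_decomposable[of M X c Y Z "l2_process M" "ennreal (c / 4)"
        "\<lambda>h. ennreal (l2norm M (h 0))", OF X sep YZ(1)])
    show "\<exists>t\<ge>T. ennreal (l2norm M (shift t Z 0)) < \<epsilon>" if "0 < \<epsilon>" for T \<epsilon>
      using mean_zero_small_values[OF \<mu> _ that] YZ(3) by (auto simp: sm_ergodic_def shift_def)
    show "\<exists>\<rho> g. strict_mono \<rho> \<and> l2_process M g \<and>
      (\<lambda>n. ennreal (l2norm M (pdiff (shift (t' (\<rho> n)) Y) g 0))) \<longlonglongrightarrow> 0" for t' :: "nat \<Rightarrow> real"
    proof -
      obtain \<rho> G where "strict_mono \<rho>" "l2_process M G" "(\<lambda>n. l2dist M (Y (0 + t' (\<rho> n))) (G 0)) \<longlonglongrightarrow> 0"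
        using YZ(2) unfolding sm_almost_automorphic_def by blast
      then show ?thesis
        using tendsto_ennrealI[of _ 0 sequentially]
        by (intro exI[of _ \<rho>] exI[of _ G]) (auto simp: l2dist_def pdiff_def shift_def)
    qed
    show False
      if "\<And>s. c \<le> l2norm M (A s) + l2norm M (B s) + l2norm M (C s) + l2norm M (D s)"
        and "ennreal (l2norm M (A 0)) < ennreal (c / 4)" "ennreal (l2norm M (B 0)) < ennreal (c / 4)"
          "ennreal (l2norm M (C 0)) < ennreal (c / 4)" "ennreal (l2norm M (D 0)) < ennreal (c / 4)" for A B C D
      using that(1)[of 0] that(2-5) by (simp add: ennreal_less_iff)
  qed (use YZ c in \<open>auto simp: sm_almost_automorphic_def sm_ergodic_def l2_continuous_def l2_process_def
      shift_def pdiff_def ennreal_less_iff intro: sq_int_diff dest: spec[of _ 0]\<close>)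
qed


section \<open>Strongly measurable processes\<close>

text \<open>\<open>bochner_l2\<close> without the finite integral: this part is stable under
  differences and translations with no estimate to carry along, and it suffices for integrating the
  lower bound.\<close>

definition strongly_measurable :: "'a measure \<Rightarrow> real measure \<Rightarrow> (real \<Rightarrow> 'a \<Rightarrow> real) \<Rightarrow> bool" where
  "strongly_measurable M m h \<longleftrightarrow> (\<forall>s\<in>space m. sq_int M (h s)) \<and>
     (\<exists>F :: nat \<Rightarrow> real \<Rightarrow> 'a \<Rightarrow> real.
        (\<forall>n. simple_function m (F n) \<and> (\<forall>s\<in>space m. sq_int M (F n s))) \<and>
        (AE s in m. (\<lambda>n. l2dist M (F n s) (h s)) \<longlonglongrightarrow> 0))"

lemma bochner_l2_strongly_measurable: "bochner_l2 M m h \<Longrightarrow> strongly_measurable M m h"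
  by (simp add: bochner_l2_def strongly_measurable_def)

lemma strongly_measurableE:
  assumes "strongly_measurable M m h"
  obtains F where "\<forall>n. simple_function m (F n)" "\<forall>n. \<forall>s\<in>space m. sq_int M (F n s)"
    "AE s in m. (\<lambda>n. l2dist M (F n s) (h s)) \<longlonglongrightarrow> 0" "\<forall>s\<in>space m. sq_int M (h s)"
proof -
  note h = assms[unfolded strongly_measurable_def]
  from h[THEN conjunct2] obtain F where
    F: "\<forall>n. simple_function m (F n) \<and> (\<forall>s\<in>space m. sq_int M (F n s))"
      "AE s in m. (\<lambda>n. l2dist M (F n s) (h s)) \<longlonglongrightarrow> 0"
    by (elim conjE exE)
  show thesis
    by (rule that[of F]) (use F h[THEN conjunct1] in simp_all)
qed

lemma strongly_measurable_pdiff: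
  assumes "strongly_measurable M m h" "strongly_measurable M m g"
  shows "strongly_measurable M m (pdiff h g)"
proof -
  obtain F where F_all: "\<forall>n. simple_function m (F n)" "\<forall>n. \<forall>s\<in>space m. sq_int M (F n s)"
    "AE s in m. (\<lambda>n. l2dist M (F n s) (h s)) \<longlonglongrightarrow> 0" and h_all: "\<forall>s\<in>space m. sq_int M (h s)"
    using assms(1) by (rule strongly_measurableE)
  note F = F_all[rule_format] and h = h_all[rule_format]
  obtain G where G_all: "\<forall>n. simple_function m (G n)" "\<forall>n. \<forall>s\<in>space m. sq_int M (G n s)"
    "AE s in m. (\<lambda>n. l2dist M (G n s) (g s)) \<longlonglongrightarrow> 0" and g_all: "\<forall>s\<in>space m. sq_int M (g s)"
    using assms(2) by (rule strongly_measurableE)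
  note G = G_all[rule_format] and g = g_all[rule_format]
  have simple: "simple_function m (pdiff (F n) (G n))" for n
    unfolding pdiff_def by (rule simple_function_compose2[OF F(1) G(1)])
  have "AE s in m. (\<lambda>n. l2dist M (pdiff (F n) (G n) s) (pdiff h g s)) \<longlonglongrightarrow> 0"
    using F(3) G(3) AE_space
  proof eventually_elim
    case (elim s)
    have "l2dist M (pdiff (F n) (G n) s) (pdiff h g s) \<le> l2dist M (F n s) (h s) + l2dist M (G n s) (g s)" for n
    proof -
      have "l2dist M (pdiff (F n) (G n) s) (pdiff h g s)
          = l2norm M (\<lambda>\<omega>. (F n s \<omega> - h s \<omega>) - (G n s \<omega> - g s \<omega>))"
        unfolding l2dist_def pdiff_def by (rule arg_cong[of _ _ "l2norm M"]) auto
      then show ?thesis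
        unfolding l2dist_def using elim(3) by (simp add: l2norm_diff_le sq_int_diff F G h g)
    qed
    moreover have "(\<lambda>n. l2dist M (F n s) (h s) + l2dist M (G n s) (g s)) \<longlonglongrightarrow> 0"
      using tendsto_add[OF elim(1,2)] by simp
    ultimately show ?case
      by (rule_tac Lim_null_comparison) (auto intro!: always_eventually)
  qed
  with simple F(2) G(2) h g show ?thesis
    unfolding strongly_measurable_def
    by (intro conjI exI[of _ "\<lambda>n. pdiff (F n) (G n)"]) (auto simp: pdiff_def intro: sq_int_diff)
qed

text \<open>The approximants converge only almost everywhere and the measure need not be complete,
  so the norm is merely equal almost everywhere to a measurable function. That is enough for
  additivity of the integral.\<close>

lemma strongly_measurable_l2norm:
  assumes "strongly_measurable M m h"
  shows "\<exists>b\<in>borel_measurable m. AE s in m. l2norm M (h s) = b s"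
proof -
  obtain F where F_all: "\<forall>n. simple_function m (F n)" "\<forall>n. \<forall>s\<in>space m. sq_int M (F n s)"
    "AE s in m. (\<lambda>n. l2dist M (F n s) (h s)) \<longlonglongrightarrow> 0" and h_all: "\<forall>s\<in>space m. sq_int M (h s)"
    using assms(1) by (rule strongly_measurableE)
  note F = F_all[rule_format] and h = h_all[rule_format]
  have [measurable]: "(\<lambda>s. l2norm M (F n s)) \<in> borel_measurable m" for n
    by (rule borel_measurable_simple_function, rule simple_function_compose1[OF F(1)])
  have "AE s in m. l2norm M (h s) = lim (\<lambda>n. l2norm M (F n s))"
    using F(3) AE_space
  proof eventually_elim
    case (elim s)
    then have "(\<lambda>n. l2norm M (F n s)) \<longlonglongrightarrow> l2norm M (h s)"
      by (intro tendsto_l2norm F h)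
    then show ?case by (simp add: limI)
  qed
  moreover have "(\<lambda>s. lim (\<lambda>n. l2norm M (F n s))) \<in> borel_measurable m" by measurable
  ultimately show ?thesis by (intro bexI)
qed

text \<open>The square of the pointwise bound is integrated. Of the factor 16, one 4 comes from the
  square of a sum of four terms and the other from adding four integrals below \<eta>.\<close>

lemma strongly_measurable_lower_bound:
  assumes A: "strongly_measurable M m A" and B: "strongly_measurable M m B"
    and C: "strongly_measurable M m C" and D: "strongly_measurable M m D"
    and c: "0 \<le> c" and le: "\<And>s. c \<le> l2norm M (A s) + l2norm M (B s) + l2norm M (C s) + l2norm M (D s)"
    and small: "(\<integral>\<^sup>+s. ennreal ((l2norm M (A s))\<^sup>2) \<partial>m) < \<eta>" "(\<integral>\<^sup>+s. ennreal ((l2norm M (B s))\<^sup>2) \<partial>m) < \<eta>"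
      "(\<integral>\<^sup>+s. ennreal ((l2norm M (C s))\<^sup>2) \<partial>m) < \<eta>" "(\<integral>\<^sup>+s. ennreal ((l2norm M (D s))\<^sup>2) \<partial>m) < \<eta>"
  shows "ennreal (c\<^sup>2) * emeasure m (space m) < 16 * \<eta>"
proof -
  obtain a where a [measurable]: "a \<in> borel_measurable m" and a': "AE s in m. l2norm M (A s) = a s"
    using strongly_measurable_l2norm[OF A] by blast
  obtain b where b [measurable]: "b \<in> borel_measurable m" and b': "AE s in m. l2norm M (B s) = b s"
    using strongly_measurable_l2norm[OF B] by blast
  obtain c' where c' [measurable]: "c' \<in> borel_measurable m" and c'': "AE s in m. l2norm M (C s) = c' s"
    using strongly_measurable_l2norm[OF C] by blast
  obtain d where d [measurable]: "d \<in> borel_measurable m" and d': "AE s in m. l2norm M (D s) = d s"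
    using strongly_measurable_l2norm[OF D] by blast
  have eq: "(\<integral>\<^sup>+s. ennreal ((l2norm M (H s))\<^sup>2) \<partial>m) = (\<integral>\<^sup>+s. ennreal ((f s)\<^sup>2) \<partial>m)"
    if "AE s in m. l2norm M (H s) = f s" for H and f :: "real \<Rightarrow> real"
    by (rule nn_integral_cong_AE) (use that in eventually_elim, simp)
  have "ennreal (c\<^sup>2) * emeasure m (space m) = (\<integral>\<^sup>+s. ennreal (c\<^sup>2) \<partial>m)" by simp
  also have "\<dots> \<le> (\<integral>\<^sup>+s. 4 * (ennreal ((a s)\<^sup>2) + ennreal ((b s)\<^sup>2) + ennreal ((c' s)\<^sup>2) + ennreal ((d s)\<^sup>2)) \<partial>m)"
  proof (rule nn_integral_mono_AE, use a' b' c'' d' in eventually_elim)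
    case (elim s)
    have "c\<^sup>2 \<le> (a s + b s + c' s + d s)\<^sup>2"
      using le[of s] elim c by (intro power_mono) auto
    also have "\<dots> \<le> 4 * ((a s)\<^sup>2 + (b s)\<^sup>2 + (c' s)\<^sup>2 + (d s)\<^sup>2)"
    proof -
      \<comment> \<open>The defect in the Cauchy-Schwarz inequality for four terms is the sum of the
        squares of the six differences.\<close>
      have "(x + y + z + w)\<^sup>2 + ((x - y)\<^sup>2 + (x - z)\<^sup>2 + (x - w)\<^sup>2 + (y - z)\<^sup>2 + (y - w)\<^sup>2 + (z - w)\<^sup>2)
          = 4 * (x\<^sup>2 + y\<^sup>2 + z\<^sup>2 + w\<^sup>2)" for x y z w :: real
        by (simp add: power2_eq_square algebra_simps)
      from this[of "a s" "b s" "c' s" "d s"] show ?thesis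
        by (smt (verit) zero_le_power2)
    qed
    finally have "ennreal (c\<^sup>2) \<le> ennreal (4 * ((a s)\<^sup>2 + (b s)\<^sup>2 + (c' s)\<^sup>2 + (d s)\<^sup>2))"
      by (rule ennreal_leI)
    then show ?case by (simp add: ennreal_mult)
  qed
  also have "\<dots> = 4 * ((\<integral>\<^sup>+s. ennreal ((a s)\<^sup>2) \<partial>m) + (\<integral>\<^sup>+s. ennreal ((b s)\<^sup>2) \<partial>m)
      + (\<integral>\<^sup>+s. ennreal ((c' s)\<^sup>2) \<partial>m) + (\<integral>\<^sup>+s. ennreal ((d s)\<^sup>2) \<partial>m))"
    by (simp add: nn_integral_cmult nn_integral_add)
  also have "\<dots> < 4 * (\<eta> + \<eta> + \<eta> + \<eta>)"
    using small unfolding eq[OF a'] eq[OF b'] eq[OF c''] eq[OF d']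
    by (intro ennreal_mult_strict_left_mono add_strict_mono) auto
  also have "\<dots> = 16 * \<eta>"
    by (cases \<eta>) (auto simp: ennreal_mult_top simp flip: ennreal_plus ennreal_mult' ennreal_numeral)
  finally show ?thesis .
qed

lemma ennreal_sqrt_less_iff:
  assumes "0 \<le> d"
  shows "ennreal_sqrt x < ennreal d \<longleftrightarrow> x < ennreal (d\<^sup>2)"
proof (cases x)
  case (real r)
  have "sqrt r < d \<longleftrightarrow> r < d\<^sup>2"
    using real_sqrt_less_iff[of r "d\<^sup>2"] unfolding real_sqrt_abs abs_of_nonneg[OF assms] .
  with real assms show ?thesis by (simp add: ennreal_sqrt_def ennreal_less_iff)
qed (simp add: ennreal_sqrt_def)

lemma separated_not_stepanov_pseudo_almost_automorphic:
  assumes \<mu>: "admissible_measure \<mu>"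
    and \<nu>: "sets \<nu> = sets (restrict_space borel {0..1::real})" "0 < emeasure \<nu> {0..1}" "emeasure \<nu> {0..1} < \<infinity>"
    and c: "0 < c" and X: "\<And>t. sq_int M (X t)"
    and sep: "\<And>s t. 1 \<le> \<bar>s - t\<bar> \<Longrightarrow> c \<le> l2dist M (X s) (X t)"
  shows "\<not> stepanov_pseudo_almost_automorphic M \<nu> \<mu> X"
proof
  assume "stepanov_pseudo_almost_automorphic M \<nu> \<mu> X"
  then obtain Y Z where YZ: "is_sum M X Y Z"
      "N_almost_automorphic (loc_sq_int_stepanov M \<nu>) (stepanov_at M \<nu>) (stepanov_norm M \<nu>) Y"
      "N_ergodic (loc_sq_int_stepanov M \<nu>) (stepanov_at M \<nu>) (stepanov_norm M \<nu>) \<mu> Z"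
    by (auto simp: stepanov_pseudo_almost_automorphic_def)
  have space: "space \<nu> = {0..1}"
    using sets_eq_imp_space_eq[OF \<nu>(1)] by (simp add: space_restrict_space)
  obtain \<kappa> where \<kappa>: "emeasure \<nu> {0..1} = ennreal \<kappa>" "0 < \<kappa>"
    using \<nu>(2,3) by (cases "emeasure \<nu> {0..1}") auto
  \<comment> \<open>All translates are included, which makes \<open>L\<close> shift-invariant
    although \<nu> itself is not translation invariant. Evaluating the translates at 0 also recovers
    every value of h.\<close>
  define L where "L h \<longleftrightarrow> (\<forall>t. strongly_measurable M \<nu> (shift t h))" for h
  have L: "L h" if "loc_sq_int_stepanov M \<nu> h" for h
    using that by (auto simp: L_def loc_sq_int_stepanov_def intro: bochner_l2_strongly_measurable)
  show False
  \<comment> \<open>With \<kappa> the mass of \<nu>, 16 times the square of this threshold is c^2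
    \<kappa>, exactly the integral of the lower bound.\<close>
  proof (rule separated_not_decomposable[of M X c Y Z L "ennreal (c * sqrt \<kappa> / 4)"
        "\<lambda>h. stepanov_at M \<nu> h 0", OF X sep YZ(1)])
    show "l2_process M h" if "L h" for h
      unfolding l2_process_def
    proof
      fix t
      have "sq_int M (shift t h 0)"
        using that by (auto simp: L_def strongly_measurable_def space)
      then show "sq_int M (h t)" by (simp add: shift_def)
    qed
    show "L (shift u h)" if "L h" for u h
      using that by (auto simp: L_def shift_def add.assoc)
    show "L (pdiff h g)" if "L h" "L g" for h g
    proof -
      have "shift t (pdiff h g) = pdiff (shift t h) (shift t g)" for t
        by (simp add: shift_def pdiff_def)
      with that show ?thesis by (simp add: L_def strongly_measurable_pdiff)
    qed
    show "L Y" "L Z" using YZ(2,3) by (auto simp: N_almost_automorphic_def N_ergodic_def intro: L)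
    show "0 < ennreal (c * sqrt \<kappa> / 4)" using c \<kappa> by simp
    show False
      if "L A" "L B" "L C" "L D"
        and le: "\<And>s. c \<le> l2norm M (A s) + l2norm M (B s) + l2norm M (C s) + l2norm M (D s)"
        and "stepanov_at M \<nu> A 0 < ennreal (c * sqrt \<kappa> / 4)" "stepanov_at M \<nu> B 0 < ennreal (c * sqrt \<kappa> / 4)"
          "stepanov_at M \<nu> C 0 < ennreal (c * sqrt \<kappa> / 4)" "stepanov_at M \<nu> D 0 < ennreal (c * sqrt \<kappa> / 4)"
      for A B C D
    proof -
      have meas: "strongly_measurable M \<nu> h" if "L h" for h
        using that unfolding L_def by (auto simp: shift_def dest: spec[of _ 0])
      have small: "(\<integral>\<^sup>+s. ennreal ((l2norm M (h s))\<^sup>2) \<partial>\<nu>) < ennreal ((c * sqrt \<kappa> / 4)\<^sup>2)"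
        if "stepanov_at M \<nu> h 0 < ennreal (c * sqrt \<kappa> / 4)" for h
        using that c \<kappa> by (simp add: stepanov_at_def ennreal_sqrt_less_iff)
      have "ennreal (c\<^sup>2) * emeasure \<nu> (space \<nu>) < 16 * ennreal ((c * sqrt \<kappa> / 4)\<^sup>2)"
        by (rule strongly_measurable_lower_bound[OF meas meas meas meas less_imp_le[OF c] le small small small small])
           (fact that)+
      also have "\<dots> = ennreal (16 * (c * sqrt \<kappa> / 4)\<^sup>2)" by (simp add: ennreal_mult)
      also have "16 * (c * sqrt \<kappa> / 4)\<^sup>2 = c\<^sup>2 * \<kappa>"
        using \<kappa> by (simp add: power_divide power_mult_distrib)
      also have "ennreal (c\<^sup>2 * \<kappa>) = ennreal (c\<^sup>2) * emeasure \<nu> (space \<nu>)"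
        using \<kappa> by (simp add: space ennreal_mult)
      finally show False by simp
    qed
    show "\<exists>t\<ge>T. stepanov_at M \<nu> (shift t Z) 0 < \<epsilon>" if "0 < \<epsilon>" for T \<epsilon>
      using mean_zero_small_values[OF \<mu> _ that, of "stepanov_at M \<nu> Z" T] YZ(3)
      by (auto simp: N_ergodic_def stepanov_at_def shift_def add.commute)
    show "\<exists>\<rho> g. strict_mono \<rho> \<and> L g \<and>
      (\<lambda>n. stepanov_at M \<nu> (pdiff (shift (t' (\<rho> n)) Y) g) 0) \<longlonglongrightarrow> 0" for t' :: "nat \<Rightarrow> real"
      using N_almost_automorphic_at_origin[OF YZ(2), of t'] L by blast
  qed
qed


section \<open>The Weyl and Besicovitch seminorms\<close>

lemma AE_lborel_translate:
  assumes "AE x in lborel. P x"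
  shows "AE x in lborel. P (t + x :: real)"
proof -
  have "AE x in distr lborel borel ((+) t). P x" using assms by (simp only: lborel_distr_plus)
  then show ?thesis by (rule AE_distrD[rotated]) simp
qed

lemma strongly_measurable_shift:
  assumes h: "strongly_measurable M (restrict_space lborel {a + u..b + u}) h"
  shows "strongly_measurable M (restrict_space lborel {a..b}) (shift u h)"
proof -
  let ?m = "restrict_space lborel {a..b}" and ?m' = "restrict_space lborel {a + u..b + u}"
  obtain F where F_all: "\<forall>n. simple_function ?m' (F n)" "\<forall>n. \<forall>s\<in>space ?m'. sq_int M (F n s)"
    "AE s in ?m'. (\<lambda>n. l2dist M (F n s) (h s)) \<longlonglongrightarrow> 0" and sq_all: "\<forall>s\<in>space ?m'. sq_int M (h s)"
    using h by (rule strongly_measurableE)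
  note F = F_all[rule_format] and sq = sq_all[rule_format]
  have T: "(\<lambda>s. s + u) \<in> measurable ?m ?m'"
    by (intro measurable_restrict_space3) (auto simp: space_restrict_space)
  have sp: "s + u \<in> space ?m'" if "s \<in> space ?m" for s
    using that by (simp add: space_restrict_space)
  have "AE s in lborel. s \<in> {a + u..b + u} \<longrightarrow> (\<lambda>n. l2dist M (F n s) (h s)) \<longlonglongrightarrow> 0"
    using F(3) by (subst (asm) AE_restrict_space_iff) auto
  from AE_lborel_translate[OF this, of u]
  have "AE s in ?m. (\<lambda>n. l2dist M (F n (s + u)) (shift u h s)) \<longlonglongrightarrow> 0"
    by (subst AE_restrict_space_iff) (auto simp: shift_def add.commute)
  then show ?thesis
    unfolding strongly_measurable_def
    using F(2) sq sp simple_function_comp[OF T F(1)]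
    by (intro conjI exI[of _ "\<lambda>n s. F n (s + u)"]) (auto simp: shift_def)
qed

text \<open>Translation invariance of Lebesgue measure. The substitution requires a Borel integrand,
  so the norm is first replaced on the window by an almost everywhere equal measurable
  function.\<close>

lemma quad_mean_shift:
  assumes h: "\<And>a b. strongly_measurable M (restrict_space lborel {a..b}) h"
  shows "quad_mean M (shift t h) 0 r = quad_mean M h t r"
proof -
  let ?I = "{t - r..t + r}"
  obtain b where b [measurable]: "b \<in> borel_measurable (restrict_space lborel ?I)"
    and eq: "AE s in restrict_space lborel ?I. l2norm M (h s) = b s"
    using strongly_measurable_l2norm[OF h[of "t - r" "t + r"]] by blast
  have eq': "AE s in lborel. s \<in> ?I \<longrightarrow> l2norm M (h s) = b s"
    using eq by (subst (asm) AE_restrict_space_iff) auto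
  define f where "f s = b s * indicator ?I s" for s
  have f [measurable]: "f \<in> borel_measurable borel"
    using b unfolding f_def[abs_def]
    by (subst (asm) borel_measurable_restrict_space_iff) (auto simp: mult.commute)
  have "(\<integral>\<^sup>+s\<in>?I. ennreal ((l2norm M (h s))\<^sup>2) \<partial>lborel) = (\<integral>\<^sup>+s. ennreal ((f s)\<^sup>2) \<partial>lborel)"
    by (rule nn_integral_cong_AE) (use eq' in eventually_elim, auto simp: f_def indicator_def)
  also have "\<dots> = (\<integral>\<^sup>+s. ennreal ((f (t + 1 * s))\<^sup>2) \<partial>lborel)"
    by (subst nn_integral_real_affine[of _ 1 t]) simp_all
  also have "\<dots> = (\<integral>\<^sup>+s\<in>{0 - r..0 + r}. ennreal ((l2norm M (shift t h s))\<^sup>2) \<partial>lborel)"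
    by (rule nn_integral_cong_AE, use AE_lborel_translate[OF eq', of t] in eventually_elim)
       (auto simp: f_def indicator_def shift_def add.commute)
  finally show ?thesis by (simp add: quad_mean_def)
qed

text \<open>For r at least |t| the window [t - r, t + r] lies in [-2r, 2r], which is only twice as
  long, so the mean square at most doubles. The factor 2 generously covers the resulting square root
  of 2.\<close>

lemma weyl_at_le:
  assumes small: "besicovitch_norm M h < ennreal e" and e: "0 < e"
  shows "weyl_at M h t \<le> ennreal (2 * e)"
  unfolding weyl_at_def
proof (rule Limsup_bounded)
  have ev: "\<forall>\<^sub>F r in at_top. quad_mean M h 0 r < ennreal e"
    by (rule Limsup_lessD) (use small in \<open>simp add: besicovitch_norm_def\<close>)
  have "filterlim (\<lambda>r::real. 2 * r) at_top at_top"
    by (rule filterlim_tendsto_pos_mult_at_top[OF tendsto_const _ filterlim_ident]) simp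
  from eventually_compose_filterlim[OF ev this]
  have "\<forall>\<^sub>F r in at_top. quad_mean M h 0 (2 * r) < ennreal e" .
  with eventually_ge_at_top[of "\<bar>t\<bar>"] eventually_gt_at_top[of 0]
  show "\<forall>\<^sub>F r in at_top. quad_mean M h t r \<le> ennreal (2 * e)"
  proof eventually_elim
    case (elim r)
    let ?f = "\<lambda>s. ennreal ((l2norm M (h s))\<^sup>2)"
    have "(\<integral>\<^sup>+s\<in>{0 - 2 * r..0 + 2 * r}. ?f s \<partial>lborel) / ennreal (2 * (2 * r)) < ennreal (e\<^sup>2)"
      using elim(3) e by (simp add: quad_mean_def ennreal_sqrt_less_iff)
    then obtain J where J: "(\<integral>\<^sup>+s\<in>{0 - 2 * r..0 + 2 * r}. ?f s \<partial>lborel) = ennreal J" "0 \<le> J"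
      using elim(2) by (cases "\<integral>\<^sup>+s\<in>{0 - 2 * r..0 + 2 * r}. ?f s \<partial>lborel")
        (auto simp: ennreal_top_divide)
    with \<open>_ < ennreal (e\<^sup>2)\<close> elim(2) have "J / (2 * (2 * r)) < e\<^sup>2"
      by (simp add: divide_ennreal ennreal_less_iff)
    then have "J / (2 * r) < 2 * e\<^sup>2" using elim(2) by (simp add: field_simps)
    also have "\<dots> \<le> (2 * e)\<^sup>2" by (simp add: power_mult_distrib)
    finally have J': "J / (2 * r) < (2 * e)\<^sup>2" .
    have "(\<integral>\<^sup>+s\<in>{t - r..t + r}. ?f s \<partial>lborel) \<le> ennreal J"
      unfolding J(1)[symmetric] using elim(1)
      by (intro nn_integral_mono) (auto simp: indicator_def)
    then have "(\<integral>\<^sup>+s\<in>{t - r..t + r}. ?f s \<partial>lborel) / ennreal (2 * r) \<le> ennreal J / ennreal (2 * r)"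
      by (rule divide_right_mono_ennreal)
    also have "\<dots> < ennreal ((2 * e)\<^sup>2)"
      using J J' elim(2) by (simp add: divide_ennreal ennreal_less_iff)
    finally have "quad_mean M h t r < ennreal (2 * e)"
      unfolding quad_mean_def using e by (subst ennreal_sqrt_less_iff) auto
    then show ?case by simp
  qed
qed

text \<open>Lets \<open>mean_zero_small_values\<close> be applied to the Weyl and Besicovitch
  classes, whose ergodicity is taken with Lebesgue measure. The mass ratio is 1/2.\<close>

lemma admissible_lborel: "admissible_measure lborel"
proof -
  have "\<forall>\<^sub>F r :: real in at_top. ennreal (1 / 2) \<le> emeasure lborel {0..r} / emeasure lborel {- r..r}"
    using eventually_gt_at_top[of "0::real"]
    by eventually_elim (simp add: divide_ennreal)
  then have "ennreal (1 / 2) \<le> Liminf at_top (\<lambda>r::real. emeasure lborel {0..r} / emeasure lborel {- r..r})"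
    by (rule Liminf_bounded)
  then have "0 < Liminf at_top (\<lambda>r::real. emeasure lborel {0..r} / emeasure lborel {- r..r})"
    by (rule less_le_trans[rotated]) (subst ennreal_less_zero_iff, simp)
  then show ?thesis
    using emeasure_bounded_finite by (auto simp: admissible_measure_def emeasure_lborel_UNIV)
qed

text \<open>The common core of the Weyl and Besicovitch cases. Both are measured by
  \<open>besicovitch_norm\<close>, which is the value of \<open>weyl_at\<close> at the origin;
  moving Z by t moves the centre of the Weyl seminorm to t.\<close>

lemma besicovitch_separated_not_decomposable:
  assumes c: "0 < c" and X: "\<And>t. sq_int M (X t)"
    and sep: "\<And>s t. 1 \<le> \<bar>s - t\<bar> \<Longrightarrow> c \<le> l2dist M (X s) (X t)"
    and sum: "is_sum M X Y Z" and Y: "loc_sq_int M Y" and Z: "loc_sq_int M Z"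
    and small: "\<And>T \<epsilon>. 0 < \<epsilon> \<Longrightarrow> \<exists>t\<ge>T. weyl_at M Z t < \<epsilon>"
    and aa: "\<And>t'. \<exists>\<rho> g. strict_mono (\<rho> :: nat \<Rightarrow> nat) \<and> loc_sq_int M g \<and>
      (\<lambda>n. besicovitch_norm M (pdiff (shift (t' (\<rho> n)) Y) g)) \<longlonglongrightarrow> 0"
  shows False
proof -
  define L where "L h \<longleftrightarrow> (\<forall>a b. strongly_measurable M (restrict_space lborel {a..b}) h)" for h
  have L: "L h" if "loc_sq_int M h" for h
    using that by (auto simp: L_def loc_sq_int_def intro: bochner_l2_strongly_measurable)
  show False
  proof (rule separated_not_decomposable[of M X c Y Z L "ennreal (c / 4)" "besicovitch_norm M",
        OF X sep sum])
    show "l2_process M h" if "L h" for h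
      unfolding l2_process_def
    proof
      fix t
      show "sq_int M (h t)"
        using that unfolding L_def strongly_measurable_def
        by (auto simp: space_restrict_space dest!: spec[of _ t] spec[of _ t])
    qed
    show "L (shift u h)" if "L h" for u h
      using that by (auto simp: L_def intro: strongly_measurable_shift)
    show "L (pdiff h g)" if "L h" "L g" for h g
      using that by (auto simp: L_def intro: strongly_measurable_pdiff)
    show "L Y" "L Z" by (intro L Y Z)+
    show "0 < ennreal (c / 4)" using c by simp
    show False
      if LABCD: "L A" "L B" "L C" "L D"
        and le: "\<And>s. c \<le> l2norm M (A s) + l2norm M (B s) + l2norm M (C s) + l2norm M (D s)"
        and N: "besicovitch_norm M A < ennreal (c / 4)" "besicovitch_norm M B < ennreal (c / 4)"
          "besicovitch_norm M C < ennreal (c / 4)" "besicovitch_norm M D < ennreal (c / 4)"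
      for A B C D
    proof -
      have ev: "\<forall>\<^sub>F r in at_top. quad_mean M h 0 r < ennreal (c / 4)"
        if "besicovitch_norm M h < ennreal (c / 4)" for h
        by (rule Limsup_lessD) (use that in \<open>simp add: besicovitch_norm_def\<close>)
      \<comment> \<open>An upper limit below c/4 holds for all large windows, so a single r serves
        all four terms; then 16 (c/4)^2 2r is c^2 times the length of the window.\<close>
      have "\<forall>\<^sub>F r in at_top. 0 < r \<and> quad_mean M A 0 r < ennreal (c / 4) \<and> quad_mean M B 0 r < ennreal (c / 4)
          \<and> quad_mean M C 0 r < ennreal (c / 4) \<and> quad_mean M D 0 r < ennreal (c / 4)"
        by (intro eventually_conj eventually_gt_at_top ev N)
      then obtain r where r: "0 < r" "quad_mean M A 0 r < ennreal (c / 4)" "quad_mean M B 0 r < ennreal (c / 4)"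
          "quad_mean M C 0 r < ennreal (c / 4)" "quad_mean M D 0 r < ennreal (c / 4)"
        by (auto simp: eventually_at_top_linorder)
      let ?m = "restrict_space lborel {- r..r}"
      have small: "(\<integral>\<^sup>+s. ennreal ((l2norm M (h s))\<^sup>2) \<partial>?m) < ennreal ((c / 4)\<^sup>2 * (2 * r))"
        if "quad_mean M h 0 r < ennreal (c / 4)" for h
      proof -
        let ?J = "\<integral>\<^sup>+s\<in>{- r..r}. ennreal ((l2norm M (h s))\<^sup>2) \<partial>lborel"
        have "?J / ennreal (2 * r) < ennreal ((c / 4)\<^sup>2)"
          using that c by (simp add: quad_mean_def ennreal_sqrt_less_iff)
        then have "?J < ennreal ((c / 4)\<^sup>2 * (2 * r))"
          using r(1) by (cases ?J) (auto simp: ennreal_top_divide divide_ennreal ennreal_less_iff field_simps)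
        then show ?thesis by (simp add: nn_integral_restrict_space)
      qed
      have meas: "strongly_measurable M ?m h" if "L h" for h using that by (simp add: L_def)
      have "ennreal (c\<^sup>2) * emeasure ?m (space ?m) < 16 * ennreal ((c / 4)\<^sup>2 * (2 * r))"
        by (rule strongly_measurable_lower_bound[OF meas meas meas meas less_imp_le[OF c] le small small small small])
           (fact LABCD r)+
      also have "\<dots> = ennreal (16 * ((c / 4)\<^sup>2 * (2 * r)))"
      proof -
        have "16 * ennreal x = ennreal (16 * x)" if "0 \<le> x" for x
          using that by (simp add: ennreal_mult)
        then show ?thesis using r(1) by simp
      qed
      also have "16 * ((c / 4)\<^sup>2 * (2 * r)) = c\<^sup>2 * (2 * r)"
        by (simp add: power_divide)
      also have "ennreal (c\<^sup>2 * (2 * r)) = ennreal (c\<^sup>2) * emeasure ?m (space ?m)"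
        using r(1) by (simp add: space_restrict_space emeasure_restrict_space ennreal_mult)
      finally show False by simp
    qed
    show "\<exists>t\<ge>T. besicovitch_norm M (shift t Z) < \<epsilon>" if "0 < \<epsilon>" for T \<epsilon>
    proof -
      have "quad_mean M (shift t Z) 0 r = quad_mean M Z t r" for t r
        using L[OF Z] by (intro quad_mean_shift) (simp add: L_def)
      then have "besicovitch_norm M (shift t Z) = weyl_at M Z t" for t
        by (simp add: besicovitch_norm_def weyl_at_def)
      with small[OF that] show ?thesis by simp
    qed
    show "\<exists>\<rho> g. strict_mono \<rho> \<and> L g \<and>
      (\<lambda>n. besicovitch_norm M (pdiff (shift (t' (\<rho> n)) Y) g)) \<longlonglongrightarrow> 0" for t' :: "nat \<Rightarrow> real"
      using aa[of t'] L by blast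
  qed
qed

lemma separated_not_weyl_pseudo_almost_automorphic:
  assumes c: "0 < c" and X: "\<And>t. sq_int M (X t)"
    and sep: "\<And>s t. 1 \<le> \<bar>s - t\<bar> \<Longrightarrow> c \<le> l2dist M (X s) (X t)"
  shows "\<not> weyl_pseudo_almost_automorphic M X"
proof
  assume "weyl_pseudo_almost_automorphic M X"
  then obtain Y Z where YZ: "is_sum M X Y Z"
      "N_almost_automorphic (loc_sq_int M) (weyl_at M) (weyl_norm M) Y"
      "N_ergodic (loc_sq_int M) (weyl_at M) (weyl_norm M) lborel Z"
    by (auto simp: weyl_pseudo_almost_automorphic_def)
  show False
  proof (rule besicovitch_separated_not_decomposable[OF c X sep YZ(1)])
    show "loc_sq_int M Y" "loc_sq_int M Z"
      using YZ(2,3) by (simp_all add: N_almost_automorphic_def N_ergodic_def)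
    show "\<exists>t\<ge>T. weyl_at M Z t < \<epsilon>" if "0 < \<epsilon>" for T \<epsilon>
      using mean_zero_small_values[OF admissible_lborel _ that] YZ(3) by (simp add: N_ergodic_def)
    \<comment> \<open>At the origin the Weyl and Besicovitch seminorms are the same upper
      limit.\<close>
    show "\<exists>\<rho> g. strict_mono \<rho> \<and> loc_sq_int M g \<and>
      (\<lambda>n. besicovitch_norm M (pdiff (shift (t' (\<rho> n)) Y) g)) \<longlonglongrightarrow> 0" for t' :: "nat \<Rightarrow> real"
      using N_almost_automorphic_at_origin[OF YZ(2), of t']
      by (simp add: weyl_at_def besicovitch_norm_def)
  qed
qed

lemma separated_not_besicovitch_pseudo_almost_automorphic:
  assumes c: "0 < c" and X: "\<And>t. sq_int M (X t)"
    and sep: "\<And>s t. 1 \<le> \<bar>s - t\<bar> \<Longrightarrow> c \<le> l2dist M (X s) (X t)"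
  shows "\<not> besicovitch_pseudo_almost_automorphic M X"
proof
  assume "besicovitch_pseudo_almost_automorphic M X"
  then obtain Y Z where YZ: "is_sum M X Y Z"
      "N_almost_automorphic (loc_sq_int M) (besicovitch_at M) (besicovitch_norm M) Y"
      "N_ergodic (loc_sq_int M) (besicovitch_at M) (besicovitch_norm M) lborel Z"
    by (auto simp: besicovitch_pseudo_almost_automorphic_def)
  show False
  proof (rule besicovitch_separated_not_decomposable[OF c X sep YZ(1)])
    show "loc_sq_int M Y" "loc_sq_int M Z"
      using YZ(2,3) by (simp_all add: N_almost_automorphic_def N_ergodic_def)
    show "\<exists>t\<ge>T. weyl_at M Z t < \<epsilon>" if \<epsilon>: "0 < \<epsilon>" for T \<epsilon>
    proof -
      \<comment> \<open>The 2 anticipates the loss in \<open>weyl_at_le\<close>.\<close>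
      obtain e where e: "0 < e" "ennreal (2 * e) < \<epsilon>"
      proof -
        obtain y where y: "0 < y" "y < \<epsilon>" using dense[OF \<epsilon>] by blast
        then obtain r where "y = ennreal r" "0 < r" by (cases y) auto
        with y that[of "r / 2"] show thesis by simp
      qed
      \<comment> \<open>\<open>besicovitch_at M Z\<close> is constant in t, so one small value
        bounds the norm itself.\<close>
      have "besicovitch_norm M Z < ennreal e"
        using mean_zero_small_values[OF admissible_lborel, of "besicovitch_at M Z" "ennreal e" T] YZ(3) e
        by (auto simp: N_ergodic_def besicovitch_at_def)
      from weyl_at_le[OF this e(1)] e(2) show ?thesis by (auto intro: le_less_trans)
    qed
    show "\<exists>\<rho> g. strict_mono \<rho> \<and> loc_sq_int M g \<and>
      (\<lambda>n. besicovitch_norm M (pdiff (shift (t' (\<rho> n)) Y) g)) \<longlonglongrightarrow> 0" for t' :: "nat \<Rightarrow> real"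
      using N_almost_automorphic_at_origin[OF YZ(2), of t'] by (simp add: besicovitch_at_def)
  qed
qed


section \<open>The Ornstein-Uhlenbeck process\<close>

context wiener_space
begin

lemma has_wiener_integral_sum:
  assumes "finite J" "\<And>t. has_wiener_integral M W (\<psi> t) (X t)"
  shows "has_wiener_integral M W (\<lambda>s. \<Sum>t\<in>J. c t * \<psi> t s) (\<lambda>\<omega>. \<Sum>t\<in>J. c t * X t \<omega>)"
  using assms(1)
proof induction
  case empty
  have "step_fun [] = (\<lambda>s. 0)" "step_integral W [] = (\<lambda>\<omega>. 0)" by auto
  then show ?case using has_wiener_integral_step[of "[]"] by simp
next
  case (insert t J)
  from has_wiener_integral_lincomb[OF assms(2)[of t] insert.IH, of "c t" 1] insert.hyps
  show ?case by simp
qed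

text \<open>A finite linear combination of the X(t) is again a Wiener integral, of the same
  combination of integrands.\<close>

lemma gaussian_process_wiener:
  assumes "\<And>t. has_wiener_integral M W (\<psi> t) (X t)"
  shows "gaussian_process M X"
  using wiener_integral_gaussian[OF has_wiener_integral_sum[where X = X and \<psi> = \<psi>, OF _ assms]]
  by (simp add: gaussian_process_def)

text \<open>The continuous version is defined pathwise from \<open>B\<close> and \<open>P\<close>,
  and the equation for it is calculus. The probabilistic part is that it agrees almost surely with X
  at each t, by uniqueness of Wiener integrals.\<close>

lemma ou_sde_solution:
  assumes \<alpha>: "0 < \<alpha>" and X: "\<And>t. X t \<in> borel_measurable M"
    and wi: "\<And>t. has_wiener_integral M W (\<lambda>s. q * ou_kernel \<alpha> t s) (X t)"
  shows "sde_solution M W (- \<alpha>) q X"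
proof -
  obtain B P where B: "\<And>t. B t \<in> borel_measurable M" "\<And>\<omega>. continuous_on UNIV (\<lambda>t. B t \<omega>)"
    "AE \<omega> in M. \<forall>t. B t \<omega> = W t \<omega>"
    and P: "\<And>\<omega> s. (P \<omega> has_real_derivative exp (\<alpha> * s) * B s \<omega>) (at s)"
    by (rule continuous_modification) blast
  define V where "V a t \<omega> = B t \<omega> - exp (- \<alpha> * (t - a)) * B a \<omega> - \<alpha> * exp (- \<alpha> * t) * (P \<omega> t - P \<omega> a)"
    for a t \<omega>
  have V: "has_wiener_integral M W (ou_window \<alpha> a t) (V a t)" if "a \<le> t" for a t
    using has_wiener_integral_ou_window[OF \<alpha> that B P] by (simp add: V_def[abs_def])
  have [measurable]: "V a t \<in> borel_measurable M" if "a \<le> t" for a t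
    using has_wiener_integral_sq_int(2)[OF V[OF that]] by (rule sq_int_measurable)
  \<comment> \<open>The splitting of the kernel at a, read for the integrals.\<close>
  have step: "AE \<omega> in M. X t \<omega> = q * V a t \<omega> + exp (- \<alpha> * (t - a)) * X a \<omega>" if "a \<le> t" for a t
  proof (rule has_wiener_integral_unique[OF wi])
    have "(\<lambda>s. q * ou_kernel \<alpha> t s)
        = (\<lambda>s. q * ou_window \<alpha> a t s + exp (- \<alpha> * (t - a)) * (q * ou_kernel \<alpha> a s))"
      using ou_kernel_split[OF that, of \<alpha>] by (auto simp: algebra_simps)
    then show "has_wiener_integral M W (\<lambda>s. q * ou_kernel \<alpha> t s)
        (\<lambda>\<omega>. q * V a t \<omega> + exp (- \<alpha> * (t - a)) * X a \<omega>)"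
      using has_wiener_integral_lincomb[OF V[OF that] wi[of a], of q "exp (- \<alpha> * (t - a))"] by simp
  qed
  \<comment> \<open>The constant that gives X'(0) = X(0).\<close>
  define C where "C \<omega> = X 0 \<omega> - q * B 0 \<omega> + \<alpha> * q * P \<omega> 0" for \<omega>
  define X' where "X' t \<omega> = exp (- \<alpha> * t) * (C \<omega> - \<alpha> * q * P \<omega> t) + q * B t \<omega>" for t \<omega>
  \<comment> \<open>Measurability of X'(t) and its agreement with X(t) come from \<open>V\<close>
    over the interval between 0 and t: directly for t \<ge> 0, and for t < 0 by solving the relation
    between X(t) and X(0) backwards.\<close>
  have pos: "X' t \<omega> = q * V 0 t \<omega> + exp (- \<alpha> * t) * X 0 \<omega>" for t \<omega>
    by (simp add: X'_def C_def V_def algebra_simps)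
  have neg: "X' t \<omega> = exp (- \<alpha> * t) * (X 0 \<omega> - q * V t 0 \<omega>)" for t \<omega>
  proof -
    have "exp (- \<alpha> * t) * exp (\<alpha> * t) = 1" by (simp flip: exp_add)
    then have "exp (- \<alpha> * t) * (X 0 \<omega> - q * V t 0 \<omega>)
        = exp (- \<alpha> * t) * (X 0 \<omega> - q * B 0 \<omega> + \<alpha> * q * P \<omega> 0 - \<alpha> * q * P \<omega> t)
          + (exp (- \<alpha> * t) * exp (\<alpha> * t)) * (q * B t \<omega>)"
      by (simp add: V_def algebra_simps del: exp_minus_inverse)
    also have "\<dots> = X' t \<omega>" using \<open>exp (- \<alpha> * t) * exp (\<alpha> * t) = 1\<close> by (simp only: X'_def C_def mult_1)
    finally show ?thesis by simp
  qed
  have meas: "X' t \<in> borel_measurable M" for t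
  proof (cases "0 \<le> t")
    case True
    have "(\<lambda>\<omega>. q * V 0 t \<omega> + exp (- \<alpha> * t) * X 0 \<omega>) \<in> borel_measurable M"
      using X[of 0] True by measurable
    then show ?thesis by (simp add: pos[abs_def])
  next
    case False
    then have [measurable]: "V t 0 \<in> borel_measurable M" by simp
    have "(\<lambda>\<omega>. exp (- \<alpha> * t) * (X 0 \<omega> - q * V t 0 \<omega>)) \<in> borel_measurable M"
      using X[of 0] by measurable
    then show ?thesis unfolding neg[abs_def] .
  qed
  have eq: "AE \<omega> in M. X' t \<omega> = X t \<omega>" for t
  proof (cases "0 \<le> t")
    case True
    from step[OF this] show ?thesis by eventually_elim (simp add: pos)
  next
    case False
    then have "t \<le> 0" by simp
    from step[OF this] show ?thesis
    proof eventually_elim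
      case (elim \<omega>)
      have "exp (- \<alpha> * t) * exp (\<alpha> * t) = 1" by (simp flip: exp_add)
      have "X' t \<omega> = exp (- \<alpha> * t) * (exp (\<alpha> * t) * X t \<omega>)" unfolding neg using elim by simp
      also have "\<dots> = X t \<omega>"
        using \<open>exp (- \<alpha> * t) * exp (\<alpha> * t) = 1\<close> by (simp only: mult.assoc[symmetric] mult_1)
      finally show ?case .
    qed
  qed
  \<comment> \<open>The differentiated function is X' - q B. In its derivative the factor of P'
    cancels the exponential, leaving -\<alpha> q B(s), which completes -\<alpha> X'(s).\<close>
  have deriv: "((\<lambda>s. exp (- \<alpha> * s) * (C \<omega> - \<alpha> * q * P \<omega> s)) has_real_derivative - \<alpha> * X' s \<omega>) (at s)" for \<omega> s
  proof -
    have "((\<lambda>s. exp (- \<alpha> * s) * (C \<omega> - \<alpha> * q * P \<omega> s)) has_real_derivative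
        (- \<alpha> * exp (- \<alpha> * s)) * (C \<omega> - \<alpha> * q * P \<omega> s)
          + exp (- \<alpha> * s) * (- \<alpha> * q * (exp (\<alpha> * s) * B s \<omega>))) (at s)"
      by (auto intro!: derivative_eq_intros P)
    moreover have "exp (- \<alpha> * s) * (- \<alpha> * q * (exp (\<alpha> * s) * B s \<omega>))
        = - \<alpha> * q * B s \<omega>"
    proof -
      have "exp (- \<alpha> * s) * exp (\<alpha> * s) = 1" by (simp flip: exp_add)
      then have "(exp (- \<alpha> * s) * exp (\<alpha> * s)) * (- \<alpha> * q * B s \<omega>) = - \<alpha> * q * B s \<omega>" by (simp only: mult_1)
      then show ?thesis by (simp only: mult_ac)
    qed
    ultimately show ?thesis
      by (elim DERIV_cong) (simp add: X'_def algebra_simps)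
  qed
  have cont: "continuous_on UNIV (\<lambda>t. X' t \<omega>)" for \<omega>
    unfolding X'_def
    by (intro continuous_on_add continuous_on_mult continuous_on_const B(2)
        DERIV_continuous_on[OF DERIV_subset[OF deriv]]) auto
  have integral: "X' t \<omega> - X' s \<omega> = integral {s..t} (\<lambda>r. - \<alpha> * X' r \<omega>) + q * (B t \<omega> - B s \<omega>)"
    if "s \<le> t" for s t \<omega>
  proof -
    have "((\<lambda>r. - \<alpha> * X' r \<omega>) has_integral
        exp (- \<alpha> * t) * (C \<omega> - \<alpha> * q * P \<omega> t) - exp (- \<alpha> * s) * (C \<omega> - \<alpha> * q * P \<omega> s)) {s..t}"
      using that deriv
      by (intro fundamental_theorem_of_calculus)
         (auto simp: has_real_derivative_iff_has_vector_derivative[symmetric] intro: DERIV_subset)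
    from integral_unique[OF this] show ?thesis by (simp add: X'_def algebra_simps)
  qed
  have "AE \<omega> in M. continuous_on UNIV (\<lambda>t. X' t \<omega>) \<and>
      (\<forall>s t. s \<le> t \<longrightarrow> X' t \<omega> - X' s \<omega> = integral {s..t} (\<lambda>r. - \<alpha> * X' r \<omega>) + q * (W t \<omega> - W s \<omega>))"
    using B(3) by eventually_elim (use cont integral in simp)
  with X meas eq show ?thesis unfolding sde_solution_def by blast
qed

end

section \<open>Uniqueness among bounded solutions\<close>

text \<open>The noise cancels in the difference of two solutions, which therefore decays exponentially.\<close>

lemma linear_integral_equation:
  fixes D :: "real \<Rightarrow> real"
  assumes cont: "continuous_on UNIV D" and st: "s \<le> t"
    and eq: "\<And>r. s \<le> r \<Longrightarrow> D r - D s = integral {s..r} (\<lambda>u. p * D u)"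
  shows "D t = exp (p * (t - s)) * D s"
proof -
  have D': "(D has_real_derivative p * D r) (at r within {s..t})" if "r \<in> {s..t}" for r
  proof -
    have "((\<lambda>r. integral {s..r} (\<lambda>u. p * D u)) has_real_derivative p * D r) (at r within {s..t})"
      using that by (intro integral_has_real_derivative continuous_intros continuous_on_subset[OF cont]) auto
    from DERIV_add[OF DERIV_const[of "D s"] this]
    have "((\<lambda>r. D s + integral {s..r} (\<lambda>u. p * D u)) has_real_derivative p * D r) (at r within {s..t})"
      by simp
    moreover have "D s + integral {s..x} (\<lambda>u. p * D u) = D x" if "x \<in> {s..t}" for x
      using eq[of x] that by simp
    ultimately show ?thesis
      using has_field_derivative_transform_within[OF _ zero_less_one that] by blast
  qed
  \<comment> \<open>Integrating factor: this product is constant on the segment.\<close>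
  have "((\<lambda>r. exp (- p * r) * D r) has_real_derivative 0) (at r within {s..t})" if "r \<in> {s..t}" for r
    by (rule derivative_eq_intros D' that refl | simp add: algebra_simps)+
  from has_field_derivative_zero_constant[OF convex_real_interval(5) this]
  obtain c where c: "\<And>r. r \<in> {s..t} \<Longrightarrow> exp (- p * r) * D r = c" by blast
  have "exp (- p * t) * D t = exp (- p * s) * D s" using c[of s] c[of t] st by simp
  then have "exp (p * t) * (exp (- p * t) * D t) = exp (p * t) * (exp (- p * s) * D s)" by simp
  then show ?thesis by (simp add: mult.assoc[symmetric] right_diff_distrib flip: exp_add)
qed

lemma sde_solution_difference:
  assumes "sde_solution M W p q U" "sde_solution M W p q X" "s \<le> t"
  shows "AE \<omega> in M. U t \<omega> - X t \<omega> = exp (p * (t - s)) * (U s \<omega> - X s \<omega>)"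
proof -
  obtain U' where U': "\<forall>t. AE \<omega> in M. U' t \<omega> = U t \<omega>"
    "AE \<omega> in M. continuous_on UNIV (\<lambda>t. U' t \<omega>) \<and> (\<forall>s t. s \<le> t \<longrightarrow>
        U' t \<omega> - U' s \<omega> = integral {s..t} (\<lambda>r. p * U' r \<omega>) + q * (W t \<omega> - W s \<omega>))"
    using assms(1) unfolding sde_solution_def by (elim conjE exE)
  obtain X' where X': "\<forall>t. AE \<omega> in M. X' t \<omega> = X t \<omega>"
    "AE \<omega> in M. continuous_on UNIV (\<lambda>t. X' t \<omega>) \<and> (\<forall>s t. s \<le> t \<longrightarrow>
        X' t \<omega> - X' s \<omega> = integral {s..t} (\<lambda>r. p * X' r \<omega>) + q * (W t \<omega> - W s \<omega>))"
    using assms(2) unfolding sde_solution_def by (elim conjE exE)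
  show ?thesis
    using U'(2) X'(2) U'(1)[THEN spec, of s] U'(1)[THEN spec, of t]
      X'(1)[THEN spec, of s] X'(1)[THEN spec, of t]
  proof eventually_elim
    case (elim \<omega>)
    have cont: "continuous_on A (\<lambda>t. U' t \<omega>)" "continuous_on A (\<lambda>t. X' t \<omega>)" for A
      using elim(1,2) by (auto intro: continuous_on_subset)
    let ?D = "\<lambda>t. U' t \<omega> - X' t \<omega>"
    have "?D t = exp (p * (t - s)) * ?D s"
    proof (rule linear_integral_equation[OF _ assms(3)])
      show "continuous_on UNIV ?D" by (intro continuous_intros cont)
      fix r assume "s \<le> r"
      have "integral {s..r} (\<lambda>u. p * ?D u) = integral {s..r} (\<lambda>u. p * U' u \<omega> - p * X' u \<omega>)"
        by (simp add: right_diff_distrib)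
      also have "\<dots> = integral {s..r} (\<lambda>u. p * U' u \<omega>) - integral {s..r} (\<lambda>u. p * X' u \<omega>)"
        by (intro Henstock_Kurzweil_Integration.integral_diff integrable_continuous_interval continuous_intros cont)
      finally have int: "integral {s..r} (\<lambda>u. p * ?D u)
          = integral {s..r} (\<lambda>u. p * U' u \<omega>) - integral {s..r} (\<lambda>u. p * X' u \<omega>)" .
      have "U' r \<omega> - U' s \<omega> = integral {s..r} (\<lambda>u. p * U' u \<omega>) + q * (W r \<omega> - W s \<omega>)"
        "X' r \<omega> - X' s \<omega> = integral {s..r} (\<lambda>u. p * X' u \<omega>) + q * (W r \<omega> - W s \<omega>)"
        using elim(1,2) \<open>s \<le> r\<close> by simp_all
      then show "?D r - ?D s = integral {s..r} (\<lambda>u. p * ?D u)" unfolding int by linarith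
    qed
    with elim(3-) show ?case by simp
  qed
qed

text \<open>The relation between times t - n and t is used backwards: the difference at t is
  exp(-\<alpha> n) times a difference whose norm is bounded uniformly in n, so it must
  vanish.\<close>

lemma bounded_sde_solution_unique:
  assumes \<alpha>: "0 < \<alpha>" and U: "sde_solution M W (- \<alpha>) q U" "l2_bounded M U"
    and X: "sde_solution M W (- \<alpha>) q X" "l2_bounded M X"
  shows "AE \<omega> in M. U t \<omega> = X t \<omega>"
proof -
  have sq: "sq_int M (U s)" "sq_int M (X s)" for s
    using U(2) X(2) by (simp_all add: l2_bounded_def l2_process_def)
  obtain b c where bc: "\<And>s. l2norm M (U s) \<le> b" "\<And>s. l2norm M (X s) \<le> c"
    using U(2) X(2) by (auto simp: l2_bounded_def)
  have le: "l2dist M (U t) (X t) \<le> exp (- \<alpha> * real n) * (b + c)" for n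
  proof -
    let ?s = "t - real n"
    have [measurable]: "U s \<in> borel_measurable M" "X s \<in> borel_measurable M" for s
      using sq by (simp_all add: sq_int_def)
    have "AE \<omega> in M. U t \<omega> - X t \<omega> = exp (- \<alpha> * real n) * (U ?s \<omega> - X ?s \<omega>)"
      using sde_solution_difference[OF U(1) X(1), of ?s t] by simp
    then have "l2dist M (U t) (X t) = l2norm M (\<lambda>\<omega>. exp (- \<alpha> * real n) * (U ?s \<omega> - X ?s \<omega>))"
      unfolding l2dist_def by (intro l2norm_cong_AE) measurable
    also have "\<dots> = exp (- \<alpha> * real n) * l2norm M (\<lambda>\<omega>. U ?s \<omega> - X ?s \<omega>)"
      by (simp add: l2norm_cmult)
    also have "\<dots> \<le> exp (- \<alpha> * real n) * (b + c)"
      using l2norm_diff_le[OF sq(1)[of ?s] sq(2)[of ?s]] bc(1)[of ?s] bc(2)[of ?s]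
      by (intro mult_left_mono) auto
    finally show ?thesis .
  qed
  have "(\<lambda>n. exp (- \<alpha>) ^ n * (b + c)) \<longlonglongrightarrow> 0"
    using \<alpha> by (intro tendsto_mult_left_zero LIMSEQ_realpow_zero) auto
  moreover have "exp (- \<alpha>) ^ n = exp (- \<alpha> * real n)" for n
    by (simp add: mult.commute flip: exp_of_nat_mult)
  ultimately have "(\<lambda>n. exp (- \<alpha> * real n) * (b + c)) \<longlonglongrightarrow> 0" by simp
  then have "l2dist M (U t) (X t) \<le> 0" by (rule LIMSEQ_le_const) (use le in auto)
  then have "l2norm M (\<lambda>\<omega>. U t \<omega> - X t \<omega>) = 0"
    by (intro antisym) (simp_all add: l2dist_def)
  from l2norm_eq_0_AE[OF sq_int_diff[OF sq] this] show ?thesis by simp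
qed

text \<open>Along times where the norm exceeds n no subsequence of values can converge. Hence a
  pseudo almost automorphic solution is L2-bounded and uniqueness identifies it with X.\<close>

lemma sm_almost_automorphic_bounded:
  assumes "sm_almost_automorphic M Y"
  shows "l2_bounded M Y"
proof (rule ccontr)
  have sq: "sq_int M (Y t)" for t
    using assms by (simp add: sm_almost_automorphic_def l2_continuous_def l2_process_def)
  assume "\<not> l2_bounded M Y"
  then have "\<exists>t. real n < l2norm M (Y t)" for n
    using sq by (auto simp: l2_bounded_def l2_process_def not_le)
  then obtain t' where t': "\<And>n. real n < l2norm M (Y (t' n))" by metis
  obtain \<rho> G where \<rho>: "strict_mono (\<rho> :: nat \<Rightarrow> nat)" and G: "l2_process M G"
    and conv: "(\<lambda>n. l2dist M (Y (0 + t' (\<rho> n))) (G 0)) \<longlonglongrightarrow> 0"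
    using assms unfolding sm_almost_automorphic_def by blast
  have "(\<lambda>n. l2norm M (Y (0 + t' (\<rho> n)))) \<longlonglongrightarrow> l2norm M (G 0)"
    using G by (intro tendsto_l2norm sq conv) (simp add: l2_process_def)
  then have "Bseq (\<lambda>n. l2norm M (Y (0 + t' (\<rho> n))))" by (intro convergent_imp_Bseq convergentI)
  then obtain K where K: "\<And>n. l2norm M (Y (t' (\<rho> n))) \<le> K" by (auto simp: Bseq_def)
  obtain n where "K < real n" using reals_Archimedean2 by blast
  moreover have "real n \<le> real (\<rho> n)" using seq_suble[OF \<rho>] by simp
  ultimately show False using K[of n] t'[of "\<rho> n"] by linarith
qed

lemma sm_pseudo_almost_automorphic_bounded:
  assumes "sm_pseudo_almost_automorphic M \<mu> X"
  shows "l2_bounded M X"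
proof -
  obtain Y Z where YZ: "is_sum M X Y Z" "sm_almost_automorphic M Y" "sm_ergodic M \<mu> Z"
    and X: "\<And>t. sq_int M (X t)"
    using assms by (auto simp: sm_pseudo_almost_automorphic_def l2_process_def)
  have "l2_bounded M Y" "l2_bounded M Z"
    using YZ(2,3) by (auto simp: sm_ergodic_def intro: sm_almost_automorphic_bounded)
  then obtain b c where bc: "\<And>s. l2norm M (Y s) \<le> b" "\<And>s. l2norm M (Z s) \<le> c"
    and sq: "\<And>s. sq_int M (Y s)" "\<And>s. sq_int M (Z s)"
    by (auto simp: l2_bounded_def l2_process_def)
  have "l2norm M (X t) \<le> b + c" for t
  proof -
    have "l2norm M (X t) = l2norm M (\<lambda>\<omega>. Y t \<omega> + Z t \<omega>)"
      using YZ(1) by (intro l2norm_cong_AE sq_int_measurable[OF X] sq_int_measurable[OF sq_int_add[OF sq]])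
        (simp add: is_sum_def)
    with l2norm_triangle[OF sq(1)[of t] sq(2)[of t]] bc(1)[of t] bc(2)[of t] show ?thesis by linarith
  qed
  with X show ?thesis by (auto simp: l2_bounded_def l2_process_def)
qed

lemma sm_pseudo_almost_automorphic_cong_AE:
  assumes "sm_pseudo_almost_automorphic M \<mu> U" "l2_process M X" "\<And>t. AE \<omega> in M. U t \<omega> = X t \<omega>"
  shows "sm_pseudo_almost_automorphic M \<mu> X"
proof -
  obtain Y Z where YZ: "is_sum M U Y Z" "sm_almost_automorphic M Y" "sm_ergodic M \<mu> Z"
    using assms(1) by (auto simp: sm_pseudo_almost_automorphic_def)
  have "AE \<omega> in M. X t \<omega> = Y t \<omega> + Z t \<omega>" for t
    using assms(3)[of t] YZ(1)[unfolded is_sum_def, rule_format, of t] by eventually_elim simp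
  with YZ(2,3) assms(2) show ?thesis
    unfolding sm_pseudo_almost_automorphic_def is_sum_def by blast
qed

theorem mainTheorem3:
  fixes M :: "'a measure" and W X :: "real \<Rightarrow> 'a \<Rightarrow> real" and \<alpha> \<sigma> :: real
  assumes "prob_space M"
    and "brownian_motion M W"
    and "\<alpha> > 0" and "\<sigma> > 0"
    and "\<And>t. X t \<in> borel_measurable M"
    and "\<And>t. AE \<omega> in M. X t \<omega> = sqrt (2 * \<alpha>) * \<sigma> *
           wiener_integral M W (\<lambda>s. indicator {..t} s * exp (- \<alpha> * (t - s))) \<omega>"
  shows "sde_solution M W (- \<alpha>) (sqrt (2 * \<alpha>) * \<sigma>) X \<and> l2_bounded M X \<and>
     (\<forall>X'. sde_solution M W (- \<alpha>) (sqrt (2 * \<alpha>) * \<sigma>) X' \<and> l2_bounded M X' \<longrightarrow>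
        (\<forall>t. AE \<omega> in M. X' t \<omega> = X t \<omega>)) \<and>
     gaussian_process M X \<and>
     (\<forall>t. expect M (X t) = 0) \<and>
     (\<forall>t \<tau>. \<tau> \<ge> 0 \<longrightarrow> covariance M (X t) (X (t + \<tau>)) = \<sigma>\<^sup>2 * exp (- \<alpha> * \<tau>)) \<and>
     (\<forall>\<mu>. admissible_measure \<mu> \<longrightarrow>
        \<not> sm_pseudo_almost_automorphic M \<mu> X \<and>
        \<not> (\<exists>U. sde_solution M W (- \<alpha>) (sqrt (2 * \<alpha>) * \<sigma>) U \<and>
                sm_pseudo_almost_automorphic M \<mu> U)) \<and>
     \<not> weyl_pseudo_almost_automorphic M X \<and>
     \<not> besicovitch_pseudo_almost_automorphic M X \<and>
     (\<forall>\<mu> \<nu>. admissible_measure \<mu> \<and>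
        sets \<nu> = sets (restrict_space borel {0..1::real}) \<and>
        0 < emeasure \<nu> {0..1} \<and> emeasure \<nu> {0..1} < \<infinity> \<longrightarrow>
        \<not> stepanov_pseudo_almost_automorphic M \<nu> \<mu> X)"
proof -
  interpret wiener_space M W
    using assms(1,2) by (simp add: wiener_space_def wiener_space_axioms_def)
  note \<alpha> = assms(3) and \<sigma> = assms(4)
  let ?q = "sqrt (2 * \<alpha>) * \<sigma>"
  have wi: "has_wiener_integral M W (\<lambda>s. ?q * ou_kernel \<alpha> t s) (X t)" for t
  proof (rule has_wiener_integral_cong_AE)
    note I = has_wiener_integral_ou_kernel[OF \<alpha>, of t]
    show "has_wiener_integral M W (\<lambda>s. ?q * ou_kernel \<alpha> t s)
        (\<lambda>\<omega>. ?q * wiener_integral M W (ou_kernel \<alpha> t) \<omega>)"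
      \<comment> \<open>The scalar multiple is a linear combination of I with itself with second
        coefficient 0.\<close>
      using has_wiener_integral_lincomb[OF I I, of ?q 0] by simp
    show "AE \<omega> in M. ?q * wiener_integral M W (ou_kernel \<alpha> t) \<omega> = X t \<omega>"
      using assms(6)[of t] unfolding ou_kernel_def by eventually_elim simp
  qed (rule assms(5))
  note sq = has_wiener_integral_sq_int(2)[OF wi] and mean = wiener_expectation[OF wi]
  have inner: "expectation (\<lambda>\<omega>. X t \<omega> * X u \<omega>) = \<sigma>\<^sup>2 * exp (- \<alpha> * (u - t))" if "t \<le> u" for t u
  proof -
    have "expectation (\<lambda>\<omega>. X t \<omega> * X u \<omega>) = (\<integral>s. ?q\<^sup>2 * (ou_kernel \<alpha> t s * ou_kernel \<alpha> u s) \<partial>lborel)"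
      unfolding wiener_inner[OF wi wi]
      by (intro Bochner_Integration.integral_cong) (simp_all only: power2_eq_square mult_ac)
    also have "\<dots> = ?q\<^sup>2 * (exp (- \<alpha> * (u - t)) / (2 * \<alpha>))"
      by (simp only: integral_mult_right_zero ou_kernel_inner[OF \<alpha> that])
    also have "\<dots> = \<sigma>\<^sup>2 * exp (- \<alpha> * (u - t))"
      using \<alpha> by (simp add: power_mult_distrib)
    finally show ?thesis .
  qed
  have norm: "(l2norm M (X t))\<^sup>2 = \<sigma>\<^sup>2" for t
    unfolding l2norm_power2 using inner[of t t] by (simp add: power2_eq_square)
  then have "l2norm M (X t) = \<sigma>" for t
    using \<sigma> by (metis l2norm_nonneg less_imp_le power2_eq_iff_nonneg)
  then have bounded: "l2_bounded M X"
    using sq by (auto simp: l2_bounded_def l2_process_def)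
  \<comment> \<open>The squared distance of X(t) and X(u) is 2 \<sigma>^2 (1 - exp(-\<alpha> |u -
    t|)), which increases with |u - t|; c is the distance at time lag 1.\<close>
  define c where "c = sqrt (2 * \<sigma>\<^sup>2 * (1 - exp (- \<alpha>)))"
  have c: "0 < c" using \<alpha> \<sigma> by (simp add: c_def)
  have sep': "c \<le> l2dist M (X t) (X u)" if "t + 1 \<le> u" for t u
  proof -
    have "(l2dist M (X t) (X u))\<^sup>2
        = expectation (\<lambda>\<omega>. (X t \<omega>)\<^sup>2 - 2 * (X t \<omega> * X u \<omega>) + (X u \<omega>)\<^sup>2)"
      unfolding l2dist_def l2norm_power2
      by (intro Bochner_Integration.integral_cong) (auto simp: power2_eq_square algebra_simps)
    also have "\<dots> = (l2norm M (X t))\<^sup>2 - 2 * expectation (\<lambda>\<omega>. X t \<omega> * X u \<omega>) + (l2norm M (X u))\<^sup>2"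
      using sq[of t] sq[of u] sq_int_integrable_mult[OF sq[of t] sq[of u]]
      by (simp add: l2norm_power2 sq_int_def)
    also have "\<dots> = 2 * \<sigma>\<^sup>2 * (1 - exp (- \<alpha> * (u - t)))"
      using that by (simp add: norm inner algebra_simps)
    finally have dist: "(l2dist M (X t) (X u))\<^sup>2 = 2 * \<sigma>\<^sup>2 * (1 - exp (- \<alpha> * (u - t)))" .
    have "exp (- \<alpha> * (u - t)) \<le> exp (- \<alpha>)"
      using \<alpha> that mult_left_mono[of 1 "u - t" \<alpha>] by simp
    then have "2 * \<sigma>\<^sup>2 * (1 - exp (- \<alpha>)) \<le> (l2dist M (X t) (X u))\<^sup>2"
      unfolding dist by (intro mult_left_mono) auto
    then show ?thesis unfolding c_def by (intro real_le_lsqrt) auto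
  qed
  have sep: "c \<le> l2dist M (X s) (X t)" if "1 \<le> \<bar>s - t\<bar>" for s t
    using that sep'[of s t] sep'[of t s] l2dist_commute[of M "X s" "X t"] by linarith
  note solution = ou_sde_solution[OF \<alpha> assms(5) wi]
  have no_sm: "\<not> sm_pseudo_almost_automorphic M \<mu> X" if "admissible_measure \<mu>" for \<mu>
    by (rule separated_not_sm_pseudo_almost_automorphic[OF that c sq sep])
  have unique: "AE \<omega> in M. U t \<omega> = X t \<omega>" if "sde_solution M W (- \<alpha>) ?q U" "l2_bounded M U" for U t
    by (rule bounded_sde_solution_unique[OF \<alpha> that solution bounded])
  have no_solution: "\<not> sm_pseudo_almost_automorphic M \<mu> U"
    if "admissible_measure \<mu>" "sde_solution M W (- \<alpha>) ?q U" for \<mu> U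
  proof
    assume U: "sm_pseudo_almost_automorphic M \<mu> U"
    have "sm_pseudo_almost_automorphic M \<mu> X"
      using bounded
      by (intro sm_pseudo_almost_automorphic_cong_AE[OF U]
          unique[OF that(2) sm_pseudo_almost_automorphic_bounded[OF U]])
         (simp add: l2_bounded_def)
    with no_sm[OF that(1)] show False by simp
  qed
  have cov: "covariance M (X t) (X (t + \<tau>)) = \<sigma>\<^sup>2 * exp (- \<alpha> * \<tau>)" if "0 \<le> \<tau>" for t \<tau>
    using inner[of t "t + \<tau>"] that by (simp add: covariance_def expect_def mean)
  show ?thesis
    using solution bounded unique gaussian_process_wiener[OF wi] mean cov no_sm no_solution
      separated_not_weyl_pseudo_almost_automorphic[OF c sq sep]
      separated_not_besicovitch_pseudo_almost_automorphic[OF c sq sep]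
      separated_not_stepanov_pseudo_almost_automorphic[OF _ _ _ _ c sq sep]
    by (auto simp: expect_def)
qed

end
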